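(* Let $Y$ be a closed oriented manifold, $P:\mathcal M_Y^{\mathrm{op}}\to\widehat{\mathrm{Cart}}$ a $\widehat{\mathrm{Cart}}$-enriched functor, $n\in\mathbb N_0$, and let $F\in\mathcal H_{\infty,n}=\mathrm{Fun}(\mathrm{Cart}^{\mathrm{op}},\mathrm{CSS}_n)$ be projectively fibrant. There are (weakly) inverse weak equivalences $$F(P)^{\mathrm D(Y)}_{red}\rightleftarrows F(P)^{coh}_{red}.$$
   Context: Fix Grothendieck universes $\mathrm S\in\mathrm L\in\mathrm{XL}$ (small, large, extra large sets). $\mathrm{Cart}$ is the small category of submanifolds of $\mathbb R^\infty$ diffeomorphic to some $\mathbb R^n$, with smooth maps; $\widehat{\mathrm{Cart}}=\mathrm{Fun}(\mathrm{Cart}^{\mathrm{op}},\mathrm{Set}_{\mathrm S})$, with Yoneda embedding $\mathcal Y$. For oriented manifolds $X,X'$, $\mathrm D(X,X')\in\widehat{\mathrm{Cart}}$ is the presheaf whose value on $c$ is the set of smooth maps $\varphi:c\times X\to X'$ such that each $\varphi(x,-)$, $x\in c$, is an orientation-preserving diffeomorphism and the map of pointwise inverses is smooth; $\mathrm D(Y)=\mathrm D(Y,Y)$. $\mathcal M_Y$ is the connected component of $Y$ in the groupoid of oriented manifolds and orientation-preserving diffeomorphisms, regarded as a $\widehat{\mathrm{Cart}}$-enriched category with mapping objects $\mathrm D(Y_0,Y_1)$ (its collection of objects is treated as a small set so that coproducts over it exist in $\widehat{\mathrm{Cart}}$). $P/\!/\mathcal M_Y$ here denotes the simplicial object in $\widehat{\mathrm{Cart}}$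 (hence simplicial presheaf on $\mathrm{Cart}$) given by the enriched bar construction $$(P/\!/\mathcal M_Y)_k=\coprod_{Y_0,\dots,Y_k\in\mathcal M_Y}P(Y_0)\times\mathrm D(Y_1,Y_0)\times\cdots\times\mathrm D(Y_k,Y_{k-1}),$$ and the action groupoid $P(Y)/\!/\mathrm D(Y)$ is the analogous bar construction for the full enriched subcategory on $Y$: $(P(Y)/\!/\mathrm D(Y))_k=P(Y)\times\mathrm D(Y)^k$. Below I write $/\!/$ for both. $Q$ is Dugger's cofibrant replacement of simplicial presheaves on $\mathrm{Cart}$: $(QZ)_k=\coprod_{c_0,\dots,c_k}\mathcal Y_{c_0}\times\mathrm{Cart}(c_0,c_1)\times\cdots\times\mathrm{Cart}(c_{k-1},c_k)\times Z_k(c_k)$. $\mathrm{CSS}_n$ is the simplicial model category for large $n$-fold complete Segal spaces: the left Bousfield localisation of the Reedy (equivalently injective) model structure on $\mathrm{Fun}((\Delta^n)^{\mathrm{op}},\mathrm{sSet}_{\mathrm L})$, where $\Delta^n$ is the $n$-fold product of the simplex category, enforcing the Segal and completeness conditions in each of the $n$ directions and essential constancy (inserting $0$ in one slot makes the object constant up to equivalence in the later slots); $\mathrm{CSS}_0=\mathrm{sSet}_{\mathrm L}$ with the Kan–Quillen structure. $\{-,-\}$ is the cotensor of $\mathrm{CSS}_n$ over simplicial sets, and for a simplicial presheaf $Z$ on $\mathrm{Cart}$, $\{Z,F\}^{\mathrm{Cart}^{\mathrm{op}}}=\int_{c\in\mathrm{Cart}}\{Z(c),F(c)\}\in\mathrm{CSS}_n$.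 Set $$F(P)^{\mathrm D(Y)}_{red}=\{Q(P(Y)/\!/\mathrm D(Y)),F\}^{\mathrm{Cart}^{\mathrm{op}}},\qquad F(P)^{coh}_{red}=\{Q(P/\!/\mathcal M_Y),F\}^{\mathrm{Cart}^{\mathrm{op}}}.$$ "Weak equivalence" means weak equivalence in $\mathrm{CSS}_n$; "weakly inverse" means inverse to each other in the homotopy category. Projectively fibrant means objectwise fibrant. *)

theory Defs
  imports "HOL-Analysis.Analysis" "Jordan_Normal_Form.Determinant"
begin

section \<open>Universes\<close>

text \<open>The type \<open>'V\<close> is an ambient model of (second-order) ZFC; \<open>elts x\<close> is the set of members of \<open>x\<close>.
  Choice is inherited from HOL.\<close>

definition zfc_model :: "('V \<Rightarrow> 'V set) \<Rightarrow> bool" where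
  "zfc_model elts \<longleftrightarrow>
     inj elts \<and> wf {(x, y). x \<in> elts y}
   \<and> (\<forall>x A. A \<subseteq> elts x \<longrightarrow> (\<exists>y. elts y = A))
   \<and> (\<forall>x y. \<exists>z. elts z = {x, y})
   \<and> (\<forall>x. \<exists>y. elts y = (\<Union>z\<in>elts x. elts z))
   \<and> (\<forall>x. \<exists>y. elts y = {z. elts z \<subseteq> elts x})
   \<and> (\<forall>x (f :: 'V \<Rightarrow> 'V). \<exists>y. elts y = f ` elts x)
   \<and> (\<exists>x. infinite (elts x))"

text \<open>A Grothendieck universe, with the usual convention that it contains an infinite set.\<close>

definition grothendieck_universe :: "('V \<Rightarrow> 'V set) \<Rightarrow> 'V \<Rightarrow> bool" where
  "grothendieck_universe elts u \<longleftrightarrow>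
     (\<forall>x\<in>elts u. elts x \<subseteq> elts u)
   \<and> (\<forall>x\<in>elts u. \<forall>y\<in>elts u. \<exists>z\<in>elts u. elts z = {x, y})
   \<and> (\<forall>x\<in>elts u. \<exists>y\<in>elts u. elts y = {z. elts z \<subseteq> elts x})
   \<and> (\<forall>x\<in>elts u. \<forall>f :: 'V \<Rightarrow> 'V. f ` elts x \<subseteq> elts u \<longrightarrow>
        (\<exists>y\<in>elts u. elts y = (\<Union>i\<in>elts x. elts (f i))))
   \<and> (\<exists>x\<in>elts u. infinite (elts x))"

text \<open>The objects of the category of sets belonging to the universe \<open>u\<close>. Below, a universe enters
  the definitions only through this collection \<open>U = sets_in elts u\<close>.\<close>

definition sets_in :: "('V \<Rightarrow> 'V set) \<Rightarrow> 'V \<Rightarrow> 'V set set" where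
  "sets_in elts u = elts ` elts u"

definition small :: "'V set set \<Rightarrow> 'a set \<Rightarrow> bool" where
  "small U A \<longleftrightarrow> (\<exists>B\<in>U. \<exists>f. bij_betw f A B)"


section \<open>Categories and presheaves\<close>

text \<open>Hom sets need not be disjoint, so composition and restriction take the objects as arguments:
  \<open>Cmp C a b c g f\<close> is \<open>g \<circ> f\<close> for \<open>f : a \<rightarrow> b\<close> and \<open>g : b \<rightarrow> c\<close>, and \<open>Rs X a b f : X(b) \<rightarrow> X(a)\<close>
  for \<open>f : a \<rightarrow> b\<close>.\<close>

record ('o, 'm) cat =
  Ob :: "'o set"
  Ar :: "'o \<Rightarrow> 'o \<Rightarrow> 'm set"
  Ide :: "'o \<Rightarrow> 'm"
  Cmp :: "'o \<Rightarrow> 'o \<Rightarrow> 'o \<Rightarrow> 'm \<Rightarrow> 'm \<Rightarrow> 'm"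

record ('o, 'm, 'e) psh =
  El :: "'o \<Rightarrow> 'e set"
  Rs :: "'o \<Rightarrow> 'o \<Rightarrow> 'm \<Rightarrow> 'e \<Rightarrow> 'e"

definition presheaf :: "('o, 'm) cat \<Rightarrow> ('o, 'm, 'e) psh \<Rightarrow> bool" where
  "presheaf C X \<longleftrightarrow>
     (\<forall>a\<in>Ob C. \<forall>b\<in>Ob C. \<forall>f\<in>Ar C a b. Rs X a b f \<in> El X b \<rightarrow> El X a)
   \<and> (\<forall>a\<in>Ob C. \<forall>x\<in>El X a. Rs X a a (Ide C a) x = x)
   \<and> (\<forall>a\<in>Ob C. \<forall>b\<in>Ob C. \<forall>c\<in>Ob C. \<forall>f\<in>Ar C a b. \<forall>g\<in>Ar C b c. \<forall>x\<in>El X c.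
        Rs X a c (Cmp C a b c g f) x = Rs X a b f (Rs X b c g x))"

definition presheaf_in :: "'V set set \<Rightarrow> ('o, 'm) cat \<Rightarrow> ('o, 'm, 'V) psh \<Rightarrow> bool" where
  "presheaf_in U C X \<longleftrightarrow> presheaf C X \<and> (\<forall>a\<in>Ob C. El X a \<in> U)"

text \<open>Natural transformations are extensional, so that HOL equality is equality of
  transformations.\<close>

definition Nat :: "('o, 'm) cat \<Rightarrow> ('o, 'm, 'e) psh \<Rightarrow> ('o, 'm, 'd) psh \<Rightarrow> ('o \<Rightarrow> 'e \<Rightarrow> 'd) set" where
  "Nat C X Y = {\<eta> \<in> (\<Pi>\<^sub>E a\<in>Ob C. El X a \<rightarrow>\<^sub>E El Y a).
     \<forall>a\<in>Ob C. \<forall>b\<in>Ob C. \<forall>f\<in>Ar C a b. \<forall>x\<in>El X b. \<eta> a (Rs X a b f x) = Rs Y a b f (\<eta> b x)}"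

definition nat_id :: "('o, 'm) cat \<Rightarrow> ('o, 'm, 'e) psh \<Rightarrow> 'o \<Rightarrow> 'e \<Rightarrow> 'e" where
  "nat_id C X = (\<lambda>a\<in>Ob C. \<lambda>x\<in>El X a. x)"

text \<open>\<open>nat_comp C X \<eta>' \<eta>\<close> is \<open>\<eta>' \<circ> \<eta>\<close>, where \<open>X\<close> is the domain of \<open>\<eta>\<close>.\<close>

definition nat_comp :: "('o, 'm) cat \<Rightarrow> ('o, 'm, 'e) psh
    \<Rightarrow> ('o \<Rightarrow> 'd \<Rightarrow> 'c) \<Rightarrow> ('o \<Rightarrow> 'e \<Rightarrow> 'd) \<Rightarrow> 'o \<Rightarrow> 'e \<Rightarrow> 'c" where
  "nat_comp C X \<eta>' \<eta> = (\<lambda>a\<in>Ob C. \<lambda>x\<in>El X a. \<eta>' a (\<eta> a x))"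

definition yoneda :: "('o, 'm) cat \<Rightarrow> 'o \<Rightarrow> ('o, 'm, 'm) psh" where
  "yoneda C c = \<lparr>El = (\<lambda>a. Ar C a c), Rs = (\<lambda>a b f g. Cmp C a b c g f)\<rparr>"

definition psh_prod :: "('o, 'm, 'e) psh \<Rightarrow> ('o, 'm, 'd) psh \<Rightarrow> ('o, 'm, 'e \<times> 'd) psh" where
  "psh_prod X Y = \<lparr>El = (\<lambda>a. El X a \<times> El Y a),
     Rs = (\<lambda>a b f. map_prod (Rs X a b f) (Rs Y a b f))\<rparr>"

text \<open>The internal hom of presheaves, through which the cartesian closed category of presheaves
  is enriched over itself.\<close>

definition ihom :: "('o, 'm) cat \<Rightarrow> ('o, 'm, 'e) psh \<Rightarrow> ('o, 'm, 'd) psh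
    \<Rightarrow> ('o, 'm, 'o \<Rightarrow> 'm \<times> 'e \<Rightarrow> 'd) psh" where
  "ihom C X Y = \<lparr>El = (\<lambda>c. Nat C (psh_prod (yoneda C c) X) Y),
     Rs = (\<lambda>c d f \<eta>. \<lambda>a\<in>Ob C. \<lambda>(g, x)\<in>Ar C a c \<times> El X a. \<eta> a (Cmp C a c d f g, x))\<rparr>"

definition ihom_id :: "('o, 'm) cat \<Rightarrow> ('o, 'm, 'e) psh \<Rightarrow> 'o \<Rightarrow> 'o \<Rightarrow> 'm \<times> 'e \<Rightarrow> 'e" where
  "ihom_id C X c = (\<lambda>a\<in>Ob C. \<lambda>(g, x)\<in>Ar C a c \<times> El X a. x)"

definition ihom_comp :: "('o, 'm) cat \<Rightarrow> ('o, 'm, 'e) psh \<Rightarrow> 'o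
    \<Rightarrow> ('o \<Rightarrow> 'm \<times> 'd \<Rightarrow> 'b) \<Rightarrow> ('o \<Rightarrow> 'm \<times> 'e \<Rightarrow> 'd) \<Rightarrow> 'o \<Rightarrow> 'm \<times> 'e \<Rightarrow> 'b" where
  "ihom_comp C X c \<beta> \<alpha> = (\<lambda>a\<in>Ob C. \<lambda>(g, x)\<in>Ar C a c \<times> El X a. \<beta> a (g, \<alpha> a (g, x)))"

definition cat_prod :: "('o, 'm) cat \<Rightarrow> ('p, 'q) cat \<Rightarrow> ('o \<times> 'p, 'm \<times> 'q) cat" where
  "cat_prod C D = \<lparr>Ob = Ob C \<times> Ob D,
     Ar = (\<lambda>(a, a') (b, b'). Ar C a b \<times> Ar D a' b'),
     Ide = map_prod (Ide C) (Ide D),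
     Cmp = (\<lambda>(a, a') (b, b') (c, c') (g, g') (f, f'). (Cmp C a b c g f, Cmp D a' b' c' g' f'))\<rparr>"

text \<open>For a presheaf \<open>X\<close> on \<open>C \<times> D\<close>, the presheaf \<open>X(a, -)\<close> on \<open>D\<close>. Functors from the opposite
  of \<open>C\<close> to presheaves on \<open>D\<close> are often written as presheaves on \<open>C \<times> D\<close>.\<close>

definition slice :: "('o, 'm) cat \<Rightarrow> ('o \<times> 'p, 'm \<times> 'q, 'e) psh \<Rightarrow> 'o \<Rightarrow> ('p, 'q, 'e) psh" where
  "slice C X a = \<lparr>El = (\<lambda>k. El X (a, k)), Rs = (\<lambda>k l \<theta>. Rs X (a, k) (a, l) (Ide C a, \<theta>))\<rparr>"

text \<open>An isomorphic copy, with values in the universe \<open>U\<close>, of a presheaf whose values are \<open>U\<close>-small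
  sets in some other HOL type.\<close>

definition encoding :: "'V set set \<Rightarrow> ('o, 'm) cat \<Rightarrow> ('o, 'm, 'e) psh \<Rightarrow> 'o \<Rightarrow> 'e \<Rightarrow> 'V" where
  "encoding U C X = (SOME e. \<forall>a\<in>Ob C. inj_on (e a) (El X a) \<and> e a ` El X a \<in> U)"

definition copy_in :: "'V set set \<Rightarrow> ('o, 'm) cat \<Rightarrow> ('o, 'm, 'e) psh \<Rightarrow> ('o, 'm, 'V) psh" where
  "copy_in U C X = (let e = encoding U C X in
     \<lparr>El = (\<lambda>a. e a ` El X a),
      Rs = (\<lambda>a b f v. e a (Rs X a b f (inv_into (El X b) (e b) v)))\<rparr>)"


section \<open>Smooth maps between subsets of the space of finite sequences\<close>

type_synonym pt = "nat \<Rightarrow> real"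

text \<open>\<open>Rsp n\<close> is \<open>n\<close>-dimensional Euclidean space, \<open>Rinf\<close> the union of all of these, and \<open>open_inf\<close> its
  colimit topology.\<close>

definition Rsp :: "nat \<Rightarrow> pt set" where
  "Rsp n = {x. \<forall>i\<ge>n. x i = 0}"

definition Rinf :: "pt set" where
  "Rinf = (\<Union>n. Rsp n)"

abbreviation open_Rsp :: "nat \<Rightarrow> pt set \<Rightarrow> bool" where
  "open_Rsp n W \<equiv> openin (top_of_set (Rsp n)) W"

definition open_inf :: "pt set \<Rightarrow> bool" where
  "open_inf W \<longleftrightarrow> W \<subseteq> Rinf \<and> (\<forall>n. open_Rsp n (W \<inter> Rsp n))"

text \<open>\<open>k\<close> times continuously differentiable on the open subset \<open>W\<close> of \<open>Rsp n\<close>, by partial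
  derivatives.\<close>

primrec cont_diff :: "nat \<Rightarrow> nat \<Rightarrow> pt set \<Rightarrow> (pt \<Rightarrow> real) \<Rightarrow> bool" where
  "cont_diff 0 n W f \<longleftrightarrow> continuous_on W f"
| "cont_diff (Suc k) n W f \<longleftrightarrow> continuous_on W f \<and>
     (\<forall>i<n. \<exists>g. (\<forall>x\<in>W. ((\<lambda>t. f (x(i := t))) has_real_derivative g x) (at (x i))) \<and> cont_diff k n W g)"

text \<open>Smoothness of a map between arbitrary subsets of \<open>Rinf\<close> in the sense of Milnor: locally the
  domain lies in some \<open>Rsp n\<close> and the map extends smoothly to an open subset of it.\<close>

definition smooth_sub :: "pt set \<Rightarrow> pt set \<Rightarrow> (pt \<Rightarrow> pt) \<Rightarrow> bool" where
  "smooth_sub A B f \<longleftrightarrow> f \<in> A \<rightarrow> B \<and>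
     (\<forall>p\<in>A. \<exists>W n m g. open_inf W \<and> p \<in> W \<and> A \<inter> W \<subseteq> Rsp n
        \<and> g \<in> W \<inter> Rsp n \<rightarrow> Rsp m
        \<and> (\<forall>j k. cont_diff k n (W \<inter> Rsp n) (\<lambda>x. g x j))
        \<and> (\<forall>x\<in>A \<inter> W. f x = g x))"

definition diffeo_sub :: "pt set \<Rightarrow> pt set \<Rightarrow> (pt \<Rightarrow> pt) \<Rightarrow> bool" where
  "diffeo_sub A B f \<longleftrightarrow> bij_betw f A B \<and> smooth_sub A B f \<and> smooth_sub B A (inv_into A f)"

text \<open>A subset of \<open>Rinf\<close> that is diffeomorphic to a Euclidean space in Milnor's sense is
  automatically a submanifold.\<close>

definition Cart :: "(pt set, pt \<Rightarrow> pt) cat" where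
  "Cart = \<lparr>Ob = {c. c \<subseteq> Rinf \<and> (\<exists>n f. diffeo_sub (Rsp n) c f)},
     Ar = (\<lambda>c d. {f \<in> c \<rightarrow>\<^sub>E d. smooth_sub c d f}),
     Ide = (\<lambda>c. \<lambda>s\<in>c. s),
     Cmp = (\<lambda>a b c g f. compose a g f)\<rparr>"


section \<open>Oriented manifolds\<close>

text \<open>A signed chart \<open>(V, x, \<epsilon>)\<close> is a chart \<open>x\<close> with domain \<open>V\<close>, together with the information whether
  it preserves (\<open>\<epsilon> = 1\<close>) or reverses (\<open>\<epsilon> = -1\<close>) the orientation. An oriented manifold is given by its
  maximal atlas of signed charts. The signs make this correct in dimension \<open>0\<close> as well, where an
  orientation is a sign for each point. The points form a subset of the type \<open>'p\<close>.\<close>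

type_synonym 'p ochart = "'p set \<times> ('p \<Rightarrow> pt) \<times> real"

record 'p omfd =
  mdim :: nat
  charts :: "'p ochart set"

definition points :: "'p omfd \<Rightarrow> 'p set" where
  "points M = (\<Union>(V, x, \<epsilon>)\<in>charts M. V)"

definition ochart :: "nat \<Rightarrow> 'p ochart \<Rightarrow> bool" where
  "ochart d = (\<lambda>(V, x, \<epsilon>). inj_on x V \<and> open_Rsp d (x ` V) \<and> \<epsilon> \<in> {1, -1})"

definition jacobian :: "nat \<Rightarrow> (pt \<Rightarrow> pt) \<Rightarrow> pt \<Rightarrow> real" where
  "jacobian d f u =
     Determinant.det (Matrix.mat d d (\<lambda>(i, j). deriv (\<lambda>t. f (u(j := t)) i) (u j)))"

definition compatible :: "nat \<Rightarrow> 'p ochart \<Rightarrow> 'p ochart \<Rightarrow> bool" where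
  "compatible d = (\<lambda>(V, x, \<epsilon>) (V', x', \<epsilon>').
     open_Rsp d (x ` (V \<inter> V')) \<and> open_Rsp d (x' ` (V \<inter> V'))
   \<and> diffeo_sub (x ` (V \<inter> V')) (x' ` (V \<inter> V')) (x' \<circ> inv_into V x)
   \<and> (\<forall>p\<in>V \<inter> V'. sgn (jacobian d (x' \<circ> inv_into V x) (x p)) = \<epsilon> * \<epsilon>'))"

definition mtop :: "'p omfd \<Rightarrow> 'p topology" where
  "mtop M = topology (\<lambda>T. T \<subseteq> points M \<and> (\<forall>(V, x, \<epsilon>)\<in>charts M. open_Rsp (mdim M) (x ` (V \<inter> T))))"

definition oriented_manifold :: "'p omfd \<Rightarrow> bool" where
  "oriented_manifold M \<longleftrightarrow>
     (\<forall>\<kappa>\<in>charts M. ochart (mdim M) \<kappa>)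
   \<and> (\<forall>\<kappa>\<in>charts M. \<forall>\<mu>\<in>charts M. compatible (mdim M) \<kappa> \<mu>)
   \<and> (\<forall>\<kappa>. ochart (mdim M) \<kappa> \<and> fst \<kappa> \<subseteq> points M \<and> (\<forall>\<mu>\<in>charts M. compatible (mdim M) \<kappa> \<mu>)
        \<longrightarrow> \<kappa> \<in> charts M)
   \<and> Hausdorff_space (mtop M) \<and> second_countable (mtop M)"

definition closed_oriented_manifold :: "'p omfd \<Rightarrow> bool" where
  "closed_oriented_manifold M \<longleftrightarrow> oriented_manifold M \<and> compact_space (mtop M)"

definition smooth_map :: "'p omfd \<Rightarrow> 'q omfd \<Rightarrow> ('p \<Rightarrow> 'q) \<Rightarrow> bool" where
  "smooth_map M N f \<longleftrightarrow> f \<in> points M \<rightarrow> points N \<and>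
     (\<forall>p\<in>points M. \<exists>(V, x, \<epsilon>)\<in>charts M. \<exists>(V', x', \<epsilon>')\<in>charts N.
        p \<in> V \<and> f ` V \<subseteq> V' \<and> smooth_sub (x ` V) (x' ` V') (x' \<circ> f \<circ> inv_into V x))"

definition orientation_preserving :: "'p omfd \<Rightarrow> 'q omfd \<Rightarrow> ('p \<Rightarrow> 'q) \<Rightarrow> bool" where
  "orientation_preserving M N f \<longleftrightarrow>
     (\<forall>(V, x, \<epsilon>)\<in>charts M. \<forall>(V', x', \<epsilon>')\<in>charts N. \<forall>p\<in>V. f p \<in> V' \<longrightarrow>
        sgn (jacobian (mdim M) (x' \<circ> f \<circ> inv_into V x) (x p)) = \<epsilon> * \<epsilon>')"

definition op_diffeo :: "'p omfd \<Rightarrow> 'q omfd \<Rightarrow> ('p \<Rightarrow> 'q) \<Rightarrow> bool" where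
  "op_diffeo M N f \<longleftrightarrow> mdim M = mdim N \<and> bij_betw f (points M) (points N)
     \<and> smooth_map M N f \<and> smooth_map N M (inv_into (points M) f) \<and> orientation_preserving M N f"

text \<open>Smoothness of \<open>\<phi> : c \<times> M \<rightarrow> N\<close> for a submanifold \<open>c\<close> of \<open>Rinf\<close>: in charts of \<open>M\<close> and \<open>N\<close>, it is
  a map defined on a subset of \<open>Rsp (mdim M) \<times> Rinf\<close>, and the latter is identified with \<open>Rinf\<close> by
  prepending coordinates.\<close>

definition pt_join :: "nat \<Rightarrow> pt \<Rightarrow> pt \<Rightarrow> pt" where
  "pt_join d u s = (\<lambda>i. if i < d then u i else s (i - d))"

definition pt_head :: "nat \<Rightarrow> pt \<Rightarrow> pt" where
  "pt_head d z = (\<lambda>i. if i < d then z i else 0)"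

definition pt_tail :: "nat \<Rightarrow> pt \<Rightarrow> pt" where
  "pt_tail d z = (\<lambda>i. z (i + d))"

definition smooth_family :: "pt set \<Rightarrow> 'p omfd \<Rightarrow> 'q omfd \<Rightarrow> (pt \<Rightarrow> 'p \<Rightarrow> 'q) \<Rightarrow> bool" where
  "smooth_family c M N \<phi> \<longleftrightarrow> (\<forall>s\<in>c. \<phi> s \<in> points M \<rightarrow> points N) \<and>
     (\<forall>s\<in>c. \<forall>p\<in>points M. \<exists>W. \<exists>(V, x, \<epsilon>)\<in>charts M. \<exists>(V', x', \<epsilon>')\<in>charts N.
        open_inf W \<and> s \<in> W \<and> p \<in> V \<and> (\<forall>t\<in>c \<inter> W. \<phi> t ` V \<subseteq> V') \<and>
        smooth_sub {pt_join (mdim M) u t | u t. u \<in> x ` V \<and> t \<in> c \<inter> W} (x' ` V')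
          (\<lambda>z. x' (\<phi> (pt_tail (mdim M) z) (inv_into V x (pt_head (mdim M) z)))))"

definition Dpsh :: "'p omfd \<Rightarrow> 'p omfd \<Rightarrow> (pt set, pt \<Rightarrow> pt, pt \<Rightarrow> 'p \<Rightarrow> 'p) psh" where
  "Dpsh M N = \<lparr>
     El = (\<lambda>c. {\<phi> \<in> c \<rightarrow>\<^sub>E (points M \<rightarrow>\<^sub>E points N). smooth_family c M N \<phi> \<and> (\<forall>s\<in>c. op_diffeo M N (\<phi> s))
            \<and> smooth_family c N M (\<lambda>s. inv_into (points M) (\<phi> s))}),
     Rs = (\<lambda>a b f \<phi>. compose a \<phi> f)\<rparr>"

definition D_id :: "'p omfd \<Rightarrow> pt set \<Rightarrow> pt \<Rightarrow> 'p \<Rightarrow> 'p" where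
  "D_id M c = (\<lambda>s\<in>c. \<lambda>p\<in>points M. p)"

definition D_comp :: "'p omfd \<Rightarrow> pt set \<Rightarrow> (pt \<Rightarrow> 'p \<Rightarrow> 'p) \<Rightarrow> (pt \<Rightarrow> 'p \<Rightarrow> 'p) \<Rightarrow> pt \<Rightarrow> 'p \<Rightarrow> 'p" where
  "D_comp M c \<phi> \<psi> = (\<lambda>s\<in>c. compose (points M) (\<phi> s) (\<psi> s))"

text \<open>The objects of the connected component of \<open>Y\<close> in the groupoid of oriented manifolds (with
  points in \<open>'p\<close>) and orientation-preserving diffeomorphisms.\<close>

definition component :: "'p omfd \<Rightarrow> 'p omfd set" where
  "component Y = {M. oriented_manifold M \<and> (\<exists>f. op_diffeo M Y f)}"

text \<open>A presheaf-enriched functor from the opposite of the full enriched subcategory on the objects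
  \<open>\<O>\<close>: \<open>PAr P M N\<close> is the map from \<open>D(N, M)\<close> to the internal hom of \<open>P(M)\<close> and \<open>P(N)\<close>.\<close>

record ('p, 'V) efun =
  POb :: "'p omfd \<Rightarrow> (pt set, pt \<Rightarrow> pt, 'V) psh"
  PAr :: "'p omfd \<Rightarrow> 'p omfd
    \<Rightarrow> pt set \<Rightarrow> (pt \<Rightarrow> 'p \<Rightarrow> 'p) \<Rightarrow> (pt set \<Rightarrow> (pt \<Rightarrow> pt) \<times> 'V \<Rightarrow> 'V)"

definition enriched_functor :: "'V set set \<Rightarrow> 'p omfd set \<Rightarrow> ('p, 'V) efun \<Rightarrow> bool" where
  "enriched_functor U \<O> P \<longleftrightarrow>
     (\<forall>M\<in>\<O>. presheaf_in U Cart (POb P M))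
   \<and> (\<forall>M\<in>\<O>. \<forall>N\<in>\<O>. PAr P M N \<in> Nat Cart (Dpsh N M) (ihom Cart (POb P M) (POb P N)))
   \<and> (\<forall>M\<in>\<O>. \<forall>c\<in>Ob Cart. PAr P M M c (D_id M c) = ihom_id Cart (POb P M) c)
   \<and> (\<forall>M\<in>\<O>. \<forall>N\<in>\<O>. \<forall>K\<in>\<O>. \<forall>c\<in>Ob Cart. \<forall>\<phi>\<in>El (Dpsh N M) c. \<forall>\<psi>\<in>El (Dpsh K N) c.
        PAr P M K c (D_comp K c \<phi> \<psi>) = ihom_comp Cart (POb P M) c (PAr P N K c \<psi>) (PAr P M N c \<phi>))"

text \<open>The adjoint action \<open>P(M) \<times> D(N, M) \<rightarrow> P(N)\<close>.\<close>

definition P_act :: "('p, 'V) efun \<Rightarrow> 'p omfd \<Rightarrow> 'p omfd \<Rightarrow> pt set \<Rightarrow> (pt \<Rightarrow> 'p \<Rightarrow> 'p) \<Rightarrow> 'V \<Rightarrow> 'V" where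
  "P_act P M N c \<phi> v = PAr P M N c \<phi> c (Ide Cart c, v)"


section \<open>Simplicial sets\<close>

definition Simp :: "(nat, nat \<Rightarrow> nat) cat" where
  "Simp = \<lparr>Ob = UNIV,
     Ar = (\<lambda>m k. {\<theta> \<in> {..m} \<rightarrow>\<^sub>E {..k}. mono_on {..m} \<theta>}),
     Ide = (\<lambda>m. \<lambda>i\<in>{..m}. i),
     Cmp = (\<lambda>a b c g f. compose {..a} g f)\<rparr>"

type_synonym 'e sset = "(nat, nat \<Rightarrow> nat, 'e) psh"

text \<open>Let \<open>C\<close> be a category with a projection to \<open>Simp\<close>, given by \<open>dO\<close> and \<open>dA\<close>. The simplicial
  mapping space of presheaves on \<open>C\<close> has as \<open>k\<close>-simplices the maps \<open>X \<times> \<Delta>\<^sup>k \<rightarrow> Y\<close>, where the standard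
  simplex \<open>\<Delta>\<^sup>k\<close> is pulled back along the projection.\<close>

definition simplex_over :: "('o \<Rightarrow> nat) \<Rightarrow> ('m \<Rightarrow> nat \<Rightarrow> nat) \<Rightarrow> nat \<Rightarrow> ('o, 'm, nat \<Rightarrow> nat) psh" where
  "simplex_over dO dA k = \<lparr>El = (\<lambda>a. Ar Simp (dO a) k),
     Rs = (\<lambda>a b f g. Cmp Simp (dO a) (dO b) k g (dA f))\<rparr>"

definition map_space :: "('o, 'm) cat \<Rightarrow> ('o \<Rightarrow> nat) \<Rightarrow> ('m \<Rightarrow> nat \<Rightarrow> nat)
    \<Rightarrow> ('o, 'm, 'e) psh \<Rightarrow> ('o, 'm, 'd) psh \<Rightarrow> ('o \<Rightarrow> 'e \<times> (nat \<Rightarrow> nat) \<Rightarrow> 'd) sset" where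
  "map_space C dO dA X Y = \<lparr>
     El = (\<lambda>k. Nat C (psh_prod X (simplex_over dO dA k)) Y),
     Rs = (\<lambda>l k \<theta> \<eta>. \<lambda>a\<in>Ob C. \<lambda>(x, g)\<in>El X a \<times> Ar Simp (dO a) l. \<eta> a (x, Cmp Simp (dO a) l k \<theta> g))\<rparr>"

definition map_space_pre :: "('o, 'm) cat \<Rightarrow> ('o \<Rightarrow> nat) \<Rightarrow> ('m \<Rightarrow> nat \<Rightarrow> nat)
    \<Rightarrow> ('o, 'm, 'e) psh \<Rightarrow> ('o, 'm, 'c) psh \<Rightarrow> ('o, 'm, 'd) psh \<Rightarrow> ('o \<Rightarrow> 'e \<Rightarrow> 'c)
    \<Rightarrow> nat \<Rightarrow> ('o \<Rightarrow> 'c \<times> (nat \<Rightarrow> nat) \<Rightarrow> 'd) \<Rightarrow> ('o \<Rightarrow> 'e \<times> (nat \<Rightarrow> nat) \<Rightarrow> 'd)" where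
  "map_space_pre C dO dA X X' Y f = (\<lambda>k. \<lambda>\<eta>\<in>El (map_space C dO dA X' Y) k.
     \<lambda>a\<in>Ob C. \<lambda>(x, g)\<in>El X a \<times> Ar Simp (dO a) k. \<eta> a (f a x, g))"

abbreviation sset_map :: "'e sset \<Rightarrow> 'd sset \<Rightarrow> (nat \<Rightarrow> 'e \<times> (nat \<Rightarrow> nat) \<Rightarrow> 'd) sset" where
  "sset_map \<equiv> map_space Simp (\<lambda>k. k) (\<lambda>\<theta>. \<theta>)"

abbreviation sset_map_pre :: "'e sset \<Rightarrow> 'c sset \<Rightarrow> 'd sset \<Rightarrow> (nat \<Rightarrow> 'e \<Rightarrow> 'c)
    \<Rightarrow> nat \<Rightarrow> (nat \<Rightarrow> 'c \<times> (nat \<Rightarrow> nat) \<Rightarrow> 'd) \<Rightarrow> (nat \<Rightarrow> 'e \<times> (nat \<Rightarrow> nat) \<Rightarrow> 'd)" where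
  "sset_map_pre \<equiv> map_space_pre Simp (\<lambda>k. k) (\<lambda>\<theta>. \<theta>)"

definition horn :: "nat \<Rightarrow> nat \<Rightarrow> (nat \<Rightarrow> nat) sset" where
  "horn k i = \<lparr>El = (\<lambda>m. {\<theta> \<in> Ar Simp m k. \<exists>j\<le>k. j \<noteq> i \<and> j \<notin> \<theta> ` {..m}}), Rs = Rs (yoneda Simp k)\<rparr>"

definition kan_complex :: "'e sset \<Rightarrow> bool" where
  "kan_complex K \<longleftrightarrow> presheaf Simp K \<and>
     (\<forall>k\<ge>1. \<forall>i\<le>k. \<forall>h\<in>Nat Simp (horn k i) K. \<exists>h'\<in>Nat Simp (yoneda Simp k) K.
        \<forall>m. \<forall>\<theta>\<in>El (horn k i) m. h' m \<theta> = h m \<theta>)"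

text \<open>Connected components: the quotient of the vertices by the equivalence relation generated by
  the edges.\<close>

definition edge_rel :: "'e sset \<Rightarrow> ('e \<times> 'e) set" where
  "edge_rel X = {(Rs X 0 1 (\<lambda>i\<in>{..0}. 0) e, Rs X 0 1 (\<lambda>i\<in>{..0}. 1) e) | e. e \<in> El X 1}"

definition conn_rel :: "'e sset \<Rightarrow> ('e \<times> 'e) set" where
  "conn_rel X = (edge_rel X \<union> (edge_rel X)\<inverse>)\<^sup>* \<inter> El X 0 \<times> El X 0"

definition pi0 :: "'e sset \<Rightarrow> 'e set set" where
  "pi0 X = El X 0 // conn_rel X"

definition pi0_map :: "'d sset \<Rightarrow> (nat \<Rightarrow> 'e \<Rightarrow> 'd) \<Rightarrow> 'e set \<Rightarrow> 'd set" where
  "pi0_map Y f A = conn_rel Y `` (f 0 ` A)"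

text \<open>Weak homotopy equivalences of simplicial sets, i.e. the weak equivalences of the Kan-Quillen
  model structure, defined (as by Joyal-Tierney and in Kerodon) by mapping into Kan complexes.\<close>

definition weak_homotopy_equivalence ::
    "'V set set \<Rightarrow> 'e sset \<Rightarrow> 'd sset \<Rightarrow> (nat \<Rightarrow> 'e \<Rightarrow> 'd) \<Rightarrow> bool" where
  "weak_homotopy_equivalence U X Y f \<longleftrightarrow> f \<in> Nat Simp X Y \<and>
     (\<forall>K :: 'V sset. presheaf_in U Simp K \<and> kan_complex K \<longrightarrow>
        bij_betw (pi0_map (sset_map X K) (sset_map_pre X Y K f))
          (pi0 (sset_map Y K)) (pi0 (sset_map X K)))"


section \<open>Complete Segal spaces\<close>

text \<open>\<open>n\<close>-fold simplicial objects in simplicial sets are presheaves on \<open>SimpN n \<times> Simp\<close>; the last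
  factor is the space direction. Directions are numbered from \<open>0\<close> to \<open>n - 1\<close>.\<close>

definition SimpN :: "nat \<Rightarrow> (nat list, (nat \<Rightarrow> nat) list) cat" where
  "SimpN n = \<lparr>Ob = {ms. length ms = n},
     Ar = (\<lambda>ls ms. {\<theta>s. length \<theta>s = n \<and> (\<forall>j<n. \<theta>s ! j \<in> Ar Simp (ls ! j) (ms ! j))}),
     Ide = map (Ide Simp),
     Cmp = (\<lambda>as bs cs gs fs.
       map (\<lambda>j. Cmp Simp (as ! j) (bs ! j) (cs ! j) (gs ! j) (fs ! j)) [0..<n])\<rparr>"

abbreviation SSp :: "nat \<Rightarrow> (nat list \<times> nat, (nat \<Rightarrow> nat) list \<times> (nat \<Rightarrow> nat)) cat" where
  "SSp n \<equiv> cat_prod (SimpN n) Simp"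

type_synonym 'e sspace = "(nat list \<times> nat, (nat \<Rightarrow> nat) list \<times> (nat \<Rightarrow> nat), 'e) psh"

type_synonym ('e, 'd) smap = "nat list \<times> nat \<Rightarrow> 'e \<Rightarrow> 'd"

definition objectwise_we ::
    "'V set set \<Rightarrow> nat \<Rightarrow> 'V sspace \<Rightarrow> 'V sspace \<Rightarrow> ('V, 'V) smap \<Rightarrow> bool" where
  "objectwise_we U n A B f \<longleftrightarrow> f \<in> Nat (SSp n) A B \<and>
     (\<forall>ms\<in>Ob (SimpN n).
        weak_homotopy_equivalence U (slice (SimpN n) A ms) (slice (SimpN n) B ms) (\<lambda>k. f (ms, k)))"

text \<open>Fibrant objects of a model structure whose cofibrations are the monomorphisms and whose weak
  equivalences are \<open>we\<close>: those with the extension property for the trivial cofibrations.\<close>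

definition fibrant_for :: "('V sspace \<Rightarrow> 'V sspace \<Rightarrow> ('V, 'V) smap \<Rightarrow> bool)
    \<Rightarrow> 'V set set \<Rightarrow> nat \<Rightarrow> 'V sspace \<Rightarrow> bool" where
  "fibrant_for we U n W \<longleftrightarrow> presheaf_in U (SSp n) W \<and>
     (\<forall>A B. \<forall>i\<in>Nat (SSp n) A B. presheaf_in U (SSp n) A \<and> presheaf_in U (SSp n) B
        \<and> (\<forall>a\<in>Ob (SSp n). inj_on (i a) (El A a)) \<and> we A B i \<longrightarrow>
        (\<forall>h\<in>Nat (SSp n) A W. \<exists>h'\<in>Nat (SSp n) B W. nat_comp (SSp n) A h' i = h))"

text \<open>The maps at which the injective model structure is localised. All their sources and targets are
  external products of simplicial sets whose simplices are given by functions on vertices: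
  \<open>R j l\<close> is the set of \<open>l\<close>-simplices of the \<open>j\<close>-th factor.\<close>

definition box :: "nat \<Rightarrow> (nat \<Rightarrow> nat \<Rightarrow> (nat \<Rightarrow> nat) set) \<Rightarrow> ((nat \<Rightarrow> nat) list) sspace" where
  "box n R = \<lparr>El = (\<lambda>(ls, k). {\<theta>s. length \<theta>s = n \<and> (\<forall>j<n. \<theta>s ! j \<in> R j (ls ! j))}),
     Rs = (\<lambda>(ls, k) (ms, l) (\<rho>s, \<rho>) \<theta>s. map (\<lambda>j. compose {..ls ! j} (\<theta>s ! j) (\<rho>s ! j)) [0..<n])\<rparr>"

abbreviation rep :: "nat \<Rightarrow> nat list \<Rightarrow> ((nat \<Rightarrow> nat) list) sspace" where
  "rep n ms \<equiv> box n (\<lambda>j l. Ar Simp l (ms ! j))"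

text \<open>Segal maps: spine inclusions in direction \<open>i\<close>.\<close>

definition spine_box :: "nat \<Rightarrow> nat \<Rightarrow> nat list \<Rightarrow> ((nat \<Rightarrow> nat) list) sspace" where
  "spine_box n i ms = box n (\<lambda>j l. if j = i
     then {\<theta> \<in> Ar Simp l (ms ! i). \<exists>a<ms ! i. \<theta> ` {..l} \<subseteq> {a, Suc a}} else Ar Simp l (ms ! j))"

definition segal_maps where
  "segal_maps n = {(spine_box n i ms, rep n ms, nat_id (SSp n) (spine_box n i ms)) | i ms.
     i < n \<and> length ms = n \<and> ms ! i \<ge> 1}"

text \<open>Completeness maps: in direction \<open>i\<close>, the nerve of the groupoid with two uniquely isomorphic
  objects is projected to the point.\<close>

definition iso_box :: "nat \<Rightarrow> nat \<Rightarrow> nat list \<Rightarrow> ((nat \<Rightarrow> nat) list) sspace" where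
  "iso_box n i ms = box n (\<lambda>j l. if j = i then {..l} \<rightarrow>\<^sub>E {0, 1} else Ar Simp l (ms ! j))"

definition completeness_maps where
  "completeness_maps n = {(iso_box n i ms, rep n ms,
       \<lambda>a\<in>Ob (SSp n). \<lambda>\<theta>s\<in>El (iso_box n i ms) a. \<theta>s[i := (\<lambda>x\<in>{..fst a ! i}. 0)]) | i ms.
     i < n \<and> length ms = n \<and> ms ! i = 0}"

text \<open>Essential constancy: if slot \<open>i\<close> is \<open>0\<close>, then all later slots may be replaced by \<open>0\<close>.\<close>

definition constancy_maps where
  "constancy_maps n = {(rep n ms, rep n (map (\<lambda>j. if j \<le> i then ms ! j else 0) [0..<n]),
       \<lambda>a\<in>Ob (SSp n). \<lambda>\<theta>s\<in>El (rep n ms) a.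
         map (\<lambda>j. if j \<le> i then \<theta>s ! j else (\<lambda>x\<in>{..fst a ! j}. 0)) [0..<n]) | i ms.
     i < n \<and> length ms = n \<and> ms ! i = 0}"

definition css_local :: "'V set set \<Rightarrow> nat \<Rightarrow> 'V sspace \<Rightarrow> bool" where
  "css_local U n W \<longleftrightarrow> fibrant_for (objectwise_we U n) U n W \<and>
     (\<forall>(A, B, s)\<in>segal_maps n \<union> completeness_maps n \<union> constancy_maps n.
        weak_homotopy_equivalence U (map_space (SSp n) snd snd B W) (map_space (SSp n) snd snd A W)
          (map_space_pre (SSp n) snd snd A B W s))"

text \<open>Weak equivalences of the left Bousfield localisation. All objects are cofibrant, so no
  cofibrant replacement is needed.\<close>

definition css_we ::
    "'V set set \<Rightarrow> nat \<Rightarrow> 'V sspace \<Rightarrow> 'V sspace \<Rightarrow> ('V, 'V) smap \<Rightarrow> bool" where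
  "css_we U n A B f \<longleftrightarrow>
     presheaf_in U (SSp n) A \<and> presheaf_in U (SSp n) B \<and> f \<in> Nat (SSp n) A B \<and>
     (if n = 0 then objectwise_we U n A B f
      else \<forall>W. css_local U n W \<longrightarrow>
        weak_homotopy_equivalence U (map_space (SSp n) snd snd B W) (map_space (SSp n) snd snd A W)
          (map_space_pre (SSp n) snd snd A B W f))"

definition css_fibrant :: "'V set set \<Rightarrow> nat \<Rightarrow> 'V sspace \<Rightarrow> bool" where
  "css_fibrant U n = fibrant_for (css_we U n) U n"

text \<open>The homotopy category is the localisation at the weak equivalences: its morphisms are zigzags,
  modulo the congruence generated by composition, identities and the cancellation of
  weak equivalences. \<open>Bwd A w B\<close> is the formal inverse \<open>A \<rightarrow> B\<close> of \<open>w : B \<rightarrow> A\<close>.\<close>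

datatype 'V zstep =
    Fwd "'V sspace" "('V, 'V) smap" "'V sspace"
  | Bwd "'V sspace" "('V, 'V) smap" "'V sspace"

fun zigzag :: "'V set set \<Rightarrow> nat \<Rightarrow> 'V sspace \<Rightarrow> 'V sspace \<Rightarrow> 'V zstep list \<Rightarrow> bool" where
  "zigzag U n A B [] \<longleftrightarrow> presheaf_in U (SSp n) A \<and> A = B"
| "zigzag U n A B (Fwd A' f C # zs) \<longleftrightarrow> A' = A \<and> presheaf_in U (SSp n) A \<and> f \<in> Nat (SSp n) A C
     \<and> zigzag U n C B zs"
| "zigzag U n A B (Bwd A' w C # zs) \<longleftrightarrow> A' = A \<and> css_we U n C A w \<and> zigzag U n C B zs"

inductive zred :: "nat \<Rightarrow> 'V zstep list \<Rightarrow> 'V zstep list \<Rightarrow> bool" for n where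
  "zred n [Fwd A f B, Fwd B g C] [Fwd A (nat_comp (SSp n) A g f) C]"
| "zred n [Fwd A (nat_id (SSp n) A) A] []"
| "zred n [Fwd A w B, Bwd B w A] []"
| "zred n [Bwd B w A, Fwd A w B] []"

inductive ho_eq :: "'V set set \<Rightarrow> nat \<Rightarrow> 'V sspace \<Rightarrow> 'V sspace \<Rightarrow> 'V zstep list \<Rightarrow> 'V zstep list \<Rightarrow> bool"
  for U n A B where
  ho_refl: "zigzag U n A B zs \<Longrightarrow> ho_eq U n A B zs zs"
| ho_sym: "ho_eq U n A B zs zs' \<Longrightarrow> ho_eq U n A B zs' zs"
| ho_trans: "ho_eq U n A B zs zs' \<Longrightarrow> ho_eq U n A B zs' zs'' \<Longrightarrow> ho_eq U n A B zs zs''"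
| ho_step: "zred n u v \<Longrightarrow> zigzag U n A B (xs @ u @ ys) \<Longrightarrow> zigzag U n A B (xs @ v @ ys)
     \<Longrightarrow> ho_eq U n A B (xs @ u @ ys) (xs @ v @ ys)"

definition inverse_in_ho ::
    "'V set set \<Rightarrow> nat \<Rightarrow> 'V sspace \<Rightarrow> 'V sspace \<Rightarrow> ('V, 'V) smap \<Rightarrow> ('V, 'V) smap \<Rightarrow> bool" where
  "inverse_in_ho U n A B f g \<longleftrightarrow>
     ho_eq U n A A [Fwd A f B, Fwd B g A] [] \<and> ho_eq U n B B [Fwd B g A, Fwd A f B] []"


section \<open>Field theories relative to a presheaf\<close>

text \<open>Functors from the opposite of \<open>Cart\<close> to the category underlying \<open>CSS\<^sub>n\<close>.\<close>

record 'V ffun =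
  FOb :: "pt set \<Rightarrow> 'V sspace"
  FAr :: "pt set \<Rightarrow> pt set \<Rightarrow> (pt \<Rightarrow> pt) \<Rightarrow> ('V, 'V) smap"

definition css_functor :: "'V set set \<Rightarrow> nat \<Rightarrow> 'V ffun \<Rightarrow> bool" where
  "css_functor U n F \<longleftrightarrow>
     (\<forall>c\<in>Ob Cart. presheaf_in U (SSp n) (FOb F c))
   \<and> (\<forall>a\<in>Ob Cart. \<forall>b\<in>Ob Cart. \<forall>f\<in>Ar Cart a b. FAr F a b f \<in> Nat (SSp n) (FOb F b) (FOb F a))
   \<and> (\<forall>a\<in>Ob Cart. FAr F a a (Ide Cart a) = nat_id (SSp n) (FOb F a))
   \<and> (\<forall>a\<in>Ob Cart. \<forall>b\<in>Ob Cart. \<forall>c\<in>Ob Cart. \<forall>f\<in>Ar Cart a b. \<forall>g\<in>Ar Cart b c.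
        FAr F a c (Cmp Cart a b c g f) = nat_comp (SSp n) (FOb F c) (FAr F a b f) (FAr F b c g))"

definition projectively_fibrant :: "'V set set \<Rightarrow> nat \<Rightarrow> 'V ffun \<Rightarrow> bool" where
  "projectively_fibrant U n F \<longleftrightarrow> (\<forall>c\<in>Ob Cart. css_fibrant U n (FOb F c))"

text \<open>The enriched bar construction on the objects \<open>\<O>\<close>. A \<open>k\<close>-simplex is
  \<open>([Y\<^sub>0, \<dots>, Y\<^sub>k], v, [\<phi>\<^sub>1, \<dots>, \<phi>\<^sub>k])\<close>; since lists are indexed from \<open>0\<close>, \<open>\<phi>s ! i : Y\<^bsub>i+1\<^esub> \<rightarrow> Y\<^sub>i\<close>.
  \<open>bar_arrow Ys \<phi>s c i j : Y\<^sub>j \<rightarrow> Y\<^sub>i\<close> is the composite, for \<open>i \<le> j\<close>.\<close>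

primrec bar_arrow :: "'p omfd list \<Rightarrow> (pt \<Rightarrow> 'p \<Rightarrow> 'p) list \<Rightarrow> pt set \<Rightarrow> nat \<Rightarrow> nat \<Rightarrow> (pt \<Rightarrow> 'p \<Rightarrow> 'p)" where
  "bar_arrow Ys \<phi>s c i 0 = D_id (Ys ! 0) c"
| "bar_arrow Ys \<phi>s c i (Suc j) = (if i \<le> j then D_comp (Ys ! Suc j) c (bar_arrow Ys \<phi>s c i j) (\<phi>s ! j)
     else D_id (Ys ! Suc j) c)"

type_synonym ('p, 'V) bar_el = "'p omfd list \<times> 'V \<times> (pt \<Rightarrow> 'p \<Rightarrow> 'p) list"

definition bar :: "'p omfd set \<Rightarrow> ('p, 'V) efun
    \<Rightarrow> (pt set \<times> nat, (pt \<Rightarrow> pt) \<times> (nat \<Rightarrow> nat), ('p, 'V) bar_el) psh" where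
  "bar \<O> P = \<lparr>
     El = (\<lambda>(c, k). {(Ys, v, \<phi>s). length Ys = Suc k \<and> set Ys \<subseteq> \<O> \<and> v \<in> El (POb P (Ys ! 0)) c
            \<and> length \<phi>s = k \<and> (\<forall>i<k. \<phi>s ! i \<in> El (Dpsh (Ys ! Suc i) (Ys ! i)) c)}),
     Rs = (\<lambda>(a, l) (b, k) (f, \<theta>) (Ys, v, \<phi>s).
       (map (\<lambda>j. Ys ! \<theta> j) [0..<Suc l],
        Rs (POb P (Ys ! \<theta> 0)) a b f (P_act P (Ys ! 0) (Ys ! \<theta> 0) b (bar_arrow Ys \<phi>s b 0 (\<theta> 0)) v),
        map (\<lambda>j. Rs (Dpsh (Ys ! \<theta> (Suc j)) (Ys ! \<theta> j)) a b f (bar_arrow Ys \<phi>s b (\<theta> j) (\<theta> (Suc j))))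
          [0..<l]))\<rparr>"

text \<open>Dugger's cofibrant replacement. A \<open>k\<close>-simplex over \<open>c\<close> is \<open>([c\<^sub>0, \<dots>, c\<^sub>k], f, [f\<^sub>1, \<dots>, f\<^sub>k], z)\<close> with
  \<open>f : c \<rightarrow> c\<^sub>0\<close>, \<open>f\<^sub>i : c\<^bsub>i-1\<^esub> \<rightarrow> c\<^sub>i\<close> and \<open>z\<close> a \<open>k\<close>-simplex of \<open>Z\<close> over \<open>c\<^sub>k\<close>; the simplicial structure is that
  of the diagonal of the bisimplicial bar construction. \<open>chain_arrow C cs fs i j : c\<^sub>i \<rightarrow> c\<^sub>j\<close> is the
  composite, for \<open>i \<le> j\<close>.\<close>

primrec chain_arrow :: "('o, 'm) cat \<Rightarrow> 'o list \<Rightarrow> 'm list \<Rightarrow> nat \<Rightarrow> nat \<Rightarrow> 'm" where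
  "chain_arrow C cs fs i 0 = Ide C (cs ! 0)"
| "chain_arrow C cs fs i (Suc j) = (if i \<le> j
     then Cmp C (cs ! i) (cs ! j) (cs ! Suc j) (fs ! j) (chain_arrow C cs fs i j)
     else Ide C (cs ! Suc j))"

definition dugger_Q :: "('o, 'm) cat \<Rightarrow> ('o \<times> nat, 'm \<times> (nat \<Rightarrow> nat), 'e) psh
    \<Rightarrow> ('o \<times> nat, 'm \<times> (nat \<Rightarrow> nat), 'o list \<times> 'm \<times> 'm list \<times> 'e) psh" where
  "dugger_Q C Z = \<lparr>
     El = (\<lambda>(c, k). {(cs, f, fs, z). length cs = Suc k \<and> set cs \<subseteq> Ob C \<and> f \<in> Ar C c (cs ! 0)
            \<and> length fs = k \<and> (\<forall>i<k. fs ! i \<in> Ar C (cs ! i) (cs ! Suc i)) \<and> z \<in> El Z (cs ! k, k)}),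
     Rs = (\<lambda>(a, l) (b, k) (h, \<theta>) (cs, f, fs, z).
       (map (\<lambda>j. cs ! \<theta> j) [0..<Suc l],
        Cmp C a (cs ! 0) (cs ! \<theta> 0) (chain_arrow C cs fs 0 (\<theta> 0)) (Cmp C a b (cs ! 0) f h),
        map (\<lambda>j. chain_arrow C cs fs (\<theta> j) (\<theta> (Suc j))) [0..<l],
        Rs Z (cs ! \<theta> l, l) (cs ! k, k) (chain_arrow C cs fs (\<theta> l) k, \<theta>) z))\<rparr>"

text \<open>The cotensor of \<open>CSS\<^sub>n\<close> over simplicial sets is computed in each multidegree.\<close>

definition cotensor :: "nat \<Rightarrow> 'e sset \<Rightarrow> 'd sspace \<Rightarrow> (nat \<Rightarrow> 'e \<times> (nat \<Rightarrow> nat) \<Rightarrow> 'd) sspace" where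
  "cotensor n K X = \<lparr>
     El = (\<lambda>(ms, k). El (sset_map K (slice (SimpN n) X ms)) k),
     Rs = (\<lambda>(ls, k) (ms, l) (\<rho>s, \<rho>) \<eta>. \<lambda>j\<in>UNIV. \<lambda>(x, g)\<in>El K j \<times> Ar Simp j k.
       Rs X (ls, j) (ms, j) (\<rho>s, Ide Simp j) (\<eta> j (x, Cmp Simp j k l \<rho> g)))\<rparr>"

text \<open>The end of \<open>{Z(c), F(c)}\<close> over \<open>c\<close>: families of elements of the cotensors, such that for
  \<open>f : c \<rightarrow> d\<close> the two images in \<open>{Z(d), F(c)}\<close> agree.\<close>

definition end_cotensor :: "nat \<Rightarrow> (pt set \<times> nat, (pt \<Rightarrow> pt) \<times> (nat \<Rightarrow> nat), 'e) psh \<Rightarrow> 'V ffun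
    \<Rightarrow> (pt set \<Rightarrow> nat \<Rightarrow> 'e \<times> (nat \<Rightarrow> nat) \<Rightarrow> 'V) sspace" where
  "end_cotensor n Z F = \<lparr>
     El = (\<lambda>(ms, k). {\<alpha> \<in> (\<Pi>\<^sub>E c\<in>Ob Cart. El (cotensor n (slice Cart Z c) (FOb F c)) (ms, k)).
            \<forall>c\<in>Ob Cart. \<forall>d\<in>Ob Cart. \<forall>f\<in>Ar Cart c d. \<forall>j. \<forall>x\<in>El Z (d, j). \<forall>g\<in>Ar Simp j k.
              \<alpha> c j (Rs Z (c, j) (d, j) (f, Ide Simp j) x, g) = FAr F c d f (ms, j) (\<alpha> d j (x, g))}),
     Rs = (\<lambda>p q \<rho> \<alpha>. \<lambda>c\<in>Ob Cart. Rs (cotensor n (slice Cart Z c) (FOb F c)) p q \<rho> (\<alpha> c))\<rparr>"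

text \<open>\<open>F(P)\<close>, reduced with respect to the objects \<open>\<O>\<close>, as an object of \<open>CSS\<^sub>n\<close>.\<close>

definition F_red :: "'V set set \<Rightarrow> nat \<Rightarrow> 'V ffun \<Rightarrow> ('p, 'V) efun \<Rightarrow> 'p omfd set \<Rightarrow> 'V sspace" where
  "F_red U n F P \<O> = copy_in U (SSp n) (end_cotensor n (dugger_Q Cart (bar \<O> P)) F)"

definition F_red_D :: "'V set set \<Rightarrow> nat \<Rightarrow> 'V ffun \<Rightarrow> ('p, 'V) efun \<Rightarrow> 'p omfd \<Rightarrow> 'V sspace" where
  "F_red_D U n F P Y = F_red U n F P {Y}"

definition F_red_coh :: "'V set set \<Rightarrow> nat \<Rightarrow> 'V ffun \<Rightarrow> ('p, 'V) efun \<Rightarrow> 'p omfd \<Rightarrow> 'V sspace" where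
  "F_red_coh U n F P Y = F_red U n F P (component Y)"

end

theory Submission
  imports Defs
begin

text \<open>
  Every manifold in the component of \<open>Y\<close> is diffeomorphic to \<open>Y\<close>, so the inclusion of the enriched
  groupoid \<open>D(Y)\<close> into that of the whole component is an equivalence of enriched groupoids. To make this
  explicit, choose an orientation-preserving diffeomorphism \<open>h\<^sub>M : Y \<rightarrow> M\<close> for every \<open>M\<close> in the component,
  with \<open>h\<^sub>Y\<close> the identity. Conjugating all arrows by the constant families \<open>h\<^sub>M\<close> retracts the bar
  construction over the component onto the one over \<open>{Y}\<close>. Conjugating only at those vertices of a simplex
  that are sent to \<open>1\<close> by a given map to the \<open>1\<close>-simplex is a simplicial homotopy from the identity to that
  retraction (\<open>homotopy_retract_bar\<close>).

  Such a retraction up to a homotopy is an elementary notion, called \<open>homotopy_retract\<close> below, and all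
  further constructions preserve it. Dugger's replacement commutes with the product by a simplicial set
  that does not depend on the test space (\<open>homotopy_retract_dugger\<close>). The functor \<open>{-, F}\<close>, followed by the
  end over test spaces, is contravariant and turns a homotopy on its first argument into a homotopy on its
  values, interchanging inclusion and retraction (\<open>homotopy_retract_end\<close>). So the two maps between the reduced
  objects are restriction along the inclusion and along the retraction.

  A homotopy retract is a weak equivalence in \<open>CSS\<^sub>n\<close> for formal reasons. By definition, a map is a weak
  equivalence if it induces weak homotopy equivalences on mapping spaces into local objects, and these are
  in turn detected on components of mapping spaces into Kan complexes. Mapping spaces preserve homotopy
  retracts (\<open>homotopy_retract_map_space\<close>), and a homotopy retract of simplicial sets induces bijections on
  components, because the homotopy provides an edge from each vertex to its image (\<open>homotopy_retract_pi0\<close>).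
  One of the two composites of the maps is the identity on the nose; since both are invertible in the
  homotopy category, they are then inverse to each other (\<open>strict_retract_inverse_in_ho\<close>).

  Two ingredients take more work than this outline suggests. The arrows of the bar construction must be closed
  under composition and conjugation, which is a statement about smooth families of orientation-preserving
  diffeomorphisms. It is proved by describing smooth families through their effect on plots, that is, on
  smooth maps from open subsets of Euclidean spaces: in this description, composition is trivial, and all
  of the calculus (chain rule, multiplicativity of the Jacobian) goes into comparing plots with charts.
  Secondly, the reduced objects have to be sets in the universe \<open>L\<close>, which follows from general closure
  properties of universes.
\<close>

section \<open>Partial derivatives and the chain rule\<close>

lemma zero_in_Rsp: "(\<lambda>_. 0) \<in> Rsp n"
  by (simp add: Rsp_def)

lemma Rsp_subset_Rinf: "Rsp n \<subseteq> Rinf"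
  by (auto simp: Rinf_def)

lemma Rsp_upd: "x \<in> Rsp n \<Longrightarrow> i < n \<Longrightarrow> x(i := t) \<in> Rsp n"
  by (auto simp: Rsp_def)

text \<open>Openness in \<open>Rsp n\<close> is tested on cubes. This replaces the product topology of the type
  \<open>pt\<close> by explicit inequalities between finitely many coordinates.\<close>

lemma open_Rsp_iff:
  "open_Rsp n W \<longleftrightarrow> W \<subseteq> Rsp n \<and>
     (\<forall>x\<in>W. \<exists>e>0. \<forall>y\<in>Rsp n. (\<forall>i<n. \<bar>y i - x i\<bar> < e) \<longrightarrow> y \<in> W)" (is "?L \<longleftrightarrow> ?R")
proof
  assume ?L
  then obtain T where T: "open T" "W = Rsp n \<inter> T" by (auto simp: openin_open)
  have "\<exists>e>0. \<forall>y\<in>Rsp n. (\<forall>i<n. \<bar>y i - x i\<bar> < e) \<longrightarrow> y \<in> W" if "x \<in> W" for x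
  proof -
    have "openin (product_topology (\<lambda>i. euclidean) UNIV) T" "x \<in> T"
      using T that by (auto simp: euclidean_product_topology open_openin[symmetric])
    from product_topology_open_contains_basis[OF this] obtain X where
      X: "x \<in> (\<Pi>\<^sub>E i\<in>UNIV. X i)" "\<And>i. open (X i)" "(\<Pi>\<^sub>E i\<in>UNIV. X i) \<subseteq> T"
      by (auto simp: openin_subtopology)
    have "\<exists>e>0. \<forall>t. \<bar>t - x i\<bar> < e \<longrightarrow> t \<in> X i" for i
    proof -
      have "x i \<in> X i" using X(1) by auto
      with X(2)[of i] obtain e where "e > 0" "\<forall>y. dist y (x i) < e \<longrightarrow> y \<in> X i"
        unfolding open_dist by blast
      then show ?thesis by (auto simp: dist_real_def)
    qed
    then obtain e where e: "\<And>i. e i > 0" "\<And>i t. \<bar>t - x i\<bar> < e i \<Longrightarrow> t \<in> X i" by metis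
    (* The number 1 only guards against n = 0. *)
    define d where "d = Min (insert 1 (e ` {..<n}))"
    have d: "d > 0" "\<And>i. i < n \<Longrightarrow> d \<le> e i" unfolding d_def using e(1) by (auto intro: Min_le)
    have "y \<in> W" if y: "y \<in> Rsp n" "\<forall>i<n. \<bar>y i - x i\<bar> < d" for y
    proof -
      have "y i \<in> X i" for i
      proof (cases "i < n")
        case True then show ?thesis using y d by (intro e(2)) force
      next
        case False
        then have "y i = x i" using y \<open>x \<in> W\<close> T by (auto simp: Rsp_def)
        then show ?thesis using e(1)[of i] by (intro e(2)) auto
      qed
      then show ?thesis using X(3) y T by auto
    qed
    then show ?thesis using d by blast
  qed
  then show ?R using T by blast
next
  assume R: ?R
  show ?L
  proof (subst openin_subopen, intro ballI)
    fix x assume x: "x \<in> W"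
    then obtain e where e: "e > 0" "\<forall>y\<in>Rsp n. (\<forall>i<n. \<bar>y i - x i\<bar> < e) \<longrightarrow> y \<in> W" using R by blast
    have "open (\<Inter>i\<in>{..<n}. {y::pt. \<bar>y i - x i\<bar> < e})"
      by (intro open_INT ballI open_Collect_less continuous_intros) auto
    then have "openin (top_of_set (Rsp n)) (Rsp n \<inter> (\<Inter>i\<in>{..<n}. {y. \<bar>y i - x i\<bar> < e}))"
      by (rule openin_open_Int)
    moreover have "x \<in> Rsp n \<inter> (\<Inter>i\<in>{..<n}. {y. \<bar>y i - x i\<bar> < e})" using R x e by auto
    moreover have "Rsp n \<inter> (\<Inter>i\<in>{..<n}. {y. \<bar>y i - x i\<bar> < e}) \<subseteq> W" using e by auto
    ultimately show "\<exists>T. openin (top_of_set (Rsp n)) T \<and> x \<in> T \<and> T \<subseteq> W" by blast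
  qed
qed

lemma open_Rsp_subset: "open_Rsp n W \<Longrightarrow> W \<subseteq> Rsp n"
  by (simp add: open_Rsp_iff)

lemma open_Rsp_box:
  assumes "open_Rsp n W" "x \<in> W"
  obtains e where "e > 0" "\<And>y. y \<in> Rsp n \<Longrightarrow> (\<And>i. i < n \<Longrightarrow> \<bar>y i - x i\<bar> < e) \<Longrightarrow> y \<in> W"
  using assms unfolding open_Rsp_iff by blast

lemma open_Rsp_preimage:
  assumes "open_Rsp n W" "continuous_on W f" "open T"
  shows "open_Rsp n {x\<in>W. f x \<in> T}"
  using continuous_openin_preimage[OF assms(2), of UNIV T] assms(1,3)
  by (auto simp: vimage_def Int_def intro: openin_trans)

lemma continuous_box:
  assumes "open_Rsp n W" "continuous_on W f" "x \<in> W" "e > (0::real)"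
  obtains d where "d > 0"
    "\<And>y. y \<in> Rsp n \<Longrightarrow> (\<And>i. i < n \<Longrightarrow> \<bar>y i - x i\<bar> < d) \<Longrightarrow> y \<in> W \<and> \<bar>f y - f x\<bar> < e"
proof -
  have "open_Rsp n {y\<in>W. f y \<in> ball (f x) e}" by (rule open_Rsp_preimage[OF assms(1,2)]) auto
  then obtain d where "d > 0"
    "\<And>y. y \<in> Rsp n \<Longrightarrow> (\<And>i. i < n \<Longrightarrow> \<bar>y i - x i\<bar> < d) \<Longrightarrow> y \<in> {y\<in>W. f y \<in> ball (f x) e}"
    by (rule open_Rsp_box[of n _ x]) (use assms in auto)
  then show thesis by (intro that[of d]) (auto simp: dist_real_def abs_minus_commute)
qed

lemma eventually_line:
  assumes "open_Rsp n W" "x \<in> W" "i < n"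
  shows "\<forall>\<^sub>F t in nhds (x i). x(i := t) \<in> W"
proof -
  obtain e where e: "e > 0" "\<And>y. y \<in> Rsp n \<Longrightarrow> (\<And>i. i < n \<Longrightarrow> \<bar>y i - x i\<bar> < e) \<Longrightarrow> y \<in> W"
    using open_Rsp_box[OF assms(1,2)] by blast
  have "x(i := t) \<in> W" if "dist t (x i) < e" for t
    using that assms open_Rsp_subset e(1) by (intro e(2) Rsp_upd) (auto simp: dist_real_def)
  then show ?thesis using e(1) unfolding eventually_nhds_metric by blast
qed

lemma cont_diff_continuous: "cont_diff k n W f \<Longrightarrow> continuous_on W f"
  by (cases k) auto

lemma cont_diff_Suc_imp: "cont_diff (Suc k) n W f \<Longrightarrow> cont_diff k n W f"
proof (induction k arbitrary: f)
  case (Suc k)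
  then show ?case by (metis cont_diff.simps(2))
qed auto

lemma cont_diff_restrict:
  "cont_diff k n W f \<Longrightarrow> W' \<subseteq> W \<Longrightarrow> d \<le> n \<Longrightarrow> cont_diff k d W' f"
proof (induction k arbitrary: f)
  case (Suc k)
  show ?case unfolding cont_diff.simps
  proof (intro conjI allI impI)
    show "continuous_on W' f" using Suc.prems continuous_on_subset by auto
    fix i assume "i < d"
    then have "i < n" using Suc.prems by simp
    then obtain g where "\<forall>x\<in>W. ((\<lambda>t. f (x(i := t))) has_real_derivative g x) (at (x i))" "cont_diff k n W g"
      using Suc.prems by auto
    then show "\<exists>g. (\<forall>x\<in>W'. ((\<lambda>t. f (x(i := t))) has_real_derivative g x) (at (x i))) \<and> cont_diff k d W' g"
      using Suc.IH Suc.prems by blast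
  qed
qed (auto intro: continuous_on_subset)

lemma cont_diff_cong:
  assumes "open_Rsp n W" "\<And>x. x \<in> W \<Longrightarrow> f x = g x" "cont_diff k n W f"
  shows "cont_diff k n W g"
proof (cases k)
  case 0
  then show ?thesis using assms continuous_on_cong by force
next
  case (Suc l)
  have "((\<lambda>t. g (x(i := t))) has_real_derivative h x) (at (x i))"
    if "x \<in> W" "i < n" "((\<lambda>t. f (x(i := t))) has_real_derivative h x) (at (x i))" for x i h
  proof -
    have "\<forall>\<^sub>F t in nhds (x i). f (x(i := t)) = g (x(i := t))"
      using eventually_line[OF assms(1) that(1,2)] by eventually_elim (rule assms(2))
    from DERIV_cong_ev[OF refl this refl] that(3) show ?thesis by blast
  qed
  moreover have "continuous_on W g"
    using assms cont_diff_continuous continuous_on_cong by metis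
  ultimately show ?thesis using assms(3) unfolding Suc cont_diff.simps by metis
qed

lemma cont_diff_const [simp]: "cont_diff k n W (\<lambda>_. c)"
proof (induction k arbitrary: c)
  case (Suc k)
  show ?case unfolding cont_diff.simps
    by (intro conjI allI impI exI[of _ "\<lambda>_. 0"] Suc) auto
qed auto

lemma cont_diff_coord [simp]: "cont_diff k n W (\<lambda>x. x j)"
proof (cases k)
  case (Suc l)
  have "\<exists>g. (\<forall>x\<in>W. ((\<lambda>t. (x(i := t)) j) has_real_derivative g x) (at (x i))) \<and> cont_diff l n W g" for i
    by (rule exI[of _ "\<lambda>_. if i = j then 1 else 0"]) (auto intro!: derivative_eq_intros)
  moreover have "continuous_on W (\<lambda>x::pt. x j)"
    by (rule continuous_on_subset[OF continuous_on_product_coordinates]) auto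
  ultimately show ?thesis unfolding Suc by auto
next
  case 0
  have "continuous_on W (\<lambda>x::pt. x j)"
    by (rule continuous_on_subset[OF continuous_on_product_coordinates]) auto
  then show ?thesis unfolding 0 by simp
qed

lemma cont_diff_add:
  "cont_diff k n W f \<Longrightarrow> cont_diff k n W g \<Longrightarrow> cont_diff k n W (\<lambda>x. f x + g x)"
proof (induction k arbitrary: f g)
  case (Suc k)
  show ?case unfolding cont_diff.simps
  proof (intro conjI allI impI)
    show "continuous_on W (\<lambda>x. f x + g x)" using Suc.prems by (auto intro: continuous_intros)
    fix i assume "i < n"
    with Suc.prems obtain f' g' where
      "\<forall>x\<in>W. ((\<lambda>t. f (x(i := t))) has_real_derivative f' x) (at (x i))" "cont_diff k n W f'"
      "\<forall>x\<in>W. ((\<lambda>t. g (x(i := t))) has_real_derivative g' x) (at (x i))" "cont_diff k n W g'"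
      by fastforce
    then show "\<exists>h. (\<forall>x\<in>W. ((\<lambda>t. f (x(i := t)) + g (x(i := t))) has_real_derivative h x) (at (x i)))
        \<and> cont_diff k n W h"
      using Suc.IH by (intro exI[of _ "\<lambda>x. f' x + g' x"]) (auto intro: DERIV_add)
  qed
qed (auto intro: continuous_intros)

lemma cont_diff_mult:
  "cont_diff k n W f \<Longrightarrow> cont_diff k n W g \<Longrightarrow> cont_diff k n W (\<lambda>x. f x * g x)"
proof (induction k arbitrary: f g)
  case (Suc k)
  show ?case unfolding cont_diff.simps
  proof (intro conjI allI impI)
    show "continuous_on W (\<lambda>x. f x * g x)" using Suc.prems by (auto intro: continuous_intros)
    fix i assume "i < n"
    with Suc.prems obtain f' g' where
      d: "\<forall>x\<in>W. ((\<lambda>t. f (x(i := t))) has_real_derivative f' x) (at (x i))" "cont_diff k n W f'"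
      "\<forall>x\<in>W. ((\<lambda>t. g (x(i := t))) has_real_derivative g' x) (at (x i))" "cont_diff k n W g'"
      by fastforce
    have "((\<lambda>t. f (x(i := t)) * g (x(i := t))) has_real_derivative f' x * g x + g' x * f x) (at (x i))"
      if "x \<in> W" for x
      using DERIV_mult[OF d(1)[rule_format, OF that] d(3)[rule_format, OF that]] by simp
    moreover have "cont_diff k n W (\<lambda>x. f' x * g x + g' x * f x)"
      using d Suc.prems by (intro cont_diff_add Suc.IH) (auto intro: cont_diff_Suc_imp)
    ultimately show "\<exists>h. (\<forall>x\<in>W. ((\<lambda>t. f (x(i := t)) * g (x(i := t))) has_real_derivative h x) (at (x i)))
        \<and> cont_diff k n W h"
      by (intro exI[of _ "\<lambda>x. f' x * g x + g' x * f x"]) auto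
  qed
qed (auto intro: continuous_intros)

lemma cont_diff_sum:
  assumes "\<And>j. j \<in> A \<Longrightarrow> cont_diff k n W (f j)"
  shows "cont_diff k n W (\<lambda>x. \<Sum>j\<in>A. f j x)"
  using assms by (induction A rule: infinite_finite_induct) (auto intro: cont_diff_add)

lemma mvt_segment:
  fixes \<phi> :: "real \<Rightarrow> real"
  assumes "\<And>t. \<bar>t - a\<bar> \<le> \<bar>b - a\<bar> \<Longrightarrow> (\<phi> has_real_derivative \<phi>' t) (at t)"
  shows "\<exists>t. \<bar>t - a\<bar> \<le> \<bar>b - a\<bar> \<and> \<phi> b - \<phi> a = \<phi>' t * (b - a)"
proof -
  consider "a = b" | "a < b" | "b < a" by linarith
  then show ?thesis
  proof cases
    case 1 then show ?thesis by auto
  next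
    case 2
    then obtain z where "a < z" "z < b" "\<phi> b - \<phi> a = (b - a) * \<phi>' z"
      using MVT2[of a b \<phi> \<phi>'] assms by auto
    then show ?thesis by (intro exI[of _ z]) (auto simp: mult.commute)
  next
    case 3
    then obtain z where "b < z" "z < a" "\<phi> a - \<phi> b = (a - b) * \<phi>' z"
      using MVT2[of b a \<phi> \<phi>'] assms by auto
    then show ?thesis by (intro exI[of _ z]) (auto simp: algebra_simps)
  qed
qed

text \<open>Moving from \<open>x\<close> to \<open>y\<close> by changing one coordinate at a time and applying the mean value
  theorem to each of the \<open>n\<close> steps writes the increment of \<open>f\<close> in terms of partial derivatives at
  points of the cube around \<open>x\<close> that is spanned by \<open>y\<close>.\<close>

lemma mvt_partials:
  assumes xy: "x \<in> Rsp n" "y \<in> Rsp n"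
    and box: "\<And>z. z \<in> Rsp n \<Longrightarrow> (\<And>i. i < n \<Longrightarrow> \<bar>z i - x i\<bar> \<le> \<bar>y i - x i\<bar>) \<Longrightarrow> z \<in> W"
    and der: "\<And>i z. i < n \<Longrightarrow> z \<in> W \<Longrightarrow> ((\<lambda>t. f (z(i := t))) has_real_derivative D i z) (at (z i))"
  shows "\<exists>\<xi>. (\<forall>i<n. \<xi> i \<in> Rsp n \<and> (\<forall>j<n. \<bar>\<xi> i j - x j\<bar> \<le> \<bar>y j - x j\<bar>)) \<and>
     f y - f x = (\<Sum>i<n. D i (\<xi> i) * (y i - x i))"
proof -
  (* A path of points along the edges of the cube, from z 0 = x to z n = y. *)
  define z where "z m = (\<lambda>j. if j < m then y j else x j)" for m :: nat
  have z: "z m \<in> Rsp n" for m using xy by (auto simp: z_def Rsp_def)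
  have zb: "\<bar>z m j - x j\<bar> \<le> \<bar>y j - x j\<bar>" for m j by (auto simp: z_def)
  have "\<exists>t. \<bar>t - x i\<bar> \<le> \<bar>y i - x i\<bar> \<and> f (z (Suc i)) - f (z i) = D i ((z i)(i := t)) * (y i - x i)"
    if i: "i < n" for i
  proof -
    have "((\<lambda>t. f ((z i)(i := t))) has_real_derivative D i ((z i)(i := t))) (at t)"
      if "\<bar>t - x i\<bar> \<le> \<bar>y i - x i\<bar>" for t
      using der[OF i, of "(z i)(i := t)"] box[of "(z i)(i := t)"] Rsp_upd[OF z[of i] i, of t] zb[of i] that
      by (auto split: if_splits)
    from mvt_segment[of "x i" "y i" "\<lambda>t. f ((z i)(i := t))" "\<lambda>t. D i ((z i)(i := t))", OF this]
    obtain t where t: "\<bar>t - x i\<bar> \<le> \<bar>y i - x i\<bar>"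
      "f ((z i)(i := y i)) - f ((z i)(i := x i)) = D i ((z i)(i := t)) * (y i - x i)" by blast
    have "(z i)(i := y i) = z (Suc i)" "(z i)(i := x i) = z i" by (auto simp: z_def less_Suc_eq)
    with t show ?thesis by auto
  qed
  then obtain t where t: "\<And>i. i < n \<Longrightarrow> \<bar>t i - x i\<bar> \<le> \<bar>y i - x i\<bar>"
    "\<And>i. i < n \<Longrightarrow> f (z (Suc i)) - f (z i) = D i ((z i)(i := t i)) * (y i - x i)" by metis
  have "f y - f x = f (z n) - f (z 0)"
  proof -
    have "z n = y" "z 0 = x" using xy by (auto simp: z_def Rsp_def fun_eq_iff)
    then show ?thesis by simp
  qed
  also have "\<dots> = (\<Sum>i<n. f (z (Suc i)) - f (z i))" using sum_lessThan_telescope[of "\<lambda>i. f (z i)" n] by simp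
  also have "\<dots> = (\<Sum>i<n. D i ((z i)(i := t i)) * (y i - x i))" using t by (intro sum.cong) auto
  finally show ?thesis
    using t(1) Rsp_upd[OF z] zb by (intro exI[of _ "\<lambda>i. (z i)(i := t i)"]) auto
qed

text \<open>No norm on the space of sequences is involved: the chain rule is derived from partial
  derivatives alone, by \<open>mvt_partials\<close>: divide the increment by \<open>t - t0\<close>. The intermediate points
  converge to \<open>\<gamma> t0\<close>, and there the partial derivatives are continuous.\<close>

lemma DERIV_chain_partials:
  fixes \<gamma> :: "real \<Rightarrow> pt"
  assumes W: "open_Rsp n W" "\<gamma> t0 \<in> W"
    and ev: "\<forall>\<^sub>F t in at t0. \<gamma> t \<in> W"
    and \<gamma>: "\<And>j. j < n \<Longrightarrow> ((\<lambda>t. \<gamma> t j) has_real_derivative \<gamma>' j) (at t0)"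
    and der: "\<And>i z. i < n \<Longrightarrow> z \<in> W \<Longrightarrow> ((\<lambda>t. f (z(i := t))) has_real_derivative D i z) (at (z i))"
    and cont: "\<And>i. i < n \<Longrightarrow> continuous_on W (D i)"
  shows "((\<lambda>t. f (\<gamma> t)) has_real_derivative (\<Sum>i<n. D i (\<gamma> t0) * \<gamma>' i)) (at t0)"
proof -
  let ?x = "\<gamma> t0"
  obtain e where e: "e > 0" "\<And>y. y \<in> Rsp n \<Longrightarrow> (\<And>i. i < n \<Longrightarrow> \<bar>y i - ?x i\<bar> < e) \<Longrightarrow> y \<in> W"
    using open_Rsp_box[OF W] by blast
  have lim: "((\<lambda>t. \<gamma> t j) \<longlongrightarrow> ?x j) (at t0)" if "j < n" for j
    using DERIV_isCont[OF \<gamma>[OF that]] by (simp add: isCont_def)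
  have near: "\<forall>\<^sub>F t in at t0. \<forall>j\<in>{..<n}. \<bar>\<gamma> t j - ?x j\<bar> < d" if "d > 0" for d
    using lim that by (intro eventually_ball_finite) (auto simp: tendsto_iff dist_real_def)
  define good where "good t \<longleftrightarrow> \<gamma> t \<in> Rsp n \<and> (\<forall>j\<in>{..<n}. \<bar>\<gamma> t j - ?x j\<bar> < e)" for t
  have good: "\<forall>\<^sub>F t in at t0. good t"
    using ev near[OF e(1)] by eventually_elim (use open_Rsp_subset[OF W(1)] in \<open>auto simp: good_def\<close>)
  have ex: "\<exists>\<xi>. good t \<longrightarrow> (\<forall>i<n. \<xi> i \<in> Rsp n \<and> (\<forall>j<n. \<bar>\<xi> i j - ?x j\<bar> \<le> \<bar>\<gamma> t j - ?x j\<bar>)) \<and>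
     f (\<gamma> t) - f ?x = (\<Sum>i<n. D i (\<xi> i) * (\<gamma> t i - ?x i))" for t
  proof (cases "good t")
    case True
    have "z \<in> W" if "z \<in> Rsp n" "\<And>i. i < n \<Longrightarrow> \<bar>z i - ?x i\<bar> \<le> \<bar>\<gamma> t i - ?x i\<bar>" for z
    proof (rule e(2)[OF that(1)])
      fix i assume "i < n"
      with that(2) True show "\<bar>z i - ?x i\<bar> < e" unfolding good_def by (meson le_less_trans lessThan_iff)
    qed
    from mvt_partials[of ?x n "\<gamma> t" W f D, OF _ _ this der] True W open_Rsp_subset[OF W(1)]
    show ?thesis by (auto simp: good_def)
  qed auto
  have "\<forall>t. \<exists>\<xi>. good t \<longrightarrow> (\<forall>i<n. \<xi> i \<in> Rsp n \<and> (\<forall>j<n. \<bar>\<xi> i j - ?x j\<bar> \<le> \<bar>\<gamma> t j - ?x j\<bar>)) \<and>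
     f (\<gamma> t) - f ?x = (\<Sum>i<n. D i (\<xi> i) * (\<gamma> t i - ?x i))" using ex by blast
  from choice[OF this] obtain \<xi> where
    "\<forall>t. good t \<longrightarrow> (\<forall>i<n. \<xi> t i \<in> Rsp n \<and> (\<forall>j<n. \<bar>\<xi> t i j - ?x j\<bar> \<le> \<bar>\<gamma> t j - ?x j\<bar>)) \<and>
     f (\<gamma> t) - f ?x = (\<Sum>i<n. D i (\<xi> t i) * (\<gamma> t i - ?x i))" by blast
  then have \<xi>: "\<And>t i. good t \<Longrightarrow> i < n \<Longrightarrow> \<xi> t i \<in> Rsp n"
    "\<And>t i j. good t \<Longrightarrow> i < n \<Longrightarrow> j < n \<Longrightarrow> \<bar>\<xi> t i j - ?x j\<bar> \<le> \<bar>\<gamma> t j - ?x j\<bar>"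
    "\<And>t. good t \<Longrightarrow> f (\<gamma> t) - f ?x = (\<Sum>i<n. D i (\<xi> t i) * (\<gamma> t i - ?x i))" by auto
  have D: "((\<lambda>t. D i (\<xi> t i)) \<longlongrightarrow> D i ?x) (at t0)" if i: "i < n" for i
    unfolding tendsto_iff
  proof (intro allI impI)
    fix r :: real assume "r > 0"
    then obtain d where d: "d > 0" "\<And>y. y \<in> Rsp n \<Longrightarrow> (\<And>i. i < n \<Longrightarrow> \<bar>y i - ?x i\<bar> < d) \<Longrightarrow> y \<in> W \<and> \<bar>D i y - D i ?x\<bar> < r"
      using continuous_box[OF W(1) cont[OF i] W(2) \<open>r > 0\<close>] by blast
    show "\<forall>\<^sub>F t in at t0. dist (D i (\<xi> t i)) (D i ?x) < r"
      using good near[OF d(1)]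
    proof eventually_elim
      case (elim t)
      have "\<bar>\<xi> t i j - ?x j\<bar> < d" if "j < n" for j
        using \<xi>(2)[OF elim(1) i that] elim(2) that by (meson le_less_trans lessThan_iff)
      then show ?case using d(2)[OF \<xi>(1)[OF elim(1) i]] by (simp add: dist_real_def)
    qed
  qed
  have "((\<lambda>t. \<Sum>i<n. D i (\<xi> t i) * ((\<gamma> t i - ?x i) / (t - t0))) \<longlongrightarrow> (\<Sum>i<n. D i ?x * \<gamma>' i)) (at t0)"
    using \<gamma> D by (intro tendsto_intros) (auto simp: has_field_derivative_iff)
  then have "((\<lambda>t. (f (\<gamma> t) - f ?x) / (t - t0)) \<longlongrightarrow> (\<Sum>i<n. D i ?x * \<gamma>' i)) (at t0)"
    by (rule Lim_transform_eventually)
      (use good in \<open>eventually_elim, simp add: \<xi>(3) sum_divide_distrib\<close>)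
  then show ?thesis by (simp add: has_field_derivative_iff)
qed

lemma cont_diff_partials:
  assumes "cont_diff (Suc k) n W f"
  obtains D where "\<And>i z. i < n \<Longrightarrow> z \<in> W \<Longrightarrow> ((\<lambda>t. f (z(i := t))) has_real_derivative D i z) (at (z i))"
    "\<And>i. i < n \<Longrightarrow> cont_diff k n W (D i)"
proof -
  have "\<forall>i\<in>{..<n}. \<exists>g. (\<forall>x\<in>W. ((\<lambda>t. f (x(i := t))) has_real_derivative g x) (at (x i))) \<and> cont_diff k n W g"
    using assms by simp
  from bchoice[OF this] show thesis using that by blast
qed

lemma continuous_on_pt:
  "(\<And>j. continuous_on U (\<lambda>x. g x j)) \<Longrightarrow> continuous_on U (g :: pt \<Rightarrow> pt)"
  by (rule continuous_on_coordinatewise_then_product)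

lemma partial_compose:
  assumes U: "open_Rsp m U" and W: "open_Rsp n W" and g: "g \<in> U \<rightarrow> W" and x: "x \<in> U" "i < m"
    and der: "\<And>i z. i < n \<Longrightarrow> z \<in> W \<Longrightarrow> ((\<lambda>t. f (z(i := t))) has_real_derivative D i z) (at (z i))"
    and cont: "\<And>i. i < n \<Longrightarrow> continuous_on W (D i)"
    and gder: "\<And>j. j < n \<Longrightarrow> ((\<lambda>t. g (x(i := t)) j) has_real_derivative g' j) (at (x i))"
  shows "((\<lambda>t. f (g (x(i := t)))) has_real_derivative (\<Sum>j<n. D j (g x) * g' j)) (at (x i))"
proof -
  have "\<forall>\<^sub>F t in at (x i). g (x(i := t)) \<in> W"
    using eventually_line[OF U x] g by (auto simp: eventually_at_filter elim: eventually_mono)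
  with DERIV_chain_partials[OF W, of "\<lambda>t. g (x(i := t))" "x i" g' f D] g x der cont gder
  show ?thesis by auto
qed

text \<open>By the chain rule, a partial derivative of the composite is a sum of products of functions
  to which the induction hypothesis applies.\<close>

lemma cont_diff_compose:
  assumes U: "open_Rsp m U" and W: "open_Rsp n W" and g: "g \<in> U \<rightarrow> W"
    and gd: "\<And>j. cont_diff k m U (\<lambda>x. g x j)" and f: "cont_diff k n W f"
  shows "cont_diff k m U (\<lambda>x. f (g x))"
  using gd f
proof (induction k arbitrary: f)
  case 0
  have "continuous_on U g" using 0 by (intro continuous_on_pt) auto
  then show ?case using 0 g by (auto intro!: continuous_on_compose2[of W f])
next
  case (Suc k)
  obtain D where D: "\<And>i z. i < n \<Longrightarrow> z \<in> W \<Longrightarrow> ((\<lambda>t. f (z(i := t))) has_real_derivative D i z) (at (z i))"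
    "\<And>i. i < n \<Longrightarrow> cont_diff k n W (D i)" by (rule cont_diff_partials[OF Suc.prems(2)], rule that) assumption+
  have gk: "cont_diff k m U (\<lambda>x. g x j)" for j by (rule cont_diff_Suc_imp[OF Suc.prems(1)])
  have Dg: "cont_diff k m U (\<lambda>x. D i (g x))" if "i < n" for i by (rule Suc.IH[OF gk D(2)[OF that]])
  show ?case unfolding cont_diff.simps
  proof (intro conjI allI impI)
    show "continuous_on U (\<lambda>x. f (g x))"
      by (rule continuous_on_compose2[OF cont_diff_continuous[OF Suc.prems(2)]
            continuous_on_pt[OF cont_diff_continuous[OF Suc.prems(1)]]]) (use g in auto)
    fix i assume i: "i < m"
    have "\<forall>j. \<exists>G. (\<forall>x\<in>U. ((\<lambda>t. g (x(i := t)) j) has_real_derivative G x) (at (x i))) \<and> cont_diff k m U G"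
      using Suc.prems(1) i by simp
    from choice[OF this] obtain G where G: "\<And>j x. x \<in> U \<Longrightarrow> ((\<lambda>t. g (x(i := t)) j) has_real_derivative G j x) (at (x i))"
      "\<And>j. cont_diff k m U (G j)" by blast
    have "((\<lambda>t. f (g (x(i := t)))) has_real_derivative (\<Sum>j<n. D j (g x) * G j x)) (at (x i))"
      if "x \<in> U" for x
      by (rule partial_compose[OF U W g that i D(1) _ G(1)]) (use D(2) cont_diff_continuous that in blast)+
    moreover have "cont_diff k m U (\<lambda>x. \<Sum>j<n. D j (g x) * G j x)"
      by (intro cont_diff_sum cont_diff_mult Dg G) auto
    ultimately show "\<exists>h. (\<forall>x\<in>U. ((\<lambda>t. f (g (x(i := t)))) has_real_derivative h x) (at (x i))) \<and> cont_diff k m U h"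
      by (intro exI[of _ "\<lambda>x. \<Sum>j<n. D j (g x) * G j x"]) blast
  qed
qed

section \<open>Smooth maps between subsets of the space of finite sequences\<close>

definition smooth_Rsp :: "nat \<Rightarrow> pt set \<Rightarrow> (pt \<Rightarrow> pt) \<Rightarrow> bool" where
  "smooth_Rsp n U g \<longleftrightarrow> (\<forall>j k. cont_diff k n U (\<lambda>x. g x j))"

lemma smooth_Rsp_mono: "smooth_Rsp n U g \<Longrightarrow> U' \<subseteq> U \<Longrightarrow> d \<le> n \<Longrightarrow> smooth_Rsp d U' g"
  by (auto simp: smooth_Rsp_def intro: cont_diff_restrict)

lemma smooth_Rsp_cong:
  "open_Rsp n U \<Longrightarrow> (\<And>x. x \<in> U \<Longrightarrow> f x = g x) \<Longrightarrow> smooth_Rsp n U f \<Longrightarrow> smooth_Rsp n U g"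
  unfolding smooth_Rsp_def by (auto intro: cont_diff_cong[where f = "\<lambda>x. f x _"])

lemma smooth_Rsp_compose:
  "open_Rsp m U \<Longrightarrow> open_Rsp n W \<Longrightarrow> g \<in> U \<rightarrow> W \<Longrightarrow> smooth_Rsp m U g \<Longrightarrow> smooth_Rsp n W f
     \<Longrightarrow> smooth_Rsp m U (\<lambda>x. f (g x))"
  unfolding smooth_Rsp_def using cont_diff_compose[of m U n W g _ "\<lambda>x. f x _"] by simp

lemma smooth_Rsp_continuous: "smooth_Rsp n U g \<Longrightarrow> continuous_on U g"
  unfolding smooth_Rsp_def by (intro continuous_on_pt) (metis cont_diff_continuous)

lemma smooth_Rsp_id: "smooth_Rsp n U (\<lambda>x. x)"
  by (simp add: smooth_Rsp_def)

lemma smooth_Rsp_head: "smooth_Rsp n U g \<Longrightarrow> smooth_Rsp n U (\<lambda>x. pt_head d (g x))"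
  unfolding smooth_Rsp_def pt_head_def
proof (intro allI)
  fix j k assume "\<forall>j k. cont_diff k n U (\<lambda>x. g x j)"
  then show "cont_diff k n U (\<lambda>x. if j < d then g x j else 0)" by (cases "j < d") auto
qed

lemma smooth_Rsp_tail: "smooth_Rsp n U g \<Longrightarrow> smooth_Rsp n U (\<lambda>x. pt_tail d (g x))"
  by (auto simp: smooth_Rsp_def pt_tail_def)

lemma smooth_Rsp_join:
  "smooth_Rsp n U f \<Longrightarrow> smooth_Rsp n U g \<Longrightarrow> smooth_Rsp n U (\<lambda>x. pt_join d (f x) (g x))"
  unfolding smooth_Rsp_def pt_join_def
proof (intro allI)
  fix j k assume "\<forall>j k. cont_diff k n U (\<lambda>x. f x j)" "\<forall>j k. cont_diff k n U (\<lambda>x. g x j)"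
  then show "cont_diff k n U (\<lambda>x. if j < d then f x j else g x (j - d))" by (cases "j < d") auto
qed

lemma pt_head_Rsp: "pt_head d z \<in> Rsp d"
  by (auto simp: pt_head_def Rsp_def)

lemma pt_head_id: "z \<in> Rsp d \<Longrightarrow> pt_head d z = z"
  by (auto simp: pt_head_def Rsp_def)

lemma pt_tail_Rsp: "z \<in> Rsp n \<Longrightarrow> pt_tail d z \<in> Rsp (n - d)"
  by (auto simp: pt_tail_def Rsp_def)

lemma pt_join_Rsp: "s \<in> Rsp n \<Longrightarrow> pt_join d u s \<in> Rsp (d + n)"
  by (auto simp: pt_join_def Rsp_def)

lemma pt_head_join: "u \<in> Rsp d \<Longrightarrow> pt_head d (pt_join d u s) = u"
  by (auto simp: pt_head_def pt_join_def Rsp_def)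

lemma pt_tail_join [simp]: "pt_tail d (pt_join d u s) = s"
  by (auto simp: pt_tail_def pt_join_def)

lemma open_Rsp_smooth_preimage:
  assumes "open_Rsp n U" "smooth_Rsp n U g" "g \<in> U \<rightarrow> Rsp m" "open_Rsp m V"
  shows "open_Rsp n {x\<in>U. g x \<in> V}"
proof -
  obtain T where "open T" "V = Rsp m \<inter> T" using assms(4) by (auto simp: openin_open)
  then show ?thesis
    using open_Rsp_preimage[OF assms(1) smooth_Rsp_continuous[OF assms(2)], of T] assms(3)
    by (auto simp: Pi_iff cong: conj_cong)
qed

lemma open_inf_Rsp: "open_inf W \<Longrightarrow> open_Rsp n (W \<inter> Rsp n)"
  by (simp add: open_inf_def)

lemma open_inf_Int: "open_inf W \<Longrightarrow> open_inf W' \<Longrightarrow> open_inf (W \<inter> W')"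
  unfolding open_inf_def
proof (intro conjI allI)
  fix n assume "W \<subseteq> Rinf \<and> (\<forall>n. open_Rsp n (W \<inter> Rsp n))" "W' \<subseteq> Rinf \<and> (\<forall>n. open_Rsp n (W' \<inter> Rsp n))"
  then have "open_Rsp n ((W \<inter> Rsp n) \<inter> (W' \<inter> Rsp n))" by (intro openin_Int[of _ "W \<inter> Rsp n" "W' \<inter> Rsp n"]) blast+
  then show "open_Rsp n (W \<inter> W' \<inter> Rsp n)" by (simp add: Int_ac)
qed auto

text \<open>Typical instances of \<open>g\<close> change the number of coordinates, so each \<open>Rsp N\<close> is mapped to some
  \<open>Rsp (h N)\<close>.\<close>

lemma open_inf_vimage:
  assumes "open_inf W" "\<And>N. g \<in> Rsp N \<rightarrow> Rsp (h N)" "\<And>N. smooth_Rsp N (Rsp N) g"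
  shows "open_inf {x\<in>Rinf. g x \<in> W}"
  unfolding open_inf_def
proof (intro conjI allI)
  fix N
  have "{x\<in>Rinf. g x \<in> W} \<inter> Rsp N = {x\<in>Rsp N. g x \<in> W \<inter> Rsp (h N)}"
    using assms(2)[of N] Rsp_subset_Rinf by auto
  then show "open_Rsp N ({x\<in>Rinf. g x \<in> W} \<inter> Rsp N)"
    using open_Rsp_smooth_preimage[of N "Rsp N" g "h N" "W \<inter> Rsp (h N)"] assms open_inf_Rsp[OF assms(1)]
    by auto
qed auto

text \<open>A neighbourhood in the colimit topology that meets \<open>Rsp n\<close> in a given open set. It serves to
  extend domains of local data from \<open>Rsp n\<close> to \<open>Rinf\<close>.\<close>

lemma open_inf_cylinder:
  assumes "open_Rsp n G" shows "open_inf {x\<in>Rinf. pt_head n x \<in> G}"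
  unfolding open_inf_def
proof (intro conjI allI)
  fix N
  have "{x\<in>Rinf. pt_head n x \<in> G} \<inter> Rsp N = {x\<in>Rsp N. pt_head n x \<in> G}"
    using Rsp_subset_Rinf by auto
  then show "open_Rsp N ({x\<in>Rinf. pt_head n x \<in> G} \<inter> Rsp N)"
    using open_Rsp_smooth_preimage[of N "Rsp N" "pt_head n" n G] assms
      smooth_Rsp_head[OF smooth_Rsp_id] pt_head_Rsp by auto
qed auto

lemma smooth_subI:
  assumes "f \<in> A \<rightarrow> B"
    and "\<And>p. p \<in> A \<Longrightarrow> \<exists>W n m g. open_inf W \<and> p \<in> W \<and> A \<inter> W \<subseteq> Rsp n
        \<and> g \<in> W \<inter> Rsp n \<rightarrow> Rsp m \<and> smooth_Rsp n (W \<inter> Rsp n) g \<and> (\<forall>x\<in>A \<inter> W. f x = g x)"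
  shows "smooth_sub A B f"
  using assms unfolding smooth_sub_def smooth_Rsp_def by blast

lemma smooth_subE:
  assumes "smooth_sub A B f" "p \<in> A"
  obtains W n m g where "open_inf W" "p \<in> W" "A \<inter> W \<subseteq> Rsp n"
    "g \<in> W \<inter> Rsp n \<rightarrow> Rsp m" "smooth_Rsp n (W \<inter> Rsp n) g" "\<And>x. x \<in> A \<inter> W \<Longrightarrow> f x = g x"
proof -
  obtain W n m g where "open_inf W \<and> p \<in> W \<and> A \<inter> W \<subseteq> Rsp n \<and> g \<in> W \<inter> Rsp n \<rightarrow> Rsp m
      \<and> smooth_Rsp n (W \<inter> Rsp n) g \<and> (\<forall>x\<in>A \<inter> W. f x = g x)"
    using assms unfolding smooth_sub_def smooth_Rsp_def by blast
  then show thesis by (intro that[of W n g m]) auto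
qed

lemma smooth_sub_maps: "smooth_sub A B f \<Longrightarrow> x \<in> A \<Longrightarrow> f x \<in> B"
  by (auto simp: smooth_sub_def)

lemma smooth_sub_mono:
  "smooth_sub A B f \<Longrightarrow> A' \<subseteq> A \<Longrightarrow> f \<in> A' \<rightarrow> B' \<Longrightarrow> smooth_sub A' B' f"
  by (rule smooth_subI) (simp, elim smooth_subE, blast, blast)

lemma smooth_sub_cong:
  assumes "smooth_sub A B f" "\<And>x. x \<in> A \<Longrightarrow> f x = g x" shows "smooth_sub A B g"
proof (rule smooth_subI)
  show "g \<in> A \<rightarrow> B" using assms smooth_sub_maps by fastforce
  fix p assume "p \<in> A"
  with assms(1) obtain W n m h where "open_inf W" "p \<in> W" "A \<inter> W \<subseteq> Rsp n"
    "h \<in> W \<inter> Rsp n \<rightarrow> Rsp m" "smooth_Rsp n (W \<inter> Rsp n) h" "\<And>x. x \<in> A \<inter> W \<Longrightarrow> f x = h x"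
    by (rule smooth_subE) blast
  with assms(2) show "\<exists>W n m h. open_inf W \<and> p \<in> W \<and> A \<inter> W \<subseteq> Rsp n
        \<and> h \<in> W \<inter> Rsp n \<rightarrow> Rsp m \<and> smooth_Rsp n (W \<inter> Rsp n) h \<and> (\<forall>x\<in>A \<inter> W. g x = h x)"
    by (intro exI[of _ W] exI[of _ n] exI[of _ m] exI[of _ h]) auto
qed

lemma smooth_sub_id: "smooth_sub A B f \<Longrightarrow> smooth_sub A A (\<lambda>x. x)"
proof (rule smooth_subI)
  fix p assume "smooth_sub A B f" "p \<in> A"
  then obtain W n where "open_inf W" "p \<in> W" "A \<inter> W \<subseteq> Rsp n" by (rule smooth_subE) blast
  then show "\<exists>W n m g. open_inf W \<and> p \<in> W \<and> A \<inter> W \<subseteq> Rsp n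
        \<and> g \<in> W \<inter> Rsp n \<rightarrow> Rsp m \<and> smooth_Rsp n (W \<inter> Rsp n) g \<and> (\<forall>x\<in>A \<inter> W. x = g x)"
    by (intro exI[of _ W] exI[of _ n] exI[of _ "\<lambda>x. x"]) (auto simp: smooth_Rsp_id)
qed auto

text \<open>A local extension \<open>g\<close> of \<open>f\<close> may take values in more coordinates than the local extension
  \<open>g'\<close> of \<open>h\<close> accepts. The values of \<open>f\<close> itself lie in the domain of \<open>g'\<close>, so the surplus coordinates
  of \<open>g\<close> can be truncated without changing the composite on \<open>A\<close>.\<close>

lemma smooth_sub_compose:
  assumes f: "smooth_sub A B f" and h: "smooth_sub B C h"
  shows "smooth_sub A C (\<lambda>x. h (f x))"
proof (rule smooth_subI)
  show "(\<lambda>x. h (f x)) \<in> A \<rightarrow> C" using assms smooth_sub_maps by fastforce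
  fix p assume p: "p \<in> A"
  obtain W n m g where W: "open_inf W" "p \<in> W" "A \<inter> W \<subseteq> Rsp n"
    "g \<in> W \<inter> Rsp n \<rightarrow> Rsp m" "smooth_Rsp n (W \<inter> Rsp n) g" "\<And>x. x \<in> A \<inter> W \<Longrightarrow> f x = g x"
    by (rule smooth_subE[OF f p], rule that) assumption+
  have fp: "f p \<in> B" using f p by (rule smooth_sub_maps)
  obtain W' n' m' g' where W': "open_inf W'" "f p \<in> W'" "B \<inter> W' \<subseteq> Rsp n'"
    "g' \<in> W' \<inter> Rsp n' \<rightarrow> Rsp m'" "smooth_Rsp n' (W' \<inter> Rsp n') g'" "\<And>x. x \<in> B \<inter> W' \<Longrightarrow> h x = g' x"
    by (rule smooth_subE[OF h fp], rule that) assumption+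
  (* The domain of the composite extension. The condition on g x itself, before truncation, ensures
     that g' computes h at f x. *)
  define G where "G = {x \<in> {x \<in> W \<inter> Rsp n. g x \<in> W' \<inter> Rsp m}. pt_head n' (g x) \<in> W' \<inter> Rsp n'}"
  have G0: "open_Rsp n {x \<in> W \<inter> Rsp n. g x \<in> W' \<inter> Rsp m}"
    by (intro open_Rsp_smooth_preimage[of n _ g m]) (use W W' open_inf_Rsp in auto)
  have G: "open_Rsp n G" unfolding G_def
    by (rule open_Rsp_smooth_preimage[OF G0 _ _ open_inf_Rsp[OF W'(1)]])
      (use W pt_head_Rsp in \<open>auto intro!: smooth_Rsp_head intro: smooth_Rsp_mono\<close>)
  define V where "V = W \<inter> {x\<in>Rinf. pt_head n x \<in> G}"
  have V: "open_inf V" unfolding V_def by (intro open_inf_Int W open_inf_cylinder G)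
  have VG: "V \<inter> Rsp n \<subseteq> G" by (auto simp: V_def pt_head_id)
  have sm: "smooth_Rsp n G (\<lambda>x. g' (pt_head n' (g x)))"
  proof (rule smooth_Rsp_compose[OF G open_inf_Rsp[OF W'(1)] _ _ W'(5)])
    show "(\<lambda>x. pt_head n' (g x)) \<in> G \<rightarrow> W' \<inter> Rsp n'" unfolding G_def by blast
    have "G \<subseteq> W \<inter> Rsp n" unfolding G_def by blast
    then show "smooth_Rsp n G (\<lambda>x. pt_head n' (g x))"
      by (rule smooth_Rsp_head[OF smooth_Rsp_mono[OF W(5)]]) simp
  qed
  have pW: "p \<in> W \<inter> Rsp n" using p W(2,3) by blast
  have "f p = g p" using W(6) p W(2) by blast
  moreover have "f p \<in> Rsp n'" using W'(2,3) fp by blast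
  moreover have "g p \<in> Rsp m" using W(4) pW by blast
  ultimately have pG: "p \<in> G" using W'(2) pW pt_head_id[of "f p" n'] by (simp add: G_def)
  have hf: "h (f x) = g' (pt_head n' (g x))" if "x \<in> A \<inter> V" for x
  proof -
    from that have x: "x \<in> G" "x \<in> W" "x \<in> A" using W(3) VG by (auto simp: V_def)
    have fx: "f x = g x" using W(6) x by blast
    have "g x \<in> W'" using x(1) by (simp add: G_def)
    moreover have "f x \<in> B" by (rule smooth_sub_maps[OF f x(3)])
    ultimately have "f x \<in> B \<inter> W'" using fx by simp
    then have "h (f x) = g' (f x)" "f x \<in> Rsp n'" using W'(3,6) by blast+
    then show ?thesis using fx pt_head_id[of "f x" n'] by simp
  qed
  have pV: "p \<in> V"
    using pW pG Rsp_subset_Rinf pt_head_id[of p n] by (auto simp: V_def)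
  show "\<exists>W n m g. open_inf W \<and> p \<in> W \<and> A \<inter> W \<subseteq> Rsp n
        \<and> g \<in> W \<inter> Rsp n \<rightarrow> Rsp m \<and> smooth_Rsp n (W \<inter> Rsp n) g \<and> (\<forall>x\<in>A \<inter> W. h (f x) = g x)"
  proof (rule exI[of _ V], rule exI[of _ n], rule exI[of _ m'], rule exI[of _ "\<lambda>x. g' (pt_head n' (g x))"], intro conjI)
    show "A \<inter> V \<subseteq> Rsp n" using W(3) by (auto simp: V_def)
    have "pt_head n' (g x) \<in> W' \<inter> Rsp n'" if "x \<in> V \<inter> Rsp n" for x
      using VG that unfolding G_def by blast
    then show "(\<lambda>x. g' (pt_head n' (g x))) \<in> V \<inter> Rsp n \<rightarrow> Rsp m'" using W'(4) by blast
    show "smooth_Rsp n (V \<inter> Rsp n) (\<lambda>x. g' (pt_head n' (g x)))"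
      by (rule smooth_Rsp_mono[OF sm VG]) simp
  qed (use V pV hf in auto)
qed

lemma smooth_sub_continuous:
  assumes f: "smooth_sub A B f" and p: "p \<in> A" and V: "open_inf V" "f p \<in> V"
  obtains W where "open_inf W" "p \<in> W" "\<And>x. x \<in> A \<inter> W \<Longrightarrow> f x \<in> V"
proof -
  obtain W n m g where W: "open_inf W" "p \<in> W" "A \<inter> W \<subseteq> Rsp n"
    "g \<in> W \<inter> Rsp n \<rightarrow> Rsp m" "smooth_Rsp n (W \<inter> Rsp n) g" "\<And>x. x \<in> A \<inter> W \<Longrightarrow> f x = g x"
    by (rule smooth_subE[OF f p], rule that) assumption+
  define G where "G = {x \<in> W \<inter> Rsp n. g x \<in> V \<inter> Rsp m}"
  have "open_Rsp n G" unfolding G_def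
    by (intro open_Rsp_smooth_preimage[of n _ g m]) (use W V open_inf_Rsp in auto)
  then have "open_inf (W \<inter> {x\<in>Rinf. pt_head n x \<in> G})" by (intro open_inf_Int W open_inf_cylinder)
  moreover have "p \<in> W \<inter> {x\<in>Rinf. pt_head n x \<in> G}"
  proof -
    have "p \<in> W \<inter> Rsp n" "p \<in> A \<inter> W" using W(2,3) p by blast+
    then have "g p \<in> V \<inter> Rsp m" using W(4,6) V(2) by auto
    then show ?thesis using \<open>p \<in> W \<inter> Rsp n\<close> pt_head_id[of p n] Rsp_subset_Rinf
      by (auto simp: G_def)
  qed
  moreover have "f x \<in> V" if "x \<in> A \<inter> (W \<inter> {x\<in>Rinf. pt_head n x \<in> G})" for x
  proof -
    have "x \<in> Rsp n" "f x = g x" "pt_head n x \<in> G" using that W(3,6) by blast+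
    then show ?thesis using pt_head_id[of x n] by (simp add: G_def)
  qed
  ultimately show thesis by (rule that)
qed

lemma smooth_sub_openI:
  assumes U: "open_Rsp m U" and f: "f \<in> U \<rightarrow> B"
    and loc: "\<And>p. p \<in> U \<Longrightarrow> \<exists>U' n. open_Rsp m U' \<and> p \<in> U' \<and> U' \<subseteq> U \<and> f ` U' \<subseteq> Rsp n \<and> smooth_Rsp m U' f"
  shows "smooth_sub U B f"
proof (rule smooth_subI[OF f])
  fix p assume "p \<in> U"
  from loc[OF this] obtain U' n where
    U': "open_Rsp m U'" "p \<in> U'" "U' \<subseteq> U" "f ` U' \<subseteq> Rsp n" "smooth_Rsp m U' f"
    by (elim exE conjE)
  have "{x\<in>Rinf. pt_head m x \<in> U'} \<inter> Rsp m = U'"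
    using open_Rsp_subset[OF U'(1)] Rsp_subset_Rinf by (auto simp: pt_head_id)
  then show "\<exists>W n m' g. open_inf W \<and> p \<in> W \<and> U \<inter> W \<subseteq> Rsp n
        \<and> g \<in> W \<inter> Rsp n \<rightarrow> Rsp m' \<and> smooth_Rsp n (W \<inter> Rsp n) g \<and> (\<forall>x\<in>U \<inter> W. f x = g x)"
    using U' open_Rsp_subset[OF U]
    by (intro exI[of _ "{x\<in>Rinf. pt_head m x \<in> U'}"] exI[of _ m] exI[of _ n] exI[of _ f])
      (auto simp: open_inf_cylinder)
qed

text \<open>Invariance of dimension in the linear situation: a nonempty open set contains points with an
  arbitrary small change of each coordinate.\<close>

lemma open_Rsp_dim_le:
  assumes "open_Rsp d U" "p \<in> U" "U \<subseteq> Rsp n" shows "d \<le> n"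
proof (rule ccontr)
  assume "\<not> d \<le> n"
  then have n: "n < d" by simp
  obtain e where e: "e > 0" "\<And>y. y \<in> Rsp d \<Longrightarrow> (\<And>i. i < d \<Longrightarrow> \<bar>y i - p i\<bar> < e) \<Longrightarrow> y \<in> U"
    using open_Rsp_box[OF assms(1,2)] by blast
  have "p(n := p n + e / 2) \<in> U"
    using e(1) n assms open_Rsp_subset by (intro e(2) Rsp_upd) (auto simp: less_imp_le)
  then have "p(n := p n + e / 2) \<in> Rsp n" "p \<in> Rsp n" using assms by blast+
  then have "(p(n := p n + e / 2)) n = 0" "p n = 0" unfolding Rsp_def by blast+
  then show False using e by simp
qed

text \<open>On an open subset of \<open>Rsp m\<close>, the local extension agrees with the map itself, up to coordinates beyond
  \<open>m\<close> in its domain that are constantly zero. So the map has continuous partial derivatives.\<close>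

lemma smooth_sub_openE:
  assumes U: "open_Rsp m U" and f: "smooth_sub U B f" and p: "p \<in> U"
  obtains U' n where "open_Rsp m U'" "p \<in> U'" "U' \<subseteq> U" "f ` U' \<subseteq> Rsp n" "smooth_Rsp m U' f"
proof -
  obtain W n k g where W: "open_inf W" "p \<in> W" "U \<inter> W \<subseteq> Rsp n"
    "g \<in> W \<inter> Rsp n \<rightarrow> Rsp k" "smooth_Rsp n (W \<inter> Rsp n) g" "\<And>x. x \<in> U \<inter> W \<Longrightarrow> f x = g x"
    by (rule smooth_subE[OF f p], rule that) assumption+
  have "U \<inter> W = U \<inter> (W \<inter> Rsp m)" using open_Rsp_subset[OF U] by blast
  then have UW: "open_Rsp m (U \<inter> W)" using openin_Int[OF U open_inf_Rsp[OF W(1)]] by simp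
  then have "m \<le> n" using W(2,3) p by (intro open_Rsp_dim_le) auto
  then have "smooth_Rsp m (U \<inter> W) g" by (intro smooth_Rsp_mono[OF W(5)]) (use W(3) in auto)
  then have "smooth_Rsp m (U \<inter> W) f" by (rule smooth_Rsp_cong[OF UW, rotated]) (simp add: W(6))
  then show thesis using UW p W by (intro that[of "U \<inter> W" k]) auto
qed

lemma smooth_sub_open_preimage:
  assumes U: "open_Rsp m U" and f: "smooth_sub U B f" and B: "B \<subseteq> Rsp d" and V: "open_Rsp d V"
  shows "open_Rsp m {x\<in>U. f x \<in> V}"
proof (subst openin_subopen, intro ballI)
  fix p assume p: "p \<in> {x\<in>U. f x \<in> V}"
  then have "p \<in> U" by simp
  obtain U' n where U': "open_Rsp m U'" "p \<in> U'" "U' \<subseteq> U" "smooth_Rsp m U' f"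
    by (rule smooth_sub_openE[OF U f \<open>p \<in> U\<close>], rule that) assumption+
  have "open_Rsp m {x\<in>U'. f x \<in> V}"
    by (rule open_Rsp_smooth_preimage[OF U'(1,4) _ V]) (use U'(3) B smooth_sub_maps[OF f] in blast)
  then show "\<exists>T. open_Rsp m T \<and> p \<in> T \<and> T \<subseteq> {x \<in> U. f x \<in> V}" using p U' by blast
qed

lemma smooth_sub_join:
  assumes U: "open_Rsp m U" and f: "smooth_sub U A f" and A: "A \<subseteq> Rsp d" and g: "smooth_sub U c g"
    and B: "\<And>x. x \<in> U \<Longrightarrow> pt_join d (f x) (g x) \<in> B"
  shows "smooth_sub U B (\<lambda>x. pt_join d (f x) (g x))"
proof (rule smooth_sub_openI[OF U])
  fix p assume p: "p \<in> U"
  obtain U1 where U1: "open_Rsp m U1" "p \<in> U1" "U1 \<subseteq> U" "smooth_Rsp m U1 f"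
    by (rule smooth_sub_openE[OF U f p], rule that) assumption+
  obtain U2 n where U2: "open_Rsp m U2" "p \<in> U2" "U2 \<subseteq> U" "g ` U2 \<subseteq> Rsp n" "smooth_Rsp m U2 g"
    by (rule smooth_sub_openE[OF U g p], rule that) assumption+
  show "\<exists>U' n. open_Rsp m U' \<and> p \<in> U' \<and> U' \<subseteq> U \<and> (\<lambda>x. pt_join d (f x) (g x)) ` U' \<subseteq> Rsp n
      \<and> smooth_Rsp m U' (\<lambda>x. pt_join d (f x) (g x))"
    using U1 U2
    by (intro exI[of _ "U1 \<inter> U2"] exI[of _ "d + n"])
      (auto intro!: pt_join_Rsp smooth_Rsp_join openin_Int intro: smooth_Rsp_mono)
qed (use B in auto)

text \<open>The product of an identity with a smooth map is smooth, in the encoding of pairs by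
  prepending coordinates.\<close>

lemma smooth_sub_join_map:
  assumes X: "X \<subseteq> Rsp d" and f: "smooth_sub c B f"
  shows "smooth_sub {pt_join d u t | u t. u \<in> X \<and> t \<in> c} {pt_join d u s | u s. u \<in> X \<and> s \<in> B}
     (\<lambda>z. pt_join d (pt_head d z) (f (pt_tail d z)))"
proof (rule smooth_subI)
  show "(\<lambda>z. pt_join d (pt_head d z) (f (pt_tail d z))) \<in> {pt_join d u t | u t. u \<in> X \<and> t \<in> c}
      \<rightarrow> {pt_join d u s | u s. u \<in> X \<and> s \<in> B}"
    using X smooth_sub_maps[OF f] by (fastforce simp: pt_head_join)
  fix p assume "p \<in> {pt_join d u t | u t. u \<in> X \<and> t \<in> c}"
  then obtain u t where p: "p = pt_join d u t" "u \<in> X" "t \<in> c" by blast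
  obtain W n m g where W: "open_inf W" "t \<in> W" "c \<inter> W \<subseteq> Rsp n"
    "g \<in> W \<inter> Rsp n \<rightarrow> Rsp m" "smooth_Rsp n (W \<inter> Rsp n) g" "\<And>x. x \<in> c \<inter> W \<Longrightarrow> f x = g x"
    by (rule smooth_subE[OF f p(3)], rule that) assumption+
  let ?V = "{z\<in>Rinf. pt_tail d z \<in> W}" and ?g = "\<lambda>z. pt_join d (pt_head d z) (g (pt_tail d z))"
  have V: "open_inf ?V"
    by (rule open_inf_vimage[OF W(1), of _ "\<lambda>N. N - d"]) (use pt_tail_Rsp in \<open>auto intro: smooth_Rsp_tail smooth_Rsp_id\<close>)
  have tail: "pt_tail d \<in> ?V \<inter> Rsp (d + n) \<rightarrow> W \<inter> Rsp n"
    using pt_tail_Rsp[of _ "d + n" d] by auto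
  have "smooth_Rsp (d + n) (?V \<inter> Rsp (d + n)) (\<lambda>z. g (pt_tail d z))"
    by (rule smooth_Rsp_compose[OF open_inf_Rsp[OF V] open_inf_Rsp[OF W(1)] tail _ W(5)])
      (intro smooth_Rsp_tail smooth_Rsp_id)
  then have "smooth_Rsp (d + n) (?V \<inter> Rsp (d + n)) ?g"
    by (intro smooth_Rsp_join smooth_Rsp_head smooth_Rsp_id)
  moreover have "?g \<in> ?V \<inter> Rsp (d + n) \<rightarrow> Rsp (d + m)" using tail W(4) by (fastforce intro!: pt_join_Rsp)
  moreover have "p \<in> ?V" using p W pt_join_Rsp[of t n d u] Rsp_subset_Rinf[of "d + n"] by auto
  ultimately show "\<exists>V n m g. open_inf V \<and> p \<in> V \<and> {pt_join d u t | u t. u \<in> X \<and> t \<in> c} \<inter> V \<subseteq> Rsp n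
        \<and> g \<in> V \<inter> Rsp n \<rightarrow> Rsp m \<and> smooth_Rsp n (V \<inter> Rsp n) g
        \<and> (\<forall>z\<in>{pt_join d u t | u t. u \<in> X \<and> t \<in> c} \<inter> V. pt_join d (pt_head d z) (f (pt_tail d z)) = g z)"
    using V W by (intro exI[of _ ?V] exI[of _ "d + n"] exI[of _ "d + m"] exI[of _ ?g])
      (auto intro!: pt_join_Rsp)
qed

lemma Cart_Ob_subset: "c \<in> Ob Cart \<Longrightarrow> c \<subseteq> Rinf"
  by (simp add: Cart_def)

lemma Cart_ObE:
  assumes "c \<in> Ob Cart"
  obtains n f where "diffeo_sub (Rsp n) c f"
  using assms by (auto simp: Cart_def)

lemma Cart_Ar_iff: "f \<in> Ar Cart a b \<longleftrightarrow> f \<in> a \<rightarrow>\<^sub>E b \<and> smooth_sub a b f"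
  by (simp add: Cart_def)

lemma Cart_Ide: assumes "c \<in> Ob Cart" shows "Ide Cart c \<in> Ar Cart c c"
proof -
  obtain n f where "diffeo_sub (Rsp n) c f" using assms by (rule Cart_ObE)
  then have "smooth_sub c c (\<lambda>x. x)" unfolding diffeo_sub_def using smooth_sub_id by blast
  then have "smooth_sub c c (\<lambda>x\<in>c. x)" by (rule smooth_sub_cong) simp
  then show ?thesis by (simp add: Cart_def)
qed

lemma Cart_Cmp:
  assumes "f \<in> Ar Cart a b" "g \<in> Ar Cart b c" shows "Cmp Cart a b c g f \<in> Ar Cart a c"
proof -
  have "smooth_sub a c (\<lambda>x. g (f x))" using assms by (auto simp: Cart_Ar_iff intro: smooth_sub_compose)
  then have "smooth_sub a c (compose a g f)" by (rule smooth_sub_cong) (simp add: compose_def)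
  then show ?thesis using assms by (auto simp: Cart_def compose_def smooth_sub_def)
qed

section \<open>Plots of oriented manifolds\<close>

lemma smooth_sub_open_preimage_inf:
  assumes U: "open_Rsp m U" and f: "smooth_sub U B f" and W: "open_inf W"
  shows "open_Rsp m {x\<in>U. f x \<in> W}"
proof (subst openin_subopen, intro ballI)
  fix p assume p: "p \<in> {x\<in>U. f x \<in> W}"
  then have "p \<in> U" by simp
  obtain U' n where U': "open_Rsp m U'" "p \<in> U'" "U' \<subseteq> U" "f ` U' \<subseteq> Rsp n" "smooth_Rsp m U' f"
    by (rule smooth_sub_openE[OF U f \<open>p \<in> U\<close>], rule that) assumption+
  have "open_Rsp m {x\<in>U'. f x \<in> W \<inter> Rsp n}"
    by (rule open_Rsp_smooth_preimage[OF U'(1,5) _ open_inf_Rsp[OF W]]) (use U'(4) in auto)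
  moreover have "p \<in> {x\<in>U'. f x \<in> W \<inter> Rsp n}" "{x\<in>U'. f x \<in> W \<inter> Rsp n} \<subseteq> {x\<in>U. f x \<in> W}"
    using p U' by auto
  ultimately show "\<exists>T. open_Rsp m T \<and> p \<in> T \<and> T \<subseteq> {x \<in> U. f x \<in> W}" by blast
qed

lemma smooth_sub_Rsp:
  assumes "open_Rsp m U" "f ` U \<subseteq> B" "f ` U \<subseteq> Rsp n" "smooth_Rsp m U f"
  shows "smooth_sub U B f"
proof (rule smooth_sub_openI[OF assms(1)])
  fix p assume "p \<in> U"
  then show "\<exists>U' n. open_Rsp m U' \<and> p \<in> U' \<and> U' \<subseteq> U \<and> f ` U' \<subseteq> Rsp n \<and> smooth_Rsp m U' f"
    using assms by (intro exI[of _ U] exI[of _ n]) simp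
qed (use assms(2) in auto)

lemma smooth_sub_open_id:
  assumes "open_Rsp m U" "U \<subseteq> B" shows "smooth_sub U B (\<lambda>x. x)"
  by (rule smooth_sub_Rsp[OF assms(1) _ _ smooth_Rsp_id, of _ m]) (use assms open_Rsp_subset in auto)

lemma smooth_sub_open_const:
  assumes "open_Rsp m U" "s \<in> c" "c \<subseteq> Rinf" shows "smooth_sub U c (\<lambda>_. s)"
proof -
  obtain n where "s \<in> Rsp n" using assms by (auto simp: Rinf_def)
  then show ?thesis
    by (intro smooth_sub_Rsp[OF assms(1), of _ _ n]) (use assms(2) in \<open>auto simp: smooth_Rsp_def\<close>)
qed

lemma open_Rsp_join_nhd:
  assumes U: "open_Rsp (d + n) U" and j: "pt_join d u0 r0 \<in> U" and u0: "u0 \<in> Rsp d" and r0: "r0 \<in> Rsp n"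
  obtains G R where "open_Rsp d G" "u0 \<in> G" "open_Rsp n R" "r0 \<in> R"
    "\<And>u r. u \<in> G \<Longrightarrow> r \<in> R \<Longrightarrow> pt_join d u r \<in> U"
proof -
  obtain e where e: "e > 0"
    "\<And>y. y \<in> Rsp (d + n) \<Longrightarrow> (\<And>i. i < d + n \<Longrightarrow> \<bar>y i - pt_join d u0 r0 i\<bar> < e) \<Longrightarrow> y \<in> U"
    using open_Rsp_box[OF U j] by blast
  have box: "open_Rsp k {y\<in>Rsp k. \<forall>i<k. \<bar>y i - x i\<bar> < e}" for k and x :: pt
    unfolding open_Rsp_iff[of k "{y\<in>Rsp k. \<forall>i<k. \<bar>y i - x i\<bar> < e}"]
  proof (intro conjI ballI)
    fix y assume y: "y \<in> {y\<in>Rsp k. \<forall>i<k. \<bar>y i - x i\<bar> < e}"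
    define \<delta> where "\<delta> = Min (insert 1 ((\<lambda>i. e - \<bar>y i - x i\<bar>) ` {..<k}))"
    have \<delta>: "\<delta> > 0" "\<And>i. i < k \<Longrightarrow> \<delta> \<le> e - \<bar>y i - x i\<bar>" using y unfolding \<delta>_def by (auto intro: Min_le)
    have "\<bar>z i - x i\<bar> < e" if "\<bar>z i - y i\<bar> < \<delta>" "i < k" for z i
      using that \<delta>(2)[of i] by linarith
    then show "\<exists>\<delta>>0. \<forall>z\<in>Rsp k. (\<forall>i<k. \<bar>z i - y i\<bar> < \<delta>) \<longrightarrow> z \<in> {y\<in>Rsp k. \<forall>i<k. \<bar>y i - x i\<bar> < e}"
      using \<delta>(1) by (intro exI[of _ \<delta>]) auto
  qed auto
  show thesis
  proof (rule that[OF box[of d u0] _ box[of n r0]])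
    fix u r assume u: "u \<in> {y\<in>Rsp d. \<forall>i<d. \<bar>y i - u0 i\<bar> < e}" and r: "r \<in> {y\<in>Rsp n. \<forall>i<n. \<bar>y i - r0 i\<bar> < e}"
    show "pt_join d u r \<in> U"
    proof (rule e(2))
      show "pt_join d u r \<in> Rsp (d + n)" using r by (auto intro: pt_join_Rsp)
      fix i assume "i < d + n"
      then show "\<bar>pt_join d u r i - pt_join d u0 r0 i\<bar> < e" using u r by (auto simp: pt_join_def)
    qed
  qed (use u0 r0 e in auto)
qed

lemma jacobian_cong:
  assumes U: "open_Rsp d U" "u \<in> U" and eq: "\<And>x. x \<in> U \<Longrightarrow> f x = g x"
  shows "jacobian d f u = jacobian d g u"
proof -
  have "deriv (\<lambda>t. f (u(j := t)) i) (u j) = deriv (\<lambda>t. g (u(j := t)) i) (u j)" if "j < d" for i j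
    by (rule deriv_cong_ev[OF _ refl]) (use eventually_line[OF U that] in \<open>eventually_elim, simp add: eq\<close>)
  then show ?thesis unfolding jacobian_def by (intro arg_cong[of _ _ Determinant.det] cong_mat) auto
qed

lemma jacobian_id: "jacobian d (\<lambda>x. x) u = 1"
proof -
  have "deriv (\<lambda>t. (u(j := t)) i) (u j) = (if i = j then 1 else 0)" for i j
    by (rule DERIV_imp_deriv) (auto intro!: derivative_eq_intros)
  then have "Matrix.mat d d (\<lambda>(i, j). deriv (\<lambda>t. (u(j := t)) i) (u j)) = 1\<^sub>m d"
    by (intro eq_matI) auto
  then show ?thesis by (simp add: jacobian_def)
qed

text \<open>The matrix of partial derivatives of a composite is the product of the two matrices, and
  determinants are multiplicative.\<close>

lemma jacobian_compose:
  assumes U: "open_Rsp d U" "u \<in> U" and f: "smooth_sub U W f"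
    and W: "open_Rsp d W" and g: "smooth_sub W B g"
  shows "jacobian d (\<lambda>x. g (f x)) u = jacobian d g (f u) * jacobian d f u"
proof -
  have fu: "f u \<in> W" by (rule smooth_sub_maps[OF f U(2)])
  obtain U1 where U1: "open_Rsp d U1" "u \<in> U1" "U1 \<subseteq> U" "smooth_Rsp d U1 f"
    by (rule smooth_sub_openE[OF U(1) f U(2)], rule that) assumption+
  obtain W1 where W1: "open_Rsp d W1" "f u \<in> W1" "W1 \<subseteq> W" "smooth_Rsp d W1 g"
    by (rule smooth_sub_openE[OF W g fu], rule that) assumption+
  define U2 where "U2 = {x\<in>U1. f x \<in> W1}"
  have U2: "open_Rsp d U2" unfolding U2_def
    by (rule open_Rsp_smooth_preimage[OF U1(1,4) _ W1(1)])
      (use U1(3) smooth_sub_maps[OF f] open_Rsp_subset[OF W] in blast)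
  have uU2: "u \<in> U2" using U1 W1 by (simp add: U2_def)
  have fUW: "f \<in> U2 \<rightarrow> W1" by (auto simp: U2_def)
  have fder: "((\<lambda>t. f (u(j := t)) k) has_real_derivative deriv (\<lambda>t. f (u(j := t)) k) (u j)) (at (u j))"
    if "j < d" for j k
  proof -
    have cd: "cont_diff (Suc 0) d U1 (\<lambda>x. f x k)" using U1(4) by (simp add: smooth_Rsp_def)
    obtain h where h: "\<And>j x. j < d \<Longrightarrow> x \<in> U1 \<Longrightarrow> ((\<lambda>t. f (x(j := t)) k) has_real_derivative h j x) (at (x j))"
      by (rule cont_diff_partials[OF cd], rule that) assumption+
    have "((\<lambda>t. f (u(j := t)) k) has_real_derivative h j u) (at (u j))" by (rule h[OF that U1(2)])
    then show ?thesis using DERIV_imp_deriv by fastforce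
  qed
  have "deriv (\<lambda>t. g (f (u(j := t))) i) (u j)
      = (\<Sum>k<d. deriv (\<lambda>t. g ((f u)(k := t)) i) (f u k) * deriv (\<lambda>t. f (u(j := t)) k) (u j))"
    if j: "j < d" for i j
  proof -
    have cd: "cont_diff (Suc 0) d W1 (\<lambda>x. g x i)" using W1(4) by (simp add: smooth_Rsp_def)
    obtain D where D: "\<And>k z. k < d \<Longrightarrow> z \<in> W1 \<Longrightarrow> ((\<lambda>t. g (z(k := t)) i) has_real_derivative D k z) (at (z k))"
      "\<And>k. k < d \<Longrightarrow> cont_diff 0 d W1 (D k)"
      by (rule cont_diff_partials[OF cd], rule that) assumption+
    have "((\<lambda>t. g (f (u(j := t))) i) has_real_derivative
        (\<Sum>k<d. D k (f u) * deriv (\<lambda>t. f (u(j := t)) k) (u j))) (at (u j))"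
      by (rule partial_compose[OF U2 W1(1) fUW uU2 j D(1) _ fder[OF j]]) (use D(2) in auto)
    moreover have "D k (f u) = deriv (\<lambda>t. g ((f u)(k := t)) i) (f u k)" if "k < d" for k
      using DERIV_imp_deriv[OF D(1)[OF that W1(2)]] by simp
    ultimately show ?thesis by (simp add: DERIV_imp_deriv)
  qed
  then have "Matrix.mat d d (\<lambda>(i, j). deriv (\<lambda>t. g (f (u(j := t))) i) (u j))
    = Matrix.mat d d (\<lambda>(i, j). deriv (\<lambda>t. g ((f u)(j := t)) i) (f u j))
      * Matrix.mat d d (\<lambda>(i, j). deriv (\<lambda>t. f (u(j := t)) i) (u j))"
    by (intro eq_matI) (auto simp: scalar_prod_def atLeast0LessThan)
  then show ?thesis unfolding jacobian_def by (simp add: det_mult[of _ d])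
qed

lemma chart_facts:
  assumes "oriented_manifold M" "(V, x, \<epsilon>) \<in> charts M"
  shows "inj_on x V" "open_Rsp (mdim M) (x ` V)" "\<epsilon> = 1 \<or> \<epsilon> = -1" "V \<subseteq> points M"
    "x ` V \<subseteq> Rsp (mdim M)"
proof -
  show "inj_on x V" "\<epsilon> = 1 \<or> \<epsilon> = -1" and o: "open_Rsp (mdim M) (x ` V)"
    using assms unfolding oriented_manifold_def ochart_def by fastforce+
  show "V \<subseteq> points M" using assms(2) by (force simp: points_def)
  show "x ` V \<subseteq> Rsp (mdim M)" by (rule open_Rsp_subset[OF o])
qed

lemma chart_at:
  assumes "p \<in> points M" obtains V x \<epsilon> where "(V, x, \<epsilon>) \<in> charts M" "p \<in> V"
  using assms by (auto simp: points_def)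

lemma transition:
  assumes "oriented_manifold M" "(V, x, \<epsilon>) \<in> charts M" "(V', x', \<epsilon>') \<in> charts M"
  shows "open_Rsp (mdim M) (x ` (V \<inter> V'))" "open_Rsp (mdim M) (x' ` (V \<inter> V'))"
    "diffeo_sub (x ` (V \<inter> V')) (x' ` (V \<inter> V')) (x' \<circ> inv_into V x)"
    "smooth_sub (x ` (V \<inter> V')) (x' ` (V \<inter> V')) (\<lambda>u. x' (inv_into V x u))"
    "\<And>p. p \<in> V \<inter> V' \<Longrightarrow> sgn (jacobian (mdim M) (x' \<circ> inv_into V x) (x p)) = \<epsilon> * \<epsilon>'"
proof -
  have "compatible (mdim M) (V, x, \<epsilon>) (V', x', \<epsilon>')" using assms unfolding oriented_manifold_def by blast
  then show "open_Rsp (mdim M) (x ` (V \<inter> V'))" "open_Rsp (mdim M) (x' ` (V \<inter> V'))"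
    "diffeo_sub (x ` (V \<inter> V')) (x' ` (V \<inter> V')) (x' \<circ> inv_into V x)"
    "\<And>p. p \<in> V \<inter> V' \<Longrightarrow> sgn (jacobian (mdim M) (x' \<circ> inv_into V x) (x p)) = \<epsilon> * \<epsilon>'"
    unfolding compatible_def by auto
  then show "smooth_sub (x ` (V \<inter> V')) (x' ` (V \<inter> V')) (\<lambda>u. x' (inv_into V x u))"
    by (simp add: diffeo_sub_def comp_def)
qed

text \<open>An atlas that is maximal contains the restrictions of its charts to open subsets. These
  are needed because smoothness of maps and families asks for charts that are mapped into charts.\<close>

lemma chart_restrict:
  assumes M: "oriented_manifold M" and \<kappa>: "(V, x, \<epsilon>) \<in> charts M" and G: "open_Rsp (mdim M) G"
  shows "({p\<in>V. x p \<in> G}, x, \<epsilon>) \<in> charts M"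
proof -
  let ?V = "{p\<in>V. x p \<in> G}" and ?d = "mdim M"
  note c = chart_facts[OF M \<kappa>]
  have inv: "inv_into ?V x (x p) = p" "inv_into V x (x p) = p" if "p \<in> ?V" for p
    using that c(1) inj_on_subset[OF c(1), of ?V] by (auto simp: inv_into_f_f)
  have "x ` ?V = x ` V \<inter> G" by auto
  then have "open_Rsp ?d (x ` ?V)" using openin_Int[OF c(2) G] by simp
  then have "ochart ?d (?V, x, \<epsilon>)" using c inj_on_subset[OF c(1), of ?V] by (auto simp: ochart_def)
  moreover have "compatible ?d (?V, x, \<epsilon>) \<mu>" if \<mu>: "\<mu> \<in> charts M" for \<mu>
  proof -
    obtain V' x' \<epsilon>' where \<mu>': "\<mu> = (V', x', \<epsilon>')" by (cases \<mu>) auto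
    note \<mu> = \<mu>[unfolded \<mu>']
    note c' = chart_facts[OF M \<mu>]
    note t = transition[OF M \<kappa> \<mu>] and t' = transition[OF M \<mu> \<kappa>]
    have inv': "inv_into V' x' (x' p) = p" if "p \<in> V'" for p using that c'(1) by (simp add: inv_into_f_f)
    have "x ` (?V \<inter> V') = x ` (V \<inter> V') \<inter> G" by auto
    then have o1: "open_Rsp ?d (x ` (?V \<inter> V'))" using openin_Int[OF t(1) G] by simp
    have "open_Rsp ?d {w \<in> x' ` (V' \<inter> V). x (inv_into V' x' w) \<in> G}"
      by (rule smooth_sub_open_preimage[OF t'(1,4) open_Rsp_subset[OF t'(2)] G])
    moreover have "{w \<in> x' ` (V' \<inter> V). x (inv_into V' x' w) \<in> G} = x' ` (?V \<inter> V')"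
      by (auto simp: inv')
    ultimately have o2: "open_Rsp ?d (x' ` (?V \<inter> V'))" by simp
    have fwd: "smooth_sub (x ` (?V \<inter> V')) (x' ` (?V \<inter> V')) (\<lambda>u. x' (inv_into V x u))"
      by (rule smooth_sub_mono[OF t(4)]) (auto simp: inv)
    then have s1: "smooth_sub (x ` (?V \<inter> V')) (x' ` (?V \<inter> V')) (x' \<circ> inv_into ?V x)"
      by (rule smooth_sub_cong) (auto simp: inv)
    have b: "bij_betw (x' \<circ> inv_into ?V x) (x ` (?V \<inter> V')) (x' ` (?V \<inter> V'))"
      using c'(1) by (intro bij_betw_imageI inj_onI) (auto simp: inv image_iff dest!: inj_onD)
    have "inv_into (x ` (?V \<inter> V')) (x' \<circ> inv_into ?V x) (x' p) = x p" if "p \<in> ?V \<inter> V'" for p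
      using that inv bij_betw_imp_inj_on[OF b] by (intro inv_into_f_eq) auto
    moreover have "smooth_sub (x' ` (?V \<inter> V')) (x ` (?V \<inter> V')) (\<lambda>w. x (inv_into V' x' w))"
      by (rule smooth_sub_mono[OF t'(4)]) (auto simp: inv')
    ultimately have s2: "smooth_sub (x' ` (?V \<inter> V')) (x ` (?V \<inter> V'))
        (inv_into (x ` (?V \<inter> V')) (x' \<circ> inv_into ?V x))"
      by (elim smooth_sub_cong) (auto simp: inv')
    have "sgn (jacobian ?d (x' \<circ> inv_into ?V x) (x p)) = \<epsilon> * \<epsilon>'" if p: "p \<in> ?V \<inter> V'" for p
    proof -
      have "jacobian ?d (x' \<circ> inv_into ?V x) (x p) = jacobian ?d (x' \<circ> inv_into V x) (x p)"
        by (rule jacobian_cong[OF o1]) (use p in \<open>auto simp: inv\<close>)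
      then show ?thesis using t(5)[of p] p by simp
    qed
    then show ?thesis unfolding \<mu>' compatible_def diffeo_sub_def using o1 o2 b s1 s2 by simp
  qed
  moreover have "fst (?V, x, \<epsilon>) \<subseteq> points M" using c by auto
  ultimately show ?thesis using M unfolding oriented_manifold_def by blast
qed

text \<open>A plot of \<open>M\<close> is a smooth map from an open subset \<open>U\<close> of \<open>Rsp m\<close>. The condition is imposed on
  all charts, so that it can be used with any chart at hand; by \<open>plotI\<close> one chart at each point suffices.\<close>

definition plot :: "'p omfd \<Rightarrow> nat \<Rightarrow> pt set \<Rightarrow> (pt \<Rightarrow> 'p) \<Rightarrow> bool" where
  "plot M m U \<beta> \<longleftrightarrow> \<beta> \<in> U \<rightarrow> points M \<and>
     (\<forall>u\<in>U. \<forall>V x \<epsilon>. (V, x, \<epsilon>) \<in> charts M \<longrightarrow> \<beta> u \<in> V \<longrightarrow>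
        (\<exists>U'. open_Rsp m U' \<and> u \<in> U' \<and> U' \<subseteq> U \<and> \<beta> ` U' \<subseteq> V \<and> smooth_sub U' (x ` V) (\<lambda>u. x (\<beta> u))))"

lemma plot_points: "plot M m U \<beta> \<Longrightarrow> u \<in> U \<Longrightarrow> \<beta> u \<in> points M"
  by (auto simp: plot_def)

lemma plotE:
  assumes "plot M m U \<beta>" "u \<in> U" "(V, x, \<epsilon>) \<in> charts M" "\<beta> u \<in> V"
  obtains U' where "open_Rsp m U'" "u \<in> U'" "U' \<subseteq> U" "\<And>w. w \<in> U' \<Longrightarrow> \<beta> w \<in> V"
    "smooth_sub U' (x ` V) (\<lambda>u. x (\<beta> u))"
proof -
  have "\<exists>U'. open_Rsp m U' \<and> u \<in> U' \<and> U' \<subseteq> U \<and> \<beta> ` U' \<subseteq> V \<and> smooth_sub U' (x ` V) (\<lambda>u. x (\<beta> u))"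
    using assms unfolding plot_def by blast
  then obtain U' where U': "open_Rsp m U'" "u \<in> U'" "U' \<subseteq> U" "\<beta> ` U' \<subseteq> V"
    "smooth_sub U' (x ` V) (\<lambda>u. x (\<beta> u))" by (elim exE conjE)
  show thesis by (rule that[OF U'(1-3) _ U'(5)]) (use U'(4) in blast)
qed

lemma smooth_sub_restrict: "smooth_sub A B f \<Longrightarrow> A' \<subseteq> A \<Longrightarrow> smooth_sub A' B f"
  by (rule smooth_sub_mono) (auto dest: smooth_sub_maps)

text \<open>The transition map to any other chart is smooth, by compatibility.\<close>

lemma plotI:
  assumes M: "oriented_manifold M"
    and loc: "\<And>u. u \<in> U \<Longrightarrow> \<exists>V x \<epsilon> U'. (V, x, \<epsilon>) \<in> charts M \<and> open_Rsp m U' \<and> u \<in> U' \<and> U' \<subseteq> U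
        \<and> \<beta> ` U' \<subseteq> V \<and> smooth_sub U' (x ` V) (\<lambda>u. x (\<beta> u))"
  shows "plot M m U \<beta>"
  unfolding plot_def
proof (intro conjI ballI allI impI)
  show "\<beta> \<in> U \<rightarrow> points M"
  proof
    fix u assume "u \<in> U"
    from loc[OF this] obtain V x \<epsilon> U' where "(V, x, \<epsilon>) \<in> charts M" "u \<in> U'" "\<beta> ` U' \<subseteq> V" by blast
    then show "\<beta> u \<in> points M" using chart_facts(4)[OF M] by blast
  qed
  fix u V2 x2 \<epsilon>2 assume u: "u \<in> U" and k2: "(V2, x2, \<epsilon>2) \<in> charts M" and V2: "\<beta> u \<in> V2"
  from loc[OF u] obtain V x \<epsilon> U' where k: "(V, x, \<epsilon>) \<in> charts M" and U': "open_Rsp m U'" "u \<in> U'" "U' \<subseteq> U"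
    "\<beta> ` U' \<subseteq> V" "smooth_sub U' (x ` V) (\<lambda>u. x (\<beta> u))" by blast
  note c = chart_facts[OF M k] and t = transition[OF M k k2]
  define U2 where "U2 = {w\<in>U'. x (\<beta> w) \<in> x ` (V \<inter> V2)}"
  have U2: "open_Rsp m U2" unfolding U2_def
    by (rule smooth_sub_open_preimage[OF U'(1,5) c(5) t(1)])
  have \<beta>: "\<beta> w \<in> V \<inter> V2" if "w \<in> U2" for w
    using that U'(4) c(1) by (auto simp: U2_def dest: inj_onD)
  have "smooth_sub U2 (x ` (V \<inter> V2)) (\<lambda>u. x (\<beta> u))"
    by (rule smooth_sub_mono[OF U'(5)]) (auto simp: U2_def)
  from smooth_sub_compose[OF this t(4)]
  have "smooth_sub U2 (x2 ` (V \<inter> V2)) (\<lambda>u. x2 (inv_into V x (x (\<beta> u))))" .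
  then have "smooth_sub U2 (x2 ` (V \<inter> V2)) (\<lambda>u. x2 (\<beta> u))"
    by (rule smooth_sub_cong) (use \<beta> c(1) in \<open>simp add: inv_into_f_f\<close>)
  then have "smooth_sub U2 (x2 ` V2) (\<lambda>u. x2 (\<beta> u))"
    by (rule smooth_sub_mono) (use \<beta> in auto)
  then show "\<exists>U'. open_Rsp m U' \<and> u \<in> U' \<and> U' \<subseteq> U \<and> \<beta> ` U' \<subseteq> V2 \<and> smooth_sub U' (x2 ` V2) (\<lambda>u. x2 (\<beta> u))"
  proof (intro exI[of _ U2] conjI)
    have "x (\<beta> u) \<in> x ` (V \<inter> V2)" using U'(2,4) V2 by blast
    then show "u \<in> U2" using U'(2) by (simp add: U2_def)
    show "U2 \<subseteq> U" using U'(3) by (auto simp: U2_def)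
    show "\<beta> ` U2 \<subseteq> V2" using \<beta> by blast
  qed (rule U2)
qed

lemma plot_cong:
  assumes p: "plot M m U \<beta>" and eq: "\<And>u. u \<in> U \<Longrightarrow> \<beta> u = \<beta>' u" shows "plot M m U \<beta>'"
  unfolding plot_def
proof (intro conjI ballI allI impI)
  show "\<beta>' \<in> U \<rightarrow> points M" using p eq by (auto simp: plot_def Pi_iff)
  fix u V x \<epsilon> assume u: "u \<in> U" and k: "(V, x, \<epsilon>) \<in> charts M" and V: "\<beta>' u \<in> V"
  have V': "\<beta> u \<in> V" using V eq[OF u] by simp
  obtain U' where U': "open_Rsp m U'" "u \<in> U'" "U' \<subseteq> U" "\<And>w. w \<in> U' \<Longrightarrow> \<beta> w \<in> V"
    "smooth_sub U' (x ` V) (\<lambda>u. x (\<beta> u))"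
    by (rule plotE[OF p u k V'], rule that) assumption+
  have eq': "\<beta> w = \<beta>' w" if "w \<in> U'" for w using eq U'(3) that by blast
  have "smooth_sub U' (x ` V) (\<lambda>u. x (\<beta>' u))" by (rule smooth_sub_cong[OF U'(5)]) (simp add: eq')
  moreover have "\<beta>' ` U' \<subseteq> V" using U'(4) eq' by force
  ultimately show "\<exists>U'. open_Rsp m U' \<and> u \<in> U' \<and> U' \<subseteq> U \<and> \<beta>' ` U' \<subseteq> V \<and> smooth_sub U' (x ` V) (\<lambda>u. x (\<beta>' u))"
    using U' by blast
qed

lemma plot_chart:
  assumes M: "oriented_manifold M" and k: "(V, x, \<epsilon>) \<in> charts M"
  shows "plot M (mdim M) (x ` V) (inv_into V x)"
proof (rule plotI[OF M])
  note c = chart_facts[OF M k]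
  fix u assume u: "u \<in> x ` V"
  have "smooth_sub (x ` V) (x ` V) (\<lambda>u. x (inv_into V x u))"
    by (rule smooth_sub_cong[OF smooth_sub_open_id[OF c(2)]]) (auto simp: f_inv_into_f)
  moreover have "inv_into V x ` x ` V \<subseteq> V" by (auto intro: inv_into_into)
  ultimately show "\<exists>V' x' \<epsilon> U'. (V', x', \<epsilon>) \<in> charts M \<and> open_Rsp (mdim M) U' \<and> u \<in> U' \<and> U' \<subseteq> x ` V
        \<and> inv_into V x ` U' \<subseteq> V' \<and> smooth_sub U' (x' ` V') (\<lambda>u. x' (inv_into V x u))"
    using k c(2) u by blast
qed

lemma plot_compose:
  assumes \<beta>: "plot M m U \<beta>" and U: "open_Rsp m U" and U2: "open_Rsp m2 U2" and g: "smooth_sub U2 U g"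
  shows "plot M m2 U2 (\<lambda>u. \<beta> (g u))"
  unfolding plot_def
proof (intro conjI ballI allI impI)
  show "(\<lambda>u. \<beta> (g u)) \<in> U2 \<rightarrow> points M" using plot_points[OF \<beta>] smooth_sub_maps[OF g] by blast
  fix u V x \<epsilon> assume u: "u \<in> U2" and k: "(V, x, \<epsilon>) \<in> charts M" and V: "\<beta> (g u) \<in> V"
  have gu: "g u \<in> U" by (rule smooth_sub_maps[OF g u])
  obtain U' where U': "open_Rsp m U'" "g u \<in> U'" "U' \<subseteq> U" "\<And>w. w \<in> U' \<Longrightarrow> \<beta> w \<in> V"
    "smooth_sub U' (x ` V) (\<lambda>u. x (\<beta> u))"
    by (rule plotE[OF \<beta> gu k V], rule that) assumption+
  have "open_Rsp m2 {w\<in>U2. g w \<in> U'}"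
    by (rule smooth_sub_open_preimage[OF U2 g open_Rsp_subset[OF U] U'(1)])
  moreover have "smooth_sub {w\<in>U2. g w \<in> U'} U' g" by (rule smooth_sub_mono[OF g]) auto
  note smooth_sub_compose[OF this U'(5)]
  ultimately show "\<exists>U'. open_Rsp m2 U' \<and> u \<in> U' \<and> U' \<subseteq> U2 \<and> (\<lambda>u. \<beta> (g u)) ` U' \<subseteq> V
      \<and> smooth_sub U' (x ` V) (\<lambda>u. x (\<beta> (g u)))"
    using u U'(2,4) by (intro exI[of _ "{w\<in>U2. g w \<in> U'}"]) auto
qed

lemma plot_const:
  assumes M: "oriented_manifold M" and U: "open_Rsp m U" and p: "p \<in> points M"
  shows "plot M m U (\<lambda>_. p)"
proof (rule plotI[OF M])
  obtain V x \<epsilon> where k: "(V, x, \<epsilon>) \<in> charts M" "p \<in> V" using chart_at[OF p] by blast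
  have "x ` V \<subseteq> Rinf" using chart_facts(5)[OF M k(1)] Rsp_subset_Rinf by blast
  then have "smooth_sub U (x ` V) (\<lambda>_. x p)" using k(2) by (intro smooth_sub_open_const[OF U]) auto
  then show "\<exists>V x \<epsilon> U'. (V, x, \<epsilon>) \<in> charts M \<and> open_Rsp m U' \<and> u \<in> U' \<and> U' \<subseteq> U
        \<and> (\<lambda>_. p) ` U' \<subseteq> V \<and> smooth_sub U' (x ` V) (\<lambda>u. x p)" if "u \<in> U" for u
    using k U that by (intro exI[of _ V] exI[of _ x] exI[of _ \<epsilon>] exI[of _ U]) auto
qed

text \<open>A family of maps, parametrised by \<open>c\<close>, is characterised by sending pairs of plots of \<open>c\<close> and
  of \<open>M\<close> to plots of \<open>N\<close>. Composition and change of parameters are immediate for this notion.\<close>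

definition smooth_param :: "pt set \<Rightarrow> 'p omfd \<Rightarrow> 'q omfd \<Rightarrow> (pt \<Rightarrow> 'p \<Rightarrow> 'q) \<Rightarrow> bool" where
  "smooth_param c M N \<phi> \<longleftrightarrow> (\<forall>m U \<alpha> \<beta>. open_Rsp m U \<longrightarrow> smooth_sub U c \<alpha> \<longrightarrow> plot M m U \<beta>
     \<longrightarrow> plot N m U (\<lambda>u. \<phi> (\<alpha> u) (\<beta> u)))"

lemma smooth_paramI:
  "(\<And>m U \<alpha> \<beta>. open_Rsp m U \<Longrightarrow> smooth_sub U c \<alpha> \<Longrightarrow> plot M m U \<beta> \<Longrightarrow> plot N m U (\<lambda>u. \<phi> (\<alpha> u) (\<beta> u)))
    \<Longrightarrow> smooth_param c M N \<phi>"
  by (simp add: smooth_param_def)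

lemma smooth_paramD:
  "smooth_param c M N \<phi> \<Longrightarrow> open_Rsp m U \<Longrightarrow> smooth_sub U c \<alpha> \<Longrightarrow> plot M m U \<beta> \<Longrightarrow> plot N m U (\<lambda>u. \<phi> (\<alpha> u) (\<beta> u))"
  by (simp add: smooth_param_def)

lemma smooth_param_cong:
  assumes "smooth_param c M N \<phi>" "\<And>s p. s \<in> c \<Longrightarrow> p \<in> points M \<Longrightarrow> \<phi> s p = \<psi> s p"
  shows "smooth_param c M N \<psi>"
proof (rule smooth_paramI)
  fix m U \<alpha> \<beta> assume a: "open_Rsp m U" "smooth_sub U c \<alpha>" "plot M m U \<beta>"
  show "plot N m U (\<lambda>u. \<psi> (\<alpha> u) (\<beta> u))"
    by (rule plot_cong[OF smooth_paramD[OF assms(1) a]])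
      (rule assms(2)[OF smooth_sub_maps[OF a(2)] plot_points[OF a(3)]])
qed

lemma smooth_param_compose:
  assumes "smooth_param c N M \<phi>" "smooth_param c K N \<psi>"
  shows "smooth_param c K M (\<lambda>s p. \<phi> s (\<psi> s p))"
  by (intro smooth_paramI smooth_paramD[OF assms(1)] smooth_paramD[OF assms(2)])

lemma smooth_param_restrict:
  assumes "smooth_param b M N \<phi>" "smooth_sub a b f"
  shows "smooth_param a M N (\<lambda>s. \<phi> (f s))"
  by (intro smooth_paramI smooth_paramD[OF assms(1)] smooth_sub_compose[OF _ assms(2)])

text \<open>In charts, the image of a pair of plots is the composite of the coordinate expression of
  the family with the pair of plots.\<close>

lemma smooth_family_imp_param:
  assumes M: "oriented_manifold M" and N: "oriented_manifold N" and fam: "smooth_family c M N \<phi>"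
  shows "smooth_param c M N \<phi>"
proof (intro smooth_paramI plotI[OF N])
  fix m U \<alpha> \<beta> u assume U: "open_Rsp m U" and \<alpha>: "smooth_sub U c \<alpha>" and \<beta>: "plot M m U \<beta>" and u: "u \<in> U"
  let ?d = "mdim M"
  have s: "\<alpha> u \<in> c" by (rule smooth_sub_maps[OF \<alpha> u])
  have p: "\<beta> u \<in> points M" by (rule plot_points[OF \<beta> u])
  from fam s p obtain W V x \<epsilon> V' x' \<epsilon>' where k: "(V, x, \<epsilon>) \<in> charts M" and k': "(V', x', \<epsilon>') \<in> charts N"
    and W: "open_inf W" "\<alpha> u \<in> W" "\<beta> u \<in> V" "\<And>t. t \<in> c \<inter> W \<Longrightarrow> \<phi> t ` V \<subseteq> V'"
    and sm: "smooth_sub {pt_join ?d u t | u t. u \<in> x ` V \<and> t \<in> c \<inter> W} (x' ` V')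
          (\<lambda>z. x' (\<phi> (pt_tail ?d z) (inv_into V x (pt_head ?d z))))"
    unfolding smooth_family_def by fastforce
  note ch = chart_facts[OF M k]
  obtain U1 where U1: "open_Rsp m U1" "u \<in> U1" "U1 \<subseteq> U" "\<And>w. w \<in> U1 \<Longrightarrow> \<beta> w \<in> V"
    "smooth_sub U1 (x ` V) (\<lambda>u. x (\<beta> u))"
    by (rule plotE[OF \<beta> u k W(3)], rule that) assumption+
  have U2: "open_Rsp m {w\<in>U. \<alpha> w \<in> W}" by (rule smooth_sub_open_preimage_inf[OF U \<alpha> W(1)])
  define U' where "U' = U1 \<inter> {w\<in>U. \<alpha> w \<in> W}"
  have U': "open_Rsp m U'" unfolding U'_def by (rule openin_Int[OF U1(1) U2])
  have in': "\<beta> w \<in> V" "\<alpha> w \<in> c \<inter> W" if "w \<in> U'" for w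
    using that U1(4) smooth_sub_maps[OF \<alpha>] by (auto simp: U'_def)
  have a: "smooth_sub U' (x ` V) (\<lambda>u. x (\<beta> u))" by (rule smooth_sub_restrict[OF U1(5)]) (simp add: U'_def)
  have b: "smooth_sub U' c \<alpha>" by (rule smooth_sub_restrict[OF \<alpha>]) (auto simp: U'_def)
  have j: "smooth_sub U' {pt_join ?d u t | u t. u \<in> x ` V \<and> t \<in> c \<inter> W} (\<lambda>w. pt_join ?d (x (\<beta> w)) (\<alpha> w))"
  proof (rule smooth_sub_join[OF U' a ch(5) b])
    fix w assume "w \<in> U'"
    from in'[OF this]
    show "pt_join ?d (x (\<beta> w)) (\<alpha> w) \<in> {pt_join ?d u t | u t. u \<in> x ` V \<and> t \<in> c \<inter> W}" by blast
  qed
  have "smooth_sub U' (x' ` V') (\<lambda>w. x' (\<phi> (\<alpha> w) (\<beta> w)))"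
  proof (rule smooth_sub_cong[OF smooth_sub_compose[OF j sm]])
    fix w assume "w \<in> U'"
    from in'(1)[OF this] have "x (\<beta> w) \<in> Rsp ?d" "inv_into V x (x (\<beta> w)) = \<beta> w"
      using ch(1,5) by auto
    then show "x' (\<phi> (pt_tail ?d (pt_join ?d (x (\<beta> w)) (\<alpha> w)))
        (inv_into V x (pt_head ?d (pt_join ?d (x (\<beta> w)) (\<alpha> w))))) = x' (\<phi> (\<alpha> w) (\<beta> w))"
      by (simp add: pt_head_join)
  qed
  moreover have "(\<lambda>w. \<phi> (\<alpha> w) (\<beta> w)) ` U' \<subseteq> V'" using in' W(4) by blast
  moreover have "u \<in> U'" "U' \<subseteq> U" using U1 W u by (auto simp: U'_def)
  ultimately show "\<exists>V x \<epsilon> U'. (V, x, \<epsilon>) \<in> charts N \<and> open_Rsp m U' \<and> u \<in> U' \<and> U' \<subseteq> U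
      \<and> (\<lambda>u. \<phi> (\<alpha> u) (\<beta> u)) ` U' \<subseteq> V \<and> smooth_sub U' (x ` V) (\<lambda>u. x (\<phi> (\<alpha> u) (\<beta> u)))"
    using k' U' by blast
qed

text \<open>A test space \<open>c\<close> has a global chart \<open>F\<close>. Together with a chart \<open>x\<close> of \<open>M\<close>, it provides a
  universal pair of plots, defined on an open subset of \<open>Rsp (mdim M + n)\<close>. The coordinate expression of
  the family is recovered from its value \<open>\<gamma>\<close> on this pair by composition with the inverse of \<open>F\<close>; the charts
  and the neighbourhood \<open>W\<close> have to be shrunk so that all of this happens inside the plot's domain.\<close>

lemma smooth_param_imp_family:
  assumes M: "oriented_manifold M" and N: "oriented_manifold N" and c: "c \<in> Ob Cart"
    and par: "smooth_param c M N \<phi>"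
  shows "smooth_family c M N \<phi>"
  unfolding smooth_family_def
proof (intro conjI ballI)
  let ?d = "mdim M"
  have op: "open_Rsp k (Rsp k)" for k by simp
  fix s assume s: "s \<in> c"
  have maps: "\<phi> s p \<in> points N" if "p \<in> points M" for p
  proof -
    have "plot N 0 (Rsp 0) (\<lambda>_. \<phi> s p)"
      by (rule smooth_paramD[OF par op smooth_sub_open_const[OF op s Cart_Ob_subset[OF c]] plot_const[OF M op that]])
    then show ?thesis using plot_points zero_in_Rsp by blast
  qed
  then show "\<phi> s \<in> points M \<rightarrow> points N" by blast
  fix p assume p: "p \<in> points M"
  obtain V0 x \<epsilon> where k: "(V0, x, \<epsilon>) \<in> charts M" "p \<in> V0" using chart_at[OF p] by blast
  note ch = chart_facts[OF M k(1)]
  obtain n F where F: "diffeo_sub (Rsp n) c F" using c by (rule Cart_ObE)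
  define F' where "F' = inv_into (Rsp n) F"
  have F1: "smooth_sub (Rsp n) c F" and F2: "smooth_sub c (Rsp n) F'" and Fb: "bij_betw F (Rsp n) c"
    using F by (auto simp: diffeo_sub_def F'_def)
  have FF: "F (F' t) = t" if "t \<in> c" for t
    using that Fb unfolding F'_def by (simp add: bij_betw_inv_into_right)
  (* The domain of the universal pair of plots; its points are (u, r), with u in the chart of M and r a
     coordinate on c. *)
  define U where "U = {z\<in>Rsp (?d + n). pt_head ?d z \<in> x ` V0}"
  have U: "open_Rsp (?d + n) U" unfolding U_def
    by (rule open_Rsp_smooth_preimage[OF op smooth_Rsp_head[OF smooth_Rsp_id] _ ch(2)]) (auto simp: pt_head_Rsp)
  have Ui: "smooth_Rsp (?d + n) U (\<lambda>z. z)" by (rule smooth_Rsp_id)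
  have hd: "smooth_sub U (x ` V0) (pt_head ?d)"
    by (rule smooth_sub_Rsp[OF U _ _ smooth_Rsp_head[OF Ui], where n = ?d]) (use pt_head_Rsp in \<open>force simp: U_def\<close>)+
  have tl: "smooth_sub U (Rsp n) (pt_tail ?d)"
    by (rule smooth_sub_Rsp[OF U _ _ smooth_Rsp_tail[OF Ui], where n = n])
      (use pt_tail_Rsp[of _ "?d + n" ?d] in \<open>auto simp: U_def\<close>)
  define \<gamma> where "\<gamma> z = \<phi> (F (pt_tail ?d z)) (inv_into V0 x (pt_head ?d z))" for z
  have \<gamma>: "plot N (?d + n) U \<gamma>" unfolding \<gamma>_def
    by (rule smooth_paramD[OF par U smooth_sub_compose[OF tl F1] plot_compose[OF plot_chart[OF M k(1)] ch(2) U hd]])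
  define r0 where "r0 = F' s"
  have r0: "r0 \<in> Rsp n" unfolding r0_def by (rule smooth_sub_maps[OF F2 s])
  have xp: "x p \<in> Rsp ?d" using ch(5) k(2) by blast
  (* The point of U that represents (s, p). *)
  define z0 where "z0 = pt_join ?d (x p) r0"
  have z0: "z0 \<in> U" using k(2) xp r0 by (simp add: z0_def U_def pt_join_Rsp pt_head_join)
  have \<gamma>z0: "\<gamma> z0 = \<phi> s p" using ch(1) k(2) xp FF[OF s] by (simp add: \<gamma>_def z0_def pt_head_join r0_def)
  obtain V' x' \<epsilon>' where k': "(V', x', \<epsilon>') \<in> charts N" "\<gamma> z0 \<in> V'"
    using chart_at[OF maps[OF p]] \<gamma>z0 by metis
  obtain U' where U': "open_Rsp (?d + n) U'" "z0 \<in> U'" "U' \<subseteq> U" "\<And>w. w \<in> U' \<Longrightarrow> \<gamma> w \<in> V'"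
    "smooth_sub U' (x' ` V') (\<lambda>u. x' (\<gamma> u))"
    by (rule plotE[OF \<gamma> z0 k'], rule that) assumption+
  obtain G R where G: "open_Rsp ?d G" "x p \<in> G" and R: "open_Rsp n R" "r0 \<in> R"
    and GR: "\<And>u r. u \<in> G \<Longrightarrow> r \<in> R \<Longrightarrow> pt_join ?d u r \<in> U'"
    by (rule open_Rsp_join_nhd[OF U'(1) U'(2)[unfolded z0_def] xp r0], rule that) assumption+
  define V where "V = {q\<in>V0. x q \<in> G}"
  have kV: "(V, x, \<epsilon>) \<in> charts M" unfolding V_def by (rule chart_restrict[OF M k(1) G(1)])
  note chV = chart_facts[OF M kV]
  have R': "open_inf {r\<in>Rinf. pt_head n r \<in> R}" by (rule open_inf_cylinder[OF R(1)])
  have "F' s \<in> {r\<in>Rinf. pt_head n r \<in> R}"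
    using r0 R(2) Rsp_subset_Rinf by (auto simp: r0_def[symmetric] pt_head_id)
  note F's = this
  obtain W where W: "open_inf W" "s \<in> W" "\<And>t. t \<in> c \<inter> W \<Longrightarrow> F' t \<in> {r\<in>Rinf. pt_head n r \<in> R}"
    by (rule smooth_sub_continuous[OF F2 s R' F's], rule that) assumption+
  have WR: "F' t \<in> R" if "t \<in> c \<inter> W" for t
  proof -
    have "F' t \<in> Rsp n" using smooth_sub_maps[OF F2] that by blast
    then show ?thesis using W(3)[OF that] by (simp add: pt_head_id)
  qed
  have \<gamma>eq: "\<gamma> (pt_join ?d (x q) (F' t)) = \<phi> t q" if "t \<in> c" "q \<in> V" for t q
  proof -
    have "q \<in> V0" "x q \<in> Rsp ?d" using that ch(5) by (auto simp: V_def)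
    then show ?thesis using FF[OF that(1)] ch(1) by (simp add: \<gamma>_def pt_head_join)
  qed
  let ?A = "{pt_join ?d u t | u t. u \<in> x ` V \<and> t \<in> c \<inter> W}"
  have F3: "smooth_sub (c \<inter> W) R F'" by (rule smooth_sub_mono[OF F2]) (use WR in auto)
  have "smooth_sub ?A {pt_join ?d u r | u r. u \<in> x ` V \<and> r \<in> R}
      (\<lambda>z. pt_join ?d (pt_head ?d z) (F' (pt_tail ?d z)))"
    by (rule smooth_sub_join_map[OF chV(5) F3])
  then have "smooth_sub ?A U' (\<lambda>z. pt_join ?d (pt_head ?d z) (F' (pt_tail ?d z)))"
  proof (rule smooth_sub_mono)
    show "(\<lambda>z. pt_join ?d (pt_head ?d z) (F' (pt_tail ?d z))) \<in> ?A \<rightarrow> U'"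
    proof
      fix z assume "z \<in> ?A"
      then obtain q t where z: "z = pt_join ?d (x q) t" "q \<in> V" "t \<in> c \<inter> W" by blast
      then have "x q \<in> Rsp ?d" "x q \<in> G" using chV(5) by (auto simp: V_def)
      then show "pt_join ?d (pt_head ?d z) (F' (pt_tail ?d z)) \<in> U'"
        using GR WR[OF z(3)] z(1) by (simp add: pt_head_join)
    qed
  qed simp
  from smooth_sub_compose[OF this U'(5)]
  have "smooth_sub ?A (x' ` V') (\<lambda>z. x' (\<gamma> (pt_join ?d (pt_head ?d z) (F' (pt_tail ?d z)))))" .
  then have sm: "smooth_sub ?A (x' ` V') (\<lambda>z. x' (\<phi> (pt_tail ?d z) (inv_into V x (pt_head ?d z))))"
  proof (rule smooth_sub_cong)
    fix z assume "z \<in> ?A"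
    then obtain q t where z: "z = pt_join ?d (x q) t" "q \<in> V" "t \<in> c \<inter> W" by blast
    then have "x q \<in> Rsp ?d" "inv_into V x (x q) = q" using chV(1,5) by auto
    then show "x' (\<gamma> (pt_join ?d (pt_head ?d z) (F' (pt_tail ?d z))))
        = x' (\<phi> (pt_tail ?d z) (inv_into V x (pt_head ?d z)))"
      using \<gamma>eq z by (simp add: pt_head_join)
  qed
  have "\<phi> t ` V \<subseteq> V'" if "t \<in> c \<inter> W" for t
  proof
    fix y assume "y \<in> \<phi> t ` V"
    then obtain q where q: "q \<in> V" "y = \<phi> t q" by blast
    then have "pt_join ?d (x q) (F' t) \<in> U'" using GR WR[OF that] by (simp add: V_def)
    then show "y \<in> V'" using U'(4) \<gamma>eq q that by fastforce
  qed
  moreover have "p \<in> V" using k G by (simp add: V_def)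
  ultimately show "\<exists>W. \<exists>(V, x, \<epsilon>)\<in>charts M. \<exists>(V', x', \<epsilon>')\<in>charts N.
        open_inf W \<and> s \<in> W \<and> p \<in> V \<and> (\<forall>t\<in>c \<inter> W. \<phi> t ` V \<subseteq> V') \<and>
        smooth_sub {pt_join ?d u t | u t. u \<in> x ` V \<and> t \<in> c \<inter> W} (x' ` V')
          (\<lambda>z. x' (\<phi> (pt_tail ?d z) (inv_into V x (pt_head ?d z))))"
    using W(1,2) sm
    by (intro exI[of _ W] bexI[OF _ kV] bexI[OF _ k'(1)] case_prodI) auto
qed

lemma smooth_family_iff_param:
  "oriented_manifold M \<Longrightarrow> oriented_manifold N \<Longrightarrow> c \<in> Ob Cart
    \<Longrightarrow> smooth_family c M N \<phi> \<longleftrightarrow> smooth_param c M N \<phi>"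
  by (blast intro: smooth_family_imp_param smooth_param_imp_family)

section \<open>Orientation-preserving diffeomorphisms and their families\<close>

lemma Rsp_0: "Rsp 0 = {\<lambda>_. 0}"
  by (auto simp: Rsp_def)

lemma Rsp_0_Cart: "Rsp 0 \<in> Ob Cart"
proof -
  have i: "inv_into (Rsp 0) (\<lambda>x. x) z = z" if "z \<in> Rsp 0" for z using that by (intro inv_into_f_eq) auto
  have s: "smooth_sub (Rsp 0) (Rsp 0) (\<lambda>x. x)" by (rule smooth_sub_open_id[where m = 0]) auto
  moreover have "smooth_sub (Rsp 0) (Rsp 0) (inv_into (Rsp 0) (\<lambda>x. x))"
    by (rule smooth_sub_cong[OF s]) (simp add: i)
  ultimately have "diffeo_sub (Rsp 0) (Rsp 0) (\<lambda>x. x)" by (auto simp: diffeo_sub_def bij_betw_def)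
  then show ?thesis using Rsp_subset_Rinf by (auto simp: Cart_def)
qed

text \<open>A single smooth map is a family over the one-point test space \<open>Rsp 0\<close>: prepending
  coordinates to its only point, the zero sequence, changes nothing.\<close>

lemma smooth_map_iff_param:
  assumes M: "oriented_manifold M" and N: "oriented_manifold N"
  shows "smooth_map M N f \<longleftrightarrow> smooth_param (Rsp 0) M N (\<lambda>_. f)"
proof -
  let ?d = "mdim M"
  have Rinf: "open_inf Rinf"
    using Rsp_subset_Rinf by (auto simp: open_inf_def Int_absorb1)
  have key: "smooth_sub {pt_join ?d u t | u t. u \<in> x ` V \<and> t \<in> Rsp 0 \<inter> W} B
        (\<lambda>z. x' (f (inv_into V x (pt_head ?d z))))
      \<longleftrightarrow> smooth_sub (x ` V) B (x' \<circ> f \<circ> inv_into V x)"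
    if k: "(V, x, \<epsilon>) \<in> charts M" and W: "(\<lambda>_. 0) \<in> W" for V x \<epsilon> W B and x' :: "'b \<Rightarrow> pt"
  proof -
    have V: "pt_join ?d u (\<lambda>_. 0) = u" "pt_head ?d u = u" if "u \<in> x ` V" for u
    proof -
      have "u \<in> Rsp ?d" using chart_facts(5)[OF M k] that by blast
      then show "pt_join ?d u (\<lambda>_. 0) = u" "pt_head ?d u = u" by (auto simp: pt_join_def Rsp_def pt_head_def)
    qed
    have "{pt_join ?d u t | u t. u \<in> x ` V \<and> t \<in> Rsp 0 \<inter> W} = (\<lambda>u. pt_join ?d u (\<lambda>_. 0)) ` x ` V"
      using W by (auto simp: Rsp_0)
    also have "\<dots> = x ` V" using V(1) by force
    finally have eq: "{pt_join ?d u t | u t. u \<in> x ` V \<and> t \<in> Rsp 0 \<inter> W} = x ` V" .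
    show ?thesis unfolding eq
    proof
      assume "smooth_sub (x ` V) B (\<lambda>z. x' (f (inv_into V x (pt_head ?d z))))"
      then show "smooth_sub (x ` V) B (x' \<circ> f \<circ> inv_into V x)"
        by (rule smooth_sub_cong) (simp add: V(2))
    next
      assume "smooth_sub (x ` V) B (x' \<circ> f \<circ> inv_into V x)"
      then show "smooth_sub (x ` V) B (\<lambda>z. x' (f (inv_into V x (pt_head ?d z))))"
        by (rule smooth_sub_cong) (simp add: V(2))
    qed
  qed
  have "smooth_map M N f \<longleftrightarrow> smooth_family (Rsp 0) M N (\<lambda>_. f)"
  proof
    assume sm: "smooth_map M N f"
    show "smooth_family (Rsp 0) M N (\<lambda>_. f)" unfolding smooth_family_def
    proof (intro conjI ballI)
      show "f \<in> points M \<rightarrow> points N" using sm by (simp add: smooth_map_def)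
      fix s p assume s: "s \<in> Rsp 0" and p: "p \<in> points M"
      from sm p obtain V x \<epsilon> V' x' \<epsilon>' where k: "(V, x, \<epsilon>) \<in> charts M" "(V', x', \<epsilon>') \<in> charts N"
        "p \<in> V" "f ` V \<subseteq> V'" "smooth_sub (x ` V) (x' ` V') (x' \<circ> f \<circ> inv_into V x)"
        unfolding smooth_map_def by fastforce
      have "(\<lambda>_. 0) \<in> Rinf" using zero_in_Rsp Rsp_subset_Rinf by blast
      from key[OF k(1) this, of "x' ` V'" x'] k
      show "\<exists>W. \<exists>(V, x, \<epsilon>)\<in>charts M. \<exists>(V', x', \<epsilon>')\<in>charts N.
        open_inf W \<and> s \<in> W \<and> p \<in> V \<and> (\<forall>t\<in>Rsp 0 \<inter> W. f ` V \<subseteq> V') \<and>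
        smooth_sub {pt_join ?d u t | u t. u \<in> x ` V \<and> t \<in> Rsp 0 \<inter> W} (x' ` V')
          (\<lambda>z. x' (f (inv_into V x (pt_head ?d z))))"
        using Rinf s Rsp_subset_Rinf
        by (intro exI[of _ Rinf] bexI[OF _ k(1)] bexI[OF _ k(2)] case_prodI) auto
    qed
  next
    assume sf: "smooth_family (Rsp 0) M N (\<lambda>_. f)"
    have z: "(\<lambda>_. 0) \<in> Rsp 0" by (rule zero_in_Rsp)
    show "smooth_map M N f" unfolding smooth_map_def
    proof (intro conjI ballI)
      show "f \<in> points M \<rightarrow> points N" using sf z unfolding smooth_family_def by blast
      fix p assume p: "p \<in> points M"
      from sf z p obtain W V x \<epsilon> V' x' \<epsilon>' where k: "(V, x, \<epsilon>) \<in> charts M" "(V', x', \<epsilon>') \<in> charts N"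
        "(\<lambda>_. 0) \<in> W" "p \<in> V" "\<And>t. t \<in> Rsp 0 \<inter> W \<Longrightarrow> f ` V \<subseteq> V'"
        "smooth_sub {pt_join ?d u t | u t. u \<in> x ` V \<and> t \<in> Rsp 0 \<inter> W} (x' ` V')
          (\<lambda>z. x' (f (inv_into V x (pt_head ?d z))))"
        unfolding smooth_family_def by fastforce
      have "smooth_sub (x ` V) (x' ` V') (x' \<circ> f \<circ> inv_into V x)"
        using key[OF k(1,3)] k(6) by blast
      moreover have "f ` V \<subseteq> V'" using k(5)[of "\<lambda>_. 0"] k(3) z by blast
      ultimately show "\<exists>(V, x, \<epsilon>)\<in>charts M. \<exists>(V', x', \<epsilon>')\<in>charts N.
        p \<in> V \<and> f ` V \<subseteq> V' \<and> smooth_sub (x ` V) (x' ` V') (x' \<circ> f \<circ> inv_into V x)"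
        using k(4) by (intro bexI[OF _ k(1)] bexI[OF _ k(2)] case_prodI) auto
    qed
  qed
  then show ?thesis using smooth_family_iff_param[OF M N Rsp_0_Cart] by blast
qed

lemma smooth_map_param:
  assumes "oriented_manifold M" "oriented_manifold N" "smooth_map M N f"
  shows "smooth_param c M N (\<lambda>_. f)"
proof (rule smooth_paramI)
  fix m U \<alpha> \<beta> assume "open_Rsp m U" "smooth_sub U c \<alpha>" "plot M m U \<beta>"
  moreover have "smooth_sub U (Rsp 0) (\<lambda>_. (\<lambda>_. 0))" if "open_Rsp m U"
    by (rule smooth_sub_open_const[OF that]) (auto simp: Rsp_0 intro: subsetD[OF Rsp_subset_Rinf[of 0]])
  ultimately show "plot N m U (\<lambda>u. f (\<beta> u))"
    using assms smooth_map_iff_param smooth_paramD[of "Rsp 0" M N "\<lambda>_. f"] by blast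
qed

lemma smooth_map_compose:
  assumes "oriented_manifold M" "oriented_manifold N" "oriented_manifold K"
    "smooth_map M N f" "smooth_map N K g"
  shows "smooth_map M K (\<lambda>p. g (f p))"
  using assms smooth_param_compose[of "Rsp 0" N K "\<lambda>_. g" M "\<lambda>_. f"] by (simp add: smooth_map_iff_param)

lemma smooth_map_cong:
  assumes "oriented_manifold M" "oriented_manifold N" "smooth_map M N f"
    "\<And>p. p \<in> points M \<Longrightarrow> f p = g p"
  shows "smooth_map M N g"
  using assms smooth_param_cong[of "Rsp 0" M N "\<lambda>_. f" "\<lambda>_. g"] by (simp add: smooth_map_iff_param)

lemma smooth_map_id: "oriented_manifold M \<Longrightarrow> smooth_map M M (\<lambda>p. p)"
  by (simp add: smooth_map_iff_param smooth_param_def)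

lemma smooth_map_points: "smooth_map M N f \<Longrightarrow> p \<in> points M \<Longrightarrow> f p \<in> points N"
  by (auto simp: smooth_map_def)

lemma smooth_map_coord:
  assumes M: "oriented_manifold M" and N: "oriented_manifold N" and f: "smooth_map M N f"
    and k: "(V, x, \<epsilon>) \<in> charts M" "(V', x', \<epsilon>') \<in> charts N" and p: "p \<in> V" "f p \<in> V'"
  obtains U where "open_Rsp (mdim M) U" "x p \<in> U" "U \<subseteq> x ` V" "\<And>u. u \<in> U \<Longrightarrow> f (inv_into V x u) \<in> V'"
    "smooth_sub U (x' ` V') (\<lambda>u. x' (f (inv_into V x u)))"
proof -
  note c = chart_facts[OF M k(1)]
  have "plot N (mdim M) (x ` V) (\<lambda>u. f (inv_into V x u))"
    using smooth_paramD[OF smooth_map_param[OF M N f, of "Rsp 0"] c(2) smooth_sub_open_const[OF c(2), of "\<lambda>_. 0"]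
        plot_chart[OF M k(1)]] zero_in_Rsp Rsp_subset_Rinf by blast
  note pl = this
  have xp: "x p \<in> x ` V" using p by blast
  have fp: "f (inv_into V x (x p)) \<in> V'" using c(1) p by simp
  show thesis by (rule plotE[OF pl xp k(2) fp], rule that) assumption+
qed

text \<open>The chain rule for Jacobians in charts; the chart of the middle manifold cancels.\<close>

lemma coordinate_chain_rule:
  assumes M: "oriented_manifold M" and N: "oriented_manifold N" and K: "oriented_manifold K"
    and f: "smooth_map M N f" and g: "smooth_map N K g" and dim: "mdim N = mdim M"
    and k: "(V, x, \<epsilon>) \<in> charts M" "(V', x', \<epsilon>') \<in> charts N" "(V'', x'', \<epsilon>'') \<in> charts K"
    and p: "p \<in> V" "f p \<in> V'" "g (f p) \<in> V''"
  shows "jacobian (mdim M) (x'' \<circ> (\<lambda>p. g (f p)) \<circ> inv_into V x) (x p)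
    = jacobian (mdim M) (x'' \<circ> g \<circ> inv_into V' x') (x' (f p)) * jacobian (mdim M) (x' \<circ> f \<circ> inv_into V x) (x p)"
proof -
  let ?d = "mdim M"
  obtain U where U: "open_Rsp ?d U" "x p \<in> U" "U \<subseteq> x ` V" "\<And>u. u \<in> U \<Longrightarrow> f (inv_into V x u) \<in> V'"
    "smooth_sub U (x' ` V') (\<lambda>u. x' (f (inv_into V x u)))"
    by (rule smooth_map_coord[OF M N f k(1,2) p(1,2)], rule that) assumption+
  obtain W where W: "open_Rsp ?d W" "x' (f p) \<in> W" "W \<subseteq> x' ` V'"
    "smooth_sub W (x'' ` V'') (\<lambda>u. x'' (g (inv_into V' x' u)))"
    by (rule smooth_map_coord[OF N K g k(2,3) p(2,3), unfolded dim], rule that) assumption+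
  note c = chart_facts[OF M k(1)] and c' = chart_facts[OF N k(2)]
  define U1 where "U1 = {u\<in>U. x' (f (inv_into V x u)) \<in> W}"
  have U1: "open_Rsp ?d U1" unfolding U1_def
    by (rule smooth_sub_open_preimage[OF U(1,5) c'(5)[unfolded dim] W(1)])
  have inv: "inv_into V x (x p) = p" using c(1) p(1) by simp
  have u: "x p \<in> U1" using U(2) W(2) by (simp add: U1_def inv)
  have "smooth_sub U1 W (\<lambda>u. x' (f (inv_into V x u)))"
    by (rule smooth_sub_mono[OF U(5)]) (auto simp: U1_def)
  from jacobian_compose[OF U1 u this W(1,4)]
  have "jacobian ?d (\<lambda>u. x'' (g (inv_into V' x' (x' (f (inv_into V x u)))))) (x p)
    = jacobian ?d (x'' \<circ> g \<circ> inv_into V' x') (x' (f p)) * jacobian ?d (x' \<circ> f \<circ> inv_into V x) (x p)"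
    by (simp add: inv comp_def)
  moreover have "jacobian ?d (\<lambda>u. x'' (g (inv_into V' x' (x' (f (inv_into V x u)))))) (x p)
      = jacobian ?d (x'' \<circ> (\<lambda>p. g (f p)) \<circ> inv_into V x) (x p)"
    by (rule jacobian_cong[OF U1 u]) (use U(4) c'(1) in \<open>auto simp: U1_def\<close>)
  ultimately show ?thesis by simp
qed

lemma jacobian_chart_id:
  assumes M: "oriented_manifold M" and k: "(V, x, \<epsilon>) \<in> charts M" and p: "p \<in> V"
    and h: "\<And>q. q \<in> V \<Longrightarrow> h q = q"
  shows "jacobian (mdim M) (x \<circ> h \<circ> inv_into V x) (x p) = 1"
proof -
  have "jacobian (mdim M) (x \<circ> h \<circ> inv_into V x) (x p) = jacobian (mdim M) (\<lambda>u. u) (x p)"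
    by (rule jacobian_cong[OF chart_facts(2)[OF M k]]) (use p h chart_facts(1)[OF M k] in auto)
  then show ?thesis by (simp add: jacobian_id)
qed

lemma orientation_preservingI:
  assumes "\<And>V x \<epsilon> V' x' \<epsilon>' p. (V, x, \<epsilon>) \<in> charts M \<Longrightarrow> (V', x', \<epsilon>') \<in> charts N \<Longrightarrow> p \<in> V \<Longrightarrow> f p \<in> V'
    \<Longrightarrow> sgn (jacobian (mdim M) (x' \<circ> f \<circ> inv_into V x) (x p)) = \<epsilon> * \<epsilon>'"
  shows "orientation_preserving M N f"
  using assms unfolding orientation_preserving_def by blast

lemma orientation_preservingD:
  "orientation_preserving M N f \<Longrightarrow> (V, x, \<epsilon>) \<in> charts M \<Longrightarrow> (V', x', \<epsilon>') \<in> charts N \<Longrightarrow> p \<in> V \<Longrightarrow> f p \<in> V'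
    \<Longrightarrow> sgn (jacobian (mdim M) (x' \<circ> f \<circ> inv_into V x) (x p)) = \<epsilon> * \<epsilon>'"
  unfolding orientation_preserving_def by fastforce

lemma inv_into_cong: "(\<And>p. p \<in> A \<Longrightarrow> f p = g p) \<Longrightarrow> inv_into A f y = inv_into A g y"
  by (simp add: inv_into_def cong: conj_cong)

lemma op_diffeoD:
  assumes "op_diffeo M N f"
  shows "mdim M = mdim N" "bij_betw f (points M) (points N)" "smooth_map M N f"
    "smooth_map N M (inv_into (points M) f)" "orientation_preserving M N f"
  using assms by (auto simp: op_diffeo_def)

lemma op_diffeo_cong:
  assumes M: "oriented_manifold M" and N: "oriented_manifold N" and f: "op_diffeo M N f"
    and eq: "\<And>p. p \<in> points M \<Longrightarrow> f p = g p"
  shows "op_diffeo M N g"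
  unfolding op_diffeo_def
proof (intro conjI)
  note D = op_diffeoD[OF f]
  show "mdim M = mdim N" by (rule D)
  show "bij_betw g (points M) (points N)" using D(2) eq bij_betw_cong[of "points M" f g] by blast
  show "smooth_map M N g" by (rule smooth_map_cong[OF M N D(3) eq])
  show "smooth_map N M (inv_into (points M) g)"
    by (rule smooth_map_cong[OF N M D(4)]) (rule inv_into_cong[OF eq])
  show "orientation_preserving M N g"
  proof (rule orientation_preservingI)
    fix V x \<epsilon> V' x' \<epsilon>' p
    assume k: "(V, x, \<epsilon>) \<in> charts M" "(V', x', \<epsilon>') \<in> charts N" "p \<in> V" "g p \<in> V'"
    note c = chart_facts[OF M k(1)]
    have p: "f p \<in> V'" using k eq c by auto
    have e: "f (inv_into V x u) = g (inv_into V x u)" if "u \<in> x ` V" for u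
      using eq c(4) inv_into_into[OF that] by blast
    have "jacobian (mdim M) (x' \<circ> f \<circ> inv_into V x) (x p) = jacobian (mdim M) (x' \<circ> g \<circ> inv_into V x) (x p)"
      by (rule jacobian_cong[OF c(2)]) (use k(3) e in auto)
    then show "sgn (jacobian (mdim M) (x' \<circ> g \<circ> inv_into V x) (x p)) = \<epsilon> * \<epsilon>'"
      using orientation_preservingD[OF D(5) k(1-3) p] by simp
  qed
qed

lemma op_diffeo_id:
  assumes M: "oriented_manifold M" shows "op_diffeo M M (\<lambda>p. p)"
  unfolding op_diffeo_def
proof (intro conjI smooth_map_id M)
  show "bij_betw (\<lambda>p. p) (points M) (points M)" by (simp add: bij_betw_def)
  show "smooth_map M M (inv_into (points M) (\<lambda>p. p))"
    by (rule smooth_map_cong[OF M M smooth_map_id[OF M]]) (simp add: inv_into_f_eq)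
  show "orientation_preserving M M (\<lambda>p. p)"
    by (rule orientation_preservingI) (use transition(5)[OF M] in \<open>simp add: comp_def\<close>)
qed simp

lemma op_diffeo_compose:
  assumes M: "oriented_manifold M" and N: "oriented_manifold N" and K: "oriented_manifold K"
    and f: "op_diffeo M N f" and g: "op_diffeo N K g"
  shows "op_diffeo M K (\<lambda>p. g (f p))"
  unfolding op_diffeo_def
proof (intro conjI)
  note F = op_diffeoD[OF f] and G = op_diffeoD[OF g]
  show "mdim M = mdim K" using F G by simp
  show b: "bij_betw (\<lambda>p. g (f p)) (points M) (points K)"
    using bij_betw_trans[OF F(2) G(2)] by (simp add: comp_def)
  show "smooth_map M K (\<lambda>p. g (f p))" by (rule smooth_map_compose[OF M N K F(3) G(3)])
  show "smooth_map K M (inv_into (points M) (\<lambda>p. g (f p)))"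
  proof (rule smooth_map_cong[OF K M smooth_map_compose[OF K N M G(4) F(4)]])
    fix q assume q: "q \<in> points K"
    have a: "inv_into (points N) g q \<in> points N" by (rule smooth_map_points[OF G(4) q])
    have "inv_into (points M) f (inv_into (points N) g q) \<in> points M" by (rule smooth_map_points[OF F(4) a])
    moreover have "g (f (inv_into (points M) f (inv_into (points N) g q))) = q"
      using F(2) G(2) q a by (simp add: bij_betw_inv_into_right)
    ultimately show "inv_into (points M) f (inv_into (points N) g q) = inv_into (points M) (\<lambda>p. g (f p)) q"
      using bij_betw_imp_inj_on[OF b] by (intro inv_into_f_eq[symmetric]) auto
  qed
  show "orientation_preserving M K (\<lambda>p. g (f p))"
  proof (rule orientation_preservingI)
    fix V x \<epsilon> V' x' \<epsilon>' p
    assume k: "(V, x, \<epsilon>) \<in> charts M" "(V', x', \<epsilon>') \<in> charts K" "p \<in> V" "g (f p) \<in> V'"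
    have "f p \<in> points N" using smooth_map_points[OF F(3)] chart_facts(4)[OF M k(1)] k(3) by blast
    then obtain W y \<delta> where l: "(W, y, \<delta>) \<in> charts N" "f p \<in> W" by (rule chart_at)
    have "\<delta> * \<delta> = 1" using chart_facts(3)[OF N l(1)] by auto
    moreover have "sgn (jacobian (mdim M) (y \<circ> f \<circ> inv_into V x) (x p)) = \<epsilon> * \<delta>"
      by (rule orientation_preservingD[OF F(5) k(1) l(1) k(3) l(2)])
    moreover have "sgn (jacobian (mdim M) (x' \<circ> g \<circ> inv_into W y) (y (f p))) = \<delta> * \<epsilon>'"
      using orientation_preservingD[OF G(5) l(1) k(2) l(2) k(4)] F(1) by simp
    ultimately show "sgn (jacobian (mdim M) (x' \<circ> (\<lambda>p. g (f p)) \<circ> inv_into V x) (x p)) = \<epsilon> * \<epsilon>'"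
      using coordinate_chain_rule[OF M N K F(3) G(3) F(1)[symmetric] k(1) l(1) k(2,3) l(2) k(4)]
      by (simp add: sgn_mult mult.assoc mult.left_commute)
  qed
qed

text \<open>The sign of the Jacobian of the inverse is determined by the chain rule, because the
  composite with \<open>f\<close> is the identity and has Jacobian \<open>1\<close>.\<close>

lemma op_diffeo_inv:
  assumes M: "oriented_manifold M" and N: "oriented_manifold N" and f: "op_diffeo M N f"
  shows "op_diffeo N M (inv_into (points M) f)"
  unfolding op_diffeo_def
proof (intro conjI)
  note F = op_diffeoD[OF f]
  let ?g = "inv_into (points M) f"
  show "mdim N = mdim M" using F(1) by simp
  show b: "bij_betw ?g (points N) (points M)" by (rule bij_betw_inv_into[OF F(2)])
  show "smooth_map N M ?g" by (rule F)
  show "smooth_map M N (inv_into (points N) ?g)"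
  proof (rule smooth_map_cong[OF M N F(3)])
    fix p assume p: "p \<in> points M"
    have "?g (f p) = p" using F(2) p by (simp add: bij_betw_inv_into_left)
    then show "f p = inv_into (points N) ?g p"
      using bij_betw_imp_inj_on[OF b] smooth_map_points[OF F(3) p] by (intro inv_into_f_eq[symmetric]) auto
  qed
  show "orientation_preserving N M ?g"
  proof (rule orientation_preservingI)
    fix V x \<epsilon> V' x' \<epsilon>' q
    assume k: "(V, x, \<epsilon>) \<in> charts N" "(V', x', \<epsilon>') \<in> charts M" "q \<in> V" "?g q \<in> V'"
    have fg: "f (?g r) = r" if "r \<in> V" for r
      using F(2) chart_facts(4)[OF N k(1)] that by (auto simp: bij_betw_inv_into_right)
    have fgq: "f (?g q) \<in> V" using fg k(3) by simp
    have e: "\<epsilon> * \<epsilon> = 1" "\<epsilon>' * \<epsilon>' = 1" using chart_facts(3)[OF N k(1)] chart_facts(3)[OF M k(2)] by auto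
    let ?J = "jacobian (mdim N) (x' \<circ> ?g \<circ> inv_into V x) (x q)"
    have "sgn (jacobian (mdim M) (x \<circ> f \<circ> inv_into V' x') (x' (?g q))) = \<epsilon>' * \<epsilon>"
      by (rule orientation_preservingD[OF F(5) k(2,1,4) fgq])
    moreover have "jacobian (mdim N) (x \<circ> f \<circ> inv_into V' x') (x' (?g q)) * ?J = 1"
      using coordinate_chain_rule[OF N M N F(4,3) F(1) k(1,2,1) k(3,4) fgq]
        jacobian_chart_id[OF N k(1,3), of "\<lambda>q. f (?g q)"] fg by simp
    ultimately have "(\<epsilon>' * \<epsilon>) * sgn ?J = 1" using F(1) by (metis sgn_mult sgn_one)
    then have "(\<epsilon> * \<epsilon>') * ((\<epsilon>' * \<epsilon>) * sgn ?J) = \<epsilon> * \<epsilon>'" by simp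
    also have "(\<epsilon> * \<epsilon>') * ((\<epsilon>' * \<epsilon>) * sgn ?J) = (\<epsilon> * \<epsilon>) * (\<epsilon>' * \<epsilon>') * sgn ?J" by (simp add: mult_ac)
    finally show "sgn ?J = \<epsilon> * \<epsilon>'" using e by simp
  qed
qed

lemma Dpsh_Rs: "Rs (Dpsh M N) a b f \<phi> = compose a \<phi> f"
  by (simp add: Dpsh_def)

lemma Dpsh_iff:
  assumes "oriented_manifold M" "oriented_manifold N" "c \<in> Ob Cart"
  shows "\<phi> \<in> El (Dpsh M N) c \<longleftrightarrow> \<phi> \<in> c \<rightarrow>\<^sub>E (points M \<rightarrow>\<^sub>E points N) \<and> smooth_param c M N \<phi>
    \<and> (\<forall>s\<in>c. op_diffeo M N (\<phi> s)) \<and> smooth_param c N M (\<lambda>s. inv_into (points M) (\<phi> s))"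
  using assms by (simp add: Dpsh_def smooth_family_iff_param)

text \<open>The smoothness of pointwise inverses is that of the composite in the opposite order.\<close>

lemma D_comp_closed:
  assumes o: "oriented_manifold M" "oriented_manifold N" "oriented_manifold K" and c: "c \<in> Ob Cart"
    and \<phi>: "\<phi> \<in> El (Dpsh N M) c" and \<psi>: "\<psi> \<in> El (Dpsh K N) c"
  shows "D_comp K c \<phi> \<psi> \<in> El (Dpsh K M) c"
proof -
  let ?\<omega> = "D_comp K c \<phi> \<psi>"
  note P = \<phi>[unfolded Dpsh_iff[OF o(2,1) c]] and Q = \<psi>[unfolded Dpsh_iff[OF o(3,2) c]]
  have eq: "?\<omega> s p = \<phi> s (\<psi> s p)" if "s \<in> c" "p \<in> points K" for s p
    using that by (simp add: D_comp_def compose_def)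
  have op: "op_diffeo K M (?\<omega> s)" if s: "s \<in> c" for s
    by (rule op_diffeo_cong[OF o(3,1) op_diffeo_compose[OF o(3,2,1), of "\<psi> s" "\<phi> s"]])
      (use P Q s eq in auto)
  have ext: "?\<omega> \<in> c \<rightarrow>\<^sub>E (points K \<rightarrow>\<^sub>E points M)"
    using P Q by (fastforce simp: D_comp_def compose_def PiE_iff)
  have sm: "smooth_param c K M ?\<omega>"
    by (rule smooth_param_cong[OF smooth_param_compose[of c N M \<phi> K \<psi>]]) (use P Q eq in auto)
  have "smooth_param c M K (\<lambda>s. inv_into (points K) (?\<omega> s))"
  proof (rule smooth_param_cong[OF smooth_param_compose])
    show "smooth_param c N K (\<lambda>s. inv_into (points K) (\<psi> s))" using Q by blast
    show "smooth_param c M N (\<lambda>s. inv_into (points N) (\<phi> s))" using P by blast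
    fix s p assume s: "s \<in> c" and p: "p \<in> points M"
    have F: "op_diffeo N M (\<phi> s)" and G: "op_diffeo K N (\<psi> s)" using P Q s by blast+
    have a: "inv_into (points N) (\<phi> s) p \<in> points N" by (rule smooth_map_points[OF op_diffeoD(4)[OF F] p])
    let ?b = "inv_into (points K) (\<psi> s) (inv_into (points N) (\<phi> s) p)"
    have b: "?b \<in> points K" by (rule smooth_map_points[OF op_diffeoD(4)[OF G] a])
    have "?\<omega> s ?b = p"
      using eq[OF s b] bij_betw_inv_into_right[OF op_diffeoD(2)[OF G] a]
        bij_betw_inv_into_right[OF op_diffeoD(2)[OF F] p] by simp
    then show "?b = inv_into (points K) (?\<omega> s) p"
      using bij_betw_imp_inj_on[OF op_diffeoD(2)[OF op[OF s]]] b by (intro inv_into_f_eq[symmetric])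
  qed
  then show ?thesis using op ext sm Dpsh_iff[OF o(3,1) c] by blast
qed

lemma Dpsh_restrict:
  assumes o: "oriented_manifold M" "oriented_manifold N" and ab: "a \<in> Ob Cart" "b \<in> Ob Cart"
    and f: "f \<in> Ar Cart a b" and \<phi>: "\<phi> \<in> El (Dpsh M N) b"
  shows "Rs (Dpsh M N) a b f \<phi> \<in> El (Dpsh M N) a"
proof -
  note P = \<phi>[unfolded Dpsh_iff[OF o ab(2)]]
  have R: "Rs (Dpsh M N) a b f \<phi> = (\<lambda>s\<in>a. \<phi> (f s))" by (simp add: Dpsh_def compose_def)
  have fs: "smooth_sub a b f" using f by (simp add: Cart_Ar_iff)
  then have fa: "f s \<in> b" if "s \<in> a" for s using that by (rule smooth_sub_maps)
  have "smooth_param a M N (\<lambda>s\<in>a. \<phi> (f s))"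
    by (rule smooth_param_cong[OF smooth_param_restrict[OF _ fs, of M N \<phi>]]) (use P in auto)
  moreover have "smooth_param a N M (\<lambda>s. inv_into (points M) ((\<lambda>s\<in>a. \<phi> (f s)) s))"
    by (rule smooth_param_cong[OF smooth_param_restrict[OF _ fs, of N M "\<lambda>s. inv_into (points M) (\<phi> s)"]])
      (use P in auto)
  moreover have "(\<lambda>s\<in>a. \<phi> (f s)) \<in> a \<rightarrow>\<^sub>E (points M \<rightarrow>\<^sub>E points N)" using P fa by auto
  ultimately show ?thesis using P fa unfolding R Dpsh_iff[OF o ab(1)] by auto
qed

definition D_const :: "'p omfd \<Rightarrow> pt set \<Rightarrow> ('p \<Rightarrow> 'p) \<Rightarrow> pt \<Rightarrow> 'p \<Rightarrow> 'p" where
  "D_const M c h = (\<lambda>s\<in>c. \<lambda>p\<in>points M. h p)"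

lemma D_const_in:
  assumes M: "oriented_manifold M" and N: "oriented_manifold N" and c: "c \<in> Ob Cart" and h: "op_diffeo M N h"
  shows "D_const M c h \<in> El (Dpsh M N) c"
proof -
  note D = op_diffeoD[OF h]
  have "smooth_param c M N (D_const M c h)"
    by (rule smooth_param_cong[OF smooth_map_param[OF M N D(3)]]) (simp add: D_const_def)
  moreover have "smooth_param c N M (\<lambda>s. inv_into (points M) (D_const M c h s))"
    by (rule smooth_param_cong[OF smooth_map_param[OF N M D(4)]])
      (simp add: D_const_def, rule inv_into_cong, simp)
  moreover have "D_const M c h \<in> c \<rightarrow>\<^sub>E (points M \<rightarrow>\<^sub>E points N)"
    using smooth_map_points[OF D(3)] by (auto simp: D_const_def)
  moreover have "op_diffeo M N (D_const M c h s)" if "s \<in> c" for s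
    by (rule op_diffeo_cong[OF M N h]) (simp add: D_const_def that)
  ultimately show ?thesis unfolding Dpsh_iff[OF M N c] by blast
qed

lemma D_const_restrict:
  "f \<in> Ar Cart a b \<Longrightarrow> compose a (D_const M b h) f = D_const M a h"
  by (auto simp: D_const_def compose_def Cart_Ar_iff fun_eq_iff)

lemma D_id_const: "D_id M c = D_const M c (\<lambda>p. p)"
  by (simp add: D_id_def D_const_def)

lemma D_comp_restrict:
  "f \<in> Ar Cart a b \<Longrightarrow> compose a (D_comp K b \<phi> \<psi>) f = D_comp K a (compose a \<phi> f) (compose a \<psi> f)"
  by (auto simp: D_comp_def compose_def Cart_Ar_iff fun_eq_iff)

lemma D_El_ext:
  assumes "\<phi> \<in> El (Dpsh M N) c"
  shows "\<And>s p. s \<in> c \<Longrightarrow> p \<in> points M \<Longrightarrow> \<phi> s p \<in> points N" "\<phi> \<in> extensional c"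
    "\<And>s. s \<in> c \<Longrightarrow> \<phi> s \<in> extensional (points M)"
  using assms by (auto simp: Dpsh_def PiE_iff)

lemma D_comp_assoc:
  assumes "\<omega> \<in> El (Dpsh L K) c"
  shows "D_comp L c (D_comp K c \<phi> \<psi>) \<omega> = D_comp L c \<phi> (D_comp L c \<psi> \<omega>)"
  using D_El_ext(1)[OF assms] by (auto simp: D_comp_def compose_def fun_eq_iff)

lemma D_comp_id:
  assumes "\<phi> \<in> El (Dpsh M N) c"
  shows "D_comp M c \<phi> (D_id M c) = \<phi>" "D_comp M c (D_id N c) \<phi> = \<phi>"
proof -
  note e = D_El_ext[OF assms]
  have "\<phi> s = undefined" if "s \<notin> c" for s using e(2) that by (simp add: extensional_def)
  moreover have "\<phi> s p = undefined" if "s \<in> c" "p \<notin> points M" for s p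
    using e(3)[OF that(1)] that(2) by (simp add: extensional_def)
  ultimately show "D_comp M c \<phi> (D_id M c) = \<phi>" "D_comp M c (D_id N c) \<phi> = \<phi>"
    using e(1) by (auto simp: D_comp_def D_id_def compose_def fun_eq_iff)
qed

lemma D_comp_const:
  assumes "\<And>p. p \<in> points M \<Longrightarrow> h p \<in> points N"
  shows "D_comp M c (D_const N c g) (D_const M c h) = D_const M c (\<lambda>p. g (h p))"
  using assms by (auto simp: D_comp_def D_const_def compose_def fun_eq_iff)

lemma D_const_cong: "(\<And>p. p \<in> points M \<Longrightarrow> h p = g p) \<Longrightarrow> D_const M c h = D_const M c g"
  by (auto simp: D_const_def fun_eq_iff)

section \<open>Small sets\<close>

text \<open>The closure properties of a universe, expressed through the sets that belong to it and
  without reference to the membership relation of the model.\<close>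

locale set_universe =
  fixes U :: "'V set set"
  assumes subset_closed: "B \<in> U \<Longrightarrow> A \<subseteq> B \<Longrightarrow> A \<in> U"
    and small_Pow_member: "B \<in> U \<Longrightarrow> small U (Pow B)"
    and UN_closed: "B \<in> U \<Longrightarrow> (\<And>b. b \<in> B \<Longrightarrow> X b \<in> U) \<Longrightarrow> (\<Union>b\<in>B. X b) \<in> U"
    and infinite_member: "\<exists>B\<in>U. infinite B"

lemma set_universe_sets_in:
  assumes Z: "zfc_model elts" and G: "grothendieck_universe elts u"
  shows "set_universe (sets_in elts u)"
proof
  have inj: "inj elts" and sep: "\<And>x A. A \<subseteq> elts x \<Longrightarrow> \<exists>y. elts y = A"
    using Z by (auto simp: zfc_model_def)
  note G = G[unfolded grothendieck_universe_def]
  have tr: "y \<in> elts u" if "x \<in> elts u" "y \<in> elts x" for x y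
    using G[THEN conjunct1] that by blast
  have pow: "\<exists>y\<in>elts u. elts y = {z. elts z \<subseteq> elts x}" if "x \<in> elts u" for x
    using G[THEN conjunct2, THEN conjunct2, THEN conjunct1] that by blast
  have un: "\<exists>y\<in>elts u. elts y = (\<Union>i\<in>elts x. elts (f i))" if "x \<in> elts u" "f ` elts x \<subseteq> elts u" for x f
    using G[THEN conjunct2, THEN conjunct2, THEN conjunct2, THEN conjunct1, rule_format, OF that] .
  have inf: "\<exists>x\<in>elts u. infinite (elts x)" using G by (elim conjE)
  show "A \<in> sets_in elts u" if B: "B \<in> sets_in elts u" and A: "A \<subseteq> B" for A B
  proof -
    obtain x where x: "x \<in> elts u" "B = elts x" using B by (auto simp: sets_in_def)
    obtain y where y: "elts y = A" using sep A x by blast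
    obtain p where "p \<in> elts u" "elts p = {z. elts z \<subseteq> elts x}" using pow x by blast
    then have "y \<in> elts u" using tr y A x by blast
    then show ?thesis using y by (auto simp: sets_in_def)
  qed
  show "small (sets_in elts u) (Pow B)" if B: "B \<in> sets_in elts u" for B
  proof -
    obtain x where x: "x \<in> elts u" "B = elts x" using B by (auto simp: sets_in_def)
    obtain p where p: "p \<in> elts u" "elts p = {z. elts z \<subseteq> elts x}" using pow x by blast
    have "elts ` elts p = Pow B"
    proof
      show "elts ` elts p \<subseteq> Pow B" using p(2) x(2) by auto
      show "Pow B \<subseteq> elts ` elts p"
      proof
        fix A assume "A \<in> Pow B"
        then obtain y where "elts y = A" "A \<subseteq> elts x" using sep[of A x] x(2) by auto
        then show "A \<in> elts ` elts p" using p(2) by auto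
      qed
    qed
    then have "bij_betw elts (elts p) (Pow B)" using inj_on_subset[OF inj] by (simp add: bij_betw_def)
    then have "bij_betw (inv_into (elts p) elts) (Pow B) (elts p)" by (rule bij_betw_inv_into)
    then show ?thesis using p(1) by (auto simp: small_def sets_in_def)
  qed
  show "(\<Union>b\<in>B. X b) \<in> sets_in elts u"
    if B: "B \<in> sets_in elts u" and X: "\<And>b. b \<in> B \<Longrightarrow> X b \<in> sets_in elts u" for B X
  proof -
    obtain x where x: "x \<in> elts u" "B = elts x" using B by (auto simp: sets_in_def)
    have "\<forall>b\<in>B. \<exists>y. y \<in> elts u \<and> X b = elts y" using X by (auto simp: sets_in_def)
    from bchoice[OF this] obtain f where f: "\<forall>b\<in>B. f b \<in> elts u \<and> X b = elts (f b)" by blast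
    then have "f ` elts x \<subseteq> elts u" using x by blast
    from un[OF x(1) this] obtain y where y: "y \<in> elts u" "elts y = (\<Union>i\<in>elts x. elts (f i))" by blast
    have "(\<Union>b\<in>B. X b) = elts y" using f x y by auto
    then show ?thesis using y(1) unfolding sets_in_def by (rule image_eqI)
  qed
  show "\<exists>B\<in>sets_in elts u. infinite B" using inf by (auto simp: sets_in_def)
qed

lemma sets_in_mono:
  assumes "grothendieck_universe elts L" "S \<in> elts L"
  shows "sets_in elts S \<subseteq> sets_in elts L"
proof -
  have "elts S \<subseteq> elts L" using assms(2) assms(1)[unfolded grothendieck_universe_def, THEN conjunct1] by blast
  then show ?thesis by (auto simp: sets_in_def)
qed

lemma small_mono: "U \<subseteq> U' \<Longrightarrow> small U A \<Longrightarrow> small U' A"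
  unfolding small_def by blast

context set_universe
begin

text \<open>Subsets of members are members, so that injections suffice for smallness.\<close>

lemma small_iff: "small U A \<longleftrightarrow> (\<exists>B\<in>U. \<exists>f. inj_on f A \<and> f ` A \<subseteq> B)"
proof
  assume "\<exists>B\<in>U. \<exists>f. inj_on f A \<and> f ` A \<subseteq> B"
  then obtain B f where "B \<in> U" "inj_on f A" "f ` A \<subseteq> B" by blast
  then have "f ` A \<in> U" "bij_betw f A (f ` A)" using subset_closed by (auto simp: bij_betw_def)
  then show "small U A" unfolding small_def by blast
next
  assume "small U A"
  then obtain B f where "B \<in> U" "bij_betw f A B" by (auto simp: small_def)
  then show "\<exists>B\<in>U. \<exists>f. inj_on f A \<and> f ` A \<subseteq> B"
    by (intro bexI[of _ B] exI[of _ f]) (auto simp: bij_betw_def)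
qed

lemma small_member: "B \<in> U \<Longrightarrow> small U B"
  unfolding small_iff by (intro bexI[of _ B] exI[of _ "\<lambda>x. x"]) auto

lemma small_inj: "small U B \<Longrightarrow> inj_on f A \<Longrightarrow> f ` A \<subseteq> B \<Longrightarrow> small U A"
proof -
  assume B: "small U B" and f: "inj_on f A" "f ` A \<subseteq> B"
  obtain C g where g: "C \<in> U" "inj_on g B" "g ` B \<subseteq> C" using B unfolding small_iff by blast
  have "inj_on (g \<circ> f) A" using f g inj_on_subset by (blast intro: comp_inj_on)
  moreover have "(g \<circ> f) ` A \<subseteq> C" using f g by auto
  ultimately show ?thesis using g(1) unfolding small_iff by blast
qed

lemma small_subset: "small U B \<Longrightarrow> A \<subseteq> B \<Longrightarrow> small U A"
  by (rule small_inj[of B "\<lambda>x. x"]) auto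

lemma small_Pow: assumes "small U A" shows "small U (Pow A)"
proof -
  obtain B f where f: "B \<in> U" "inj_on f A" "f ` A \<subseteq> B" using assms unfolding small_iff by blast
  show ?thesis
    by (rule small_inj[OF small_Pow_member[OF f(1)], of "image f"])
      (use f(2) inj_on_image_Pow in blast, use f(3) in blast)
qed

lemma small_nat: "small U (A :: nat set)"
proof -
  obtain B where B: "B \<in> U" "infinite B" using infinite_member by blast
  obtain f :: "nat \<Rightarrow> 'V" where "inj f" "range f \<subseteq> B" using infinite_countable_subset[OF B(2)] by blast
  then have "small U (UNIV :: nat set)" using B(1) unfolding small_iff by blast
  then show ?thesis by (rule small_subset) simp
qed

lemma UN_small: assumes "small U I" "\<And>i. i \<in> I \<Longrightarrow> X i \<in> U" shows "(\<Union>i\<in>I. X i) \<in> U"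
proof -
  obtain B f where f: "B \<in> U" "bij_betw f I B" using assms(1) unfolding small_def by blast
  have "(\<Union>b\<in>B. X (inv_into I f b)) \<in> U"
    using f by (intro UN_closed assms(2)) (auto simp: bij_betw_def inv_into_into)
  moreover have "(\<Union>b\<in>B. X (inv_into I f b)) = (\<Union>i\<in>I. X i)"
    using f by (auto simp: bij_betw_def inv_into_into intro!: bexI[of _ "f _"])
  ultimately show ?thesis by simp
qed

text \<open>Instead of encoding pairs in the model, embed both factors into one infinite member \<open>E\<close> and
  use that \<open>E \<times> E\<close> and \<open>E\<close> have the same cardinality.\<close>

lemma small_Times: assumes "small U A" "small U B" shows "small U (A \<times> B)"
proof -
  obtain C f where f: "C \<in> U" "inj_on f A" "f ` A \<subseteq> C" using assms(1) unfolding small_iff by blast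
  obtain D g where g: "D \<in> U" "inj_on g B" "g ` B \<subseteq> D" using assms(2) unfolding small_iff by blast
  obtain I where I: "I \<in> U" "infinite I" using infinite_member by blast
  let ?X = "\<lambda>n::nat. if n = 0 then C else if n = 1 then D else I"
  have "(\<Union>n\<in>{0,1,2}. ?X n) \<in> U" by (rule UN_small[OF small_nat]) (use f g I in auto)
  moreover have "(\<Union>n\<in>{0,1,2}. ?X n) = C \<union> D \<union> I" by auto
  ultimately have E: "C \<union> D \<union> I \<in> U" by simp
  (* I makes E infinite. *)
  define E where "E = C \<union> D \<union> I"
  have "infinite E" using I by (simp add: E_def)
  from card_of_Times_same_infinite[OF this] obtain h where h: "bij_betw h (E \<times> E) E" using card_of_ordIso by blast
  have "small U (E \<times> E)" unfolding small_def using h E by (auto simp: E_def)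
  then show ?thesis
    by (rule small_inj[of _ "map_prod f g"]) (use f g in \<open>auto simp: E_def intro: map_prod_inj_on\<close>)
qed

lemma small_UN:
  assumes I: "small U I" and X: "\<And>i. i \<in> I \<Longrightarrow> small U (X i)"
  shows "small U (\<Union>i\<in>I. X i)"
proof -
  have "\<forall>i\<in>I. \<exists>p. fst p \<in> U \<and> inj_on (snd p) (X i) \<and> snd p ` X i \<subseteq> fst p"
  proof
    fix i assume "i \<in> I"
    then obtain B f where "B \<in> U" "inj_on f (X i)" "f ` X i \<subseteq> B" using X[of i] unfolding small_iff by blast
    then show "\<exists>p. fst p \<in> U \<and> inj_on (snd p) (X i) \<and> snd p ` X i \<subseteq> fst p"
      by (intro exI[of _ "(B, f)"]) simp
  qed
  from bchoice[OF this] obtain p where p: "\<And>i. i \<in> I \<Longrightarrow> fst (p i) \<in> U"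
    "\<And>i. i \<in> I \<Longrightarrow> inj_on (snd (p i)) (X i)" "\<And>i. i \<in> I \<Longrightarrow> snd (p i) ` X i \<subseteq> fst (p i)" by blast
  have B: "small U (I \<times> (\<Union>i\<in>I. fst (p i)))" by (intro small_Times I small_member UN_small p)
  (* An element of the union is encoded by an index and its code in the set with that index. *)
  define j where "j x = (SOME i. i \<in> I \<and> x \<in> X i)" for x
  have j: "j x \<in> I \<and> x \<in> X (j x)" if "x \<in> (\<Union>i\<in>I. X i)" for x
  proof -
    have "\<exists>i. i \<in> I \<and> x \<in> X i" using that by blast
    then show ?thesis unfolding j_def by (rule someI_ex)
  qed
  show ?thesis
  proof (rule small_inj[OF B, of "\<lambda>x. (j x, snd (p (j x)) x)"])
    show "inj_on (\<lambda>x. (j x, snd (p (j x)) x)) (\<Union>i\<in>I. X i)"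
    proof (rule inj_onI)
      fix x y assume x: "x \<in> (\<Union>i\<in>I. X i)" and y: "y \<in> (\<Union>i\<in>I. X i)"
        and e: "(j x, snd (p (j x)) x) = (j y, snd (p (j y)) y)"
      then have "y \<in> X (j x)" "snd (p (j x)) x = snd (p (j x)) y" using j[OF y] by auto
      with inj_onD[OF p(2)[of "j x"], of x y] j[OF x] show "x = y" by blast
    qed
    show "(\<lambda>x. (j x, snd (p (j x)) x)) ` (\<Union>i\<in>I. X i) \<subseteq> I \<times> (\<Union>i\<in>I. fst (p i))"
      using j p(3) by blast
  qed
qed

text \<open>A function is determined by its graph.\<close>

lemma small_PiE:
  assumes I: "small U I" and X: "\<And>i. i \<in> I \<Longrightarrow> small U (X i)"
  shows "small U (Pi\<^sub>E I X)"
proof (rule small_inj[where f = "\<lambda>f. (\<lambda>i. (i, f i)) ` I"])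
  show "small U (Pow (I \<times> (\<Union>i\<in>I. X i)))" by (intro small_Pow small_Times small_UN I X)
  show "inj_on (\<lambda>f. (\<lambda>i. (i, f i)) ` I) (Pi\<^sub>E I X)"
  proof (rule inj_onI)
    fix f g assume f: "f \<in> Pi\<^sub>E I X" and g: "g \<in> Pi\<^sub>E I X" and e: "(\<lambda>i. (i, f i)) ` I = (\<lambda>i. (i, g i)) ` I"
    have "f i = g i" if "i \<in> I" for i using e that by blast
    then show "f = g" using f g by (intro PiE_ext)
  qed
qed auto

lemma small_fun:
  assumes "small U (UNIV :: 'a set)" "small U (UNIV :: 'b set)"
  shows "small U (A :: ('a \<Rightarrow> 'b) set)"
  by (rule small_subset[OF small_PiE[OF assms(1), of "\<lambda>_. UNIV"]]) (use assms in auto)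

lemma small_set:
  assumes "small U (UNIV :: 'a set)" shows "small U (A :: 'a set set)"
  using small_subset[OF small_Pow[OF assms]] by simp

lemma small_prod:
  assumes "small U (UNIV :: 'a set)" "small U (UNIV :: 'b set)"
  shows "small U (A :: ('a \<times> 'b) set)"
  by (rule small_subset[OF small_Times[OF assms]]) simp

lemma small_list:
  assumes "small U (UNIV :: 'a set)" shows "small U (A :: 'a list set)"
proof (rule small_inj[of _ "\<lambda>xs. (length xs, (\<lambda>i. if i < length xs then xs ! i else undefined))"])
  show "small U (UNIV :: (nat \<times> (nat \<Rightarrow> 'a)) set)" by (intro small_prod small_fun small_nat assms)
  show "inj_on (\<lambda>xs. (length xs, (\<lambda>i. if i < length xs then xs ! i else undefined))) A"
  proof (intro inj_onI nth_equalityI)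
    fix x y :: "'a list" and i
    assume e: "(length x, (\<lambda>i. if i < length x then x ! i else undefined))
      = (length y, (\<lambda>i. if i < length y then y ! i else undefined))"
    then show "length x = length y" by simp
    assume "i < length x"
    then show "x ! i = y ! i" using fun_cong[OF e[THEN arg_cong[where f = snd], unfolded snd_conv], of i] e by simp
  qed
qed auto

text \<open>A real number is determined by the set of rational numbers below it.\<close>

lemma small_real: "small U (A :: real set)"
proof (rule small_inj[of _ "\<lambda>x. {n. real_of_rat (nat_to_rat_surj n) < x}"])
  show "small U (UNIV :: nat set set)" by (intro small_set small_nat)
  show "inj_on (\<lambda>x. {n. real_of_rat (nat_to_rat_surj n) < x}) A"
  proof (rule inj_onI, rule ccontr)
    have key: "{n. real_of_rat (nat_to_rat_surj n) < x} \<noteq> {n. real_of_rat (nat_to_rat_surj n) < y}"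
      if "x < y" for x y
    proof -
      obtain q where q: "x < of_rat q" "of_rat q < y" using of_rat_dense[OF \<open>x < y\<close>] by blast
      obtain n where "q = nat_to_rat_surj n" using surj_nat_to_rat_surj by blast
      then show ?thesis using q by (auto simp: set_eq_iff intro!: exI[of _ n])
    qed
    fix x y assume "{n. real_of_rat (nat_to_rat_surj n) < x} = {n. real_of_rat (nat_to_rat_surj n) < y}" "x \<noteq> y"
    then show False using key[of x y] key[of y x] by (cases x y rule: linorder_cases) auto
  qed
qed auto

lemma small_pt: "small U (A :: pt set)"
  by (intro small_fun small_nat small_real)

lemma small_omfd:
  assumes "small U (UNIV :: 'p set)" shows "small U (A :: 'p omfd set)"
proof (rule small_inj[of _ "\<lambda>M. (mdim M, charts M)"])
  show "small U (UNIV :: (nat \<times> 'p ochart set) set)"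
    by (intro small_prod small_set small_fun small_nat small_real small_pt assms)
qed (auto intro: inj_onI)

end

section \<open>Homotopy retracts of presheaves and mapping spaces\<close>

locale category =
  fixes C :: "('o, 'm) cat"
  assumes Ide_in: "a \<in> Ob C \<Longrightarrow> Ide C a \<in> Ar C a a"
    and Cmp_in: "a \<in> Ob C \<Longrightarrow> b \<in> Ob C \<Longrightarrow> c \<in> Ob C \<Longrightarrow> f \<in> Ar C a b \<Longrightarrow> g \<in> Ar C b c
      \<Longrightarrow> Cmp C a b c g f \<in> Ar C a c"
    and Cmp_Ide_right: "a \<in> Ob C \<Longrightarrow> b \<in> Ob C \<Longrightarrow> f \<in> Ar C a b \<Longrightarrow> Cmp C a a b f (Ide C a) = f"
    and Cmp_Ide_left: "a \<in> Ob C \<Longrightarrow> b \<in> Ob C \<Longrightarrow> f \<in> Ar C a b \<Longrightarrow> Cmp C a b b (Ide C b) f = f"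
    and Cmp_assoc: "a \<in> Ob C \<Longrightarrow> b \<in> Ob C \<Longrightarrow> c \<in> Ob C \<Longrightarrow> d \<in> Ob C \<Longrightarrow> f \<in> Ar C a b \<Longrightarrow> g \<in> Ar C b c
      \<Longrightarrow> h \<in> Ar C c d \<Longrightarrow> Cmp C a b d (Cmp C b c d h g) f = Cmp C a c d h (Cmp C a b c g f)"

lemma category_Simp: "category Simp"
proof
  fix a b c :: nat and f g :: "nat \<Rightarrow> nat"
  assume f: "f \<in> Ar Simp a b" and g: "g \<in> Ar Simp b c"
  then have m: "\<And>i j. i \<le> j \<Longrightarrow> j \<le> a \<Longrightarrow> f i \<le> f j" "\<And>i j. i \<le> j \<Longrightarrow> j \<le> b \<Longrightarrow> g i \<le> g j"
    and r: "\<And>i. i \<le> a \<Longrightarrow> f i \<le> b" "\<And>i. i \<le> b \<Longrightarrow> g i \<le> c"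
    by (auto simp: Simp_def mono_on_def)
  show "Cmp Simp a b c g f \<in> Ar Simp a c"
    unfolding Simp_def by (auto simp: compose_def mono_on_def m r)
next
  fix a b f assume "f \<in> Ar Simp a b"
  then have "f \<in> {..a} \<rightarrow>\<^sub>E {..b}" by (simp add: Simp_def)
  then show "Cmp Simp a a b f (Ide Simp a) = f" "Cmp Simp a b b (Ide Simp b) f = f"
    by (auto simp: Simp_def compose_def fun_eq_iff PiE_iff extensional_def)
qed (auto simp: Simp_def compose_def fun_eq_iff mono_on_def)

interpretation Simp: category Simp by (rule category_Simp)

lemma Ob_Simp [simp]: "Ob Simp = UNIV"
  by (simp add: Simp_def)

lemma Simp_ArD:
  assumes "\<theta> \<in> Ar Simp l k"
  shows "\<And>j. j \<le> l \<Longrightarrow> \<theta> j \<le> k" "\<And>i j. i \<le> j \<Longrightarrow> j \<le> l \<Longrightarrow> \<theta> i \<le> \<theta> j"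
  using assms by (auto simp: Simp_def mono_on_def)

lemma category_Cart: "category Cart"
proof
  show "Ide Cart a \<in> Ar Cart a a" if "a \<in> Ob Cart" for a by (rule Cart_Ide[OF that])
  show "Cmp Cart a b c g f \<in> Ar Cart a c" if "f \<in> Ar Cart a b" "g \<in> Ar Cart b c" for a b c f g
    by (rule Cart_Cmp[OF that])
qed (auto simp: Cart_def compose_def fun_eq_iff PiE_iff extensional_def)

interpretation Cart: category Cart by (rule category_Cart)

lemma category_SimpN: "category (SimpN n)"
proof
  fix a b f assume a: "a \<in> Ob (SimpN n)" and f: "f \<in> Ar (SimpN n) a b"
  then show "Cmp (SimpN n) a a b f (Ide (SimpN n) a) = f" "Cmp (SimpN n) a b b (Ide (SimpN n) b) f = f"
    if "b \<in> Ob (SimpN n)"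
    using that by (auto simp: SimpN_def intro!: nth_equalityI Simp.Cmp_Ide_right Simp.Cmp_Ide_left)
qed (auto simp: SimpN_def intro!: Simp.Ide_in Simp.Cmp_in Simp.Cmp_assoc)

lemma category_cat_prod: assumes "category C" "category D" shows "category (cat_prod C D)"
proof -
  interpret C: category C by fact
  interpret D: category D by fact
  show ?thesis
    by unfold_locales (auto simp: cat_prod_def C.Ide_in D.Ide_in C.Cmp_in D.Cmp_in C.Cmp_Ide_right D.Cmp_Ide_right
        C.Cmp_Ide_left D.Cmp_Ide_left C.Cmp_assoc D.Cmp_assoc)
qed

abbreviation CartS :: "(pt set \<times> nat, (pt \<Rightarrow> pt) \<times> (nat \<Rightarrow> nat)) cat" where
  "CartS \<equiv> cat_prod Cart Simp"

lemma cat_prod_simps [simp]: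
  "Ob (cat_prod C D) = Ob C \<times> Ob D"
  "Ar (cat_prod C D) (a, a') (b, b') = Ar C a b \<times> Ar D a' b'"
  "Ide (cat_prod C D) (a, a') = (Ide C a, Ide D a')"
  "Cmp (cat_prod C D) (a, a') (b, b') (c, c') (g, g') (f, f') = (Cmp C a b c g f, Cmp D a' b' c' g' f')"
  by (simp_all add: cat_prod_def)

text \<open>Several constructions below only need that restriction maps are well defined. Not asking
  for functoriality saves the verification of the simplicial identities in the bar construction.\<close>

definition rs_closed :: "('o, 'm) cat \<Rightarrow> ('o, 'm, 'e) psh \<Rightarrow> bool" where
  "rs_closed C X \<longleftrightarrow> (\<forall>a\<in>Ob C. \<forall>b\<in>Ob C. \<forall>f\<in>Ar C a b. \<forall>x\<in>El X b. Rs X a b f x \<in> El X a)"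

lemma rs_closedD:
  "rs_closed C X \<Longrightarrow> a \<in> Ob C \<Longrightarrow> b \<in> Ob C \<Longrightarrow> f \<in> Ar C a b \<Longrightarrow> x \<in> El X b \<Longrightarrow> Rs X a b f x \<in> El X a"
  by (simp add: rs_closed_def)

lemma presheaf_rs_closed: "presheaf C X \<Longrightarrow> rs_closed C X"
  by (auto simp: presheaf_def rs_closed_def)

lemma presheafD:
  assumes "presheaf C X"
  shows "\<And>a b f x. a \<in> Ob C \<Longrightarrow> b \<in> Ob C \<Longrightarrow> f \<in> Ar C a b \<Longrightarrow> x \<in> El X b \<Longrightarrow> Rs X a b f x \<in> El X a"
    "\<And>a x. a \<in> Ob C \<Longrightarrow> x \<in> El X a \<Longrightarrow> Rs X a a (Ide C a) x = x"
    "\<And>a b c f g x. a \<in> Ob C \<Longrightarrow> b \<in> Ob C \<Longrightarrow> c \<in> Ob C \<Longrightarrow> f \<in> Ar C a b \<Longrightarrow> g \<in> Ar C b c \<Longrightarrow> x \<in> El X c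
      \<Longrightarrow> Rs X a c (Cmp C a b c g f) x = Rs X a b f (Rs X b c g x)"
  using assms unfolding presheaf_def by (auto simp: Pi_iff)

lemma NatD:
  assumes "\<eta> \<in> Nat C X Y"
  shows "\<And>a x. a \<in> Ob C \<Longrightarrow> x \<in> El X a \<Longrightarrow> \<eta> a x \<in> El Y a"
    "\<And>a b f x. a \<in> Ob C \<Longrightarrow> b \<in> Ob C \<Longrightarrow> f \<in> Ar C a b \<Longrightarrow> x \<in> El X b \<Longrightarrow> \<eta> a (Rs X a b f x) = Rs Y a b f (\<eta> b x)"
  using assms unfolding Nat_def by (auto simp: PiE_iff Pi_iff)

lemma Nat_ext:
  assumes "\<eta> \<in> Nat C X Y" "\<theta> \<in> Nat C X Z" "\<And>a x. a \<in> Ob C \<Longrightarrow> x \<in> El X a \<Longrightarrow> \<eta> a x = \<theta> a x"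
  shows "\<eta> = \<theta>"
proof
  fix a show "\<eta> a = \<theta> a"
  proof (cases "a \<in> Ob C")
    case True
    then have "\<eta> a \<in> extensional (El X a)" "\<theta> a \<in> extensional (El X a)"
      using assms(1,2) by (auto simp: Nat_def PiE_iff)
    then show ?thesis using assms(3)[OF True] by (rule extensionalityI)
  next
    case False
    then show ?thesis using assms(1,2) by (auto simp: Nat_def PiE_iff extensional_def)
  qed
qed

lemma NatI:
  assumes "rs_closed C X" "\<And>a x. a \<in> Ob C \<Longrightarrow> x \<in> El X a \<Longrightarrow> F a x \<in> El Y a"
    "\<And>a b f x. a \<in> Ob C \<Longrightarrow> b \<in> Ob C \<Longrightarrow> f \<in> Ar C a b \<Longrightarrow> x \<in> El X b \<Longrightarrow> F a (Rs X a b f x) = Rs Y a b f (F b x)"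
  shows "(\<lambda>a\<in>Ob C. \<lambda>x\<in>El X a. F a x) \<in> Nat C X Y"
  using assms unfolding Nat_def by (auto simp: rs_closed_def)

lemma psh_prod_simps [simp]:
  "El (psh_prod X Y) a = El X a \<times> El Y a"
  "Rs (psh_prod X Y) a b f (x, y) = (Rs X a b f x, Rs Y a b f y)"
  by (simp_all add: psh_prod_def)

lemma simplex_over_simps [simp]:
  "El (simplex_over dO dA k) a = Ar Simp (dO a) k"
  "Rs (simplex_over dO dA k) a b f g = Cmp Simp (dO a) (dO b) k g (dA f)"
  by (simp_all add: simplex_over_def)

text \<open>The degenerate simplex of the standard \<open>1\<close>-simplex at the vertex \<open>j\<close>; a homotopy restricts to its two
  ends along \<open>vtx m 0\<close> and \<open>vtx m 1\<close>.\<close>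

definition vtx :: "nat \<Rightarrow> nat \<Rightarrow> nat \<Rightarrow> nat" where
  "vtx m j = (\<lambda>i\<in>{..m}. j)"

lemma vtx_in: "j \<le> k \<Longrightarrow> vtx m j \<in> Ar Simp m k"
  by (auto simp: vtx_def Simp_def mono_on_def)

lemma Cmp_vtx: "\<theta> \<in> Ar Simp l m \<Longrightarrow> Cmp Simp l m k (vtx m j) \<theta> = vtx l j"
  by (auto simp: vtx_def Simp_def compose_def fun_eq_iff)

text \<open>The data of a projection to \<open>Simp\<close>, along which standard simplices are pulled back; so
  simplicial homotopies of presheaves make sense.\<close>

locale over_Simp = category C for C :: "('o, 'm) cat" +
  fixes dO :: "'o \<Rightarrow> nat" and dA :: "'m \<Rightarrow> nat \<Rightarrow> nat"
  assumes dA_in: "a \<in> Ob C \<Longrightarrow> b \<in> Ob C \<Longrightarrow> f \<in> Ar C a b \<Longrightarrow> dA f \<in> Ar Simp (dO a) (dO b)"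

lemma over_Simp_snd: "category D \<Longrightarrow> over_Simp (cat_prod D Simp) snd snd"
  unfolding over_Simp_def over_Simp_axioms_def
  by (auto intro: category_cat_prod category_Simp)

lemma over_Simp_self: "over_Simp Simp (\<lambda>k. k) (\<lambda>\<theta>. \<theta>)"
  unfolding over_Simp_def over_Simp_axioms_def by (auto intro: category_Simp)

context over_Simp
begin

lemma rs_closed_simplex_prod:
  assumes "rs_closed C X" shows "rs_closed C (psh_prod X (simplex_over dO dA k))"
  unfolding rs_closed_def using assms by (auto intro!: rs_closedD Simp.Cmp_in dA_in)

text \<open>\<open>A\<close> is a retract of \<open>B\<close>, and the homotopy runs from the identity of \<open>B\<close> to the composite
  \<open>i \<circ> r\<close>. The notion is self-dual: a contravariant construction exchanges the roles of \<open>i\<close> and \<open>r\<close>, and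
  keeps the direction of the homotopy.\<close>

definition homotopy_retract :: "('o, 'm, 'e) psh \<Rightarrow> ('o, 'm, 'd) psh
    \<Rightarrow> ('o \<Rightarrow> 'e \<Rightarrow> 'd) \<Rightarrow> ('o \<Rightarrow> 'd \<Rightarrow> 'e) \<Rightarrow> bool" where
  "homotopy_retract A B i r \<longleftrightarrow> rs_closed C A \<and> rs_closed C B \<and> i \<in> Nat C A B \<and> r \<in> Nat C B A
     \<and> (\<forall>a\<in>Ob C. \<forall>x\<in>El A a. r a (i a x) = x)
     \<and> (\<exists>H\<in>Nat C (psh_prod B (simplex_over dO dA 1)) B. \<forall>a\<in>Ob C. \<forall>x\<in>El B a.
          H a (x, vtx (dO a) 0) = x \<and> H a (x, vtx (dO a) 1) = i a (r a x))"

lemma homotopy_retractI: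
  assumes "rs_closed C A" "rs_closed C B" "i \<in> Nat C A B" "r \<in> Nat C B A"
    "\<And>a x. a \<in> Ob C \<Longrightarrow> x \<in> El A a \<Longrightarrow> r a (i a x) = x"
    "H \<in> Nat C (psh_prod B (simplex_over dO dA 1)) B"
    "\<And>a x. a \<in> Ob C \<Longrightarrow> x \<in> El B a \<Longrightarrow> H a (x, vtx (dO a) 0) = x"
    "\<And>a x. a \<in> Ob C \<Longrightarrow> x \<in> El B a \<Longrightarrow> H a (x, vtx (dO a) 1) = i a (r a x)"
  shows "homotopy_retract A B i r"
  using assms unfolding homotopy_retract_def by blast

lemma homotopy_retractD:
  assumes "homotopy_retract A B i r"
  shows "rs_closed C A" "rs_closed C B" "i \<in> Nat C A B" "r \<in> Nat C B A"
    "\<And>a x. a \<in> Ob C \<Longrightarrow> x \<in> El A a \<Longrightarrow> r a (i a x) = x"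
  using assms unfolding homotopy_retract_def by blast+

lemma homotopy_retract_homotopy:
  assumes "homotopy_retract A B i r"
  obtains H where "H \<in> Nat C (psh_prod B (simplex_over dO dA 1)) B"
    "\<And>a x. a \<in> Ob C \<Longrightarrow> x \<in> El B a \<Longrightarrow> H a (x, vtx (dO a) 0) = x"
    "\<And>a x. a \<in> Ob C \<Longrightarrow> x \<in> El B a \<Longrightarrow> H a (x, vtx (dO a) 1) = i a (r a x)"
proof -
  obtain H where "H \<in> Nat C (psh_prod B (simplex_over dO dA 1)) B"
    "\<forall>a\<in>Ob C. \<forall>x\<in>El B a. H a (x, vtx (dO a) 0) = x \<and> H a (x, vtx (dO a) 1) = i a (r a x)"
    using assms unfolding homotopy_retract_def by blast
  then show thesis by (intro that[of H]) auto
qed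

lemma map_space_simps:
  "El (map_space C dO dA X Y) k = Nat C (psh_prod X (simplex_over dO dA k)) Y"
  "Rs (map_space C dO dA X Y) l k \<theta> \<eta> =
     (\<lambda>a\<in>Ob C. \<lambda>(x, g)\<in>El X a \<times> Ar Simp (dO a) l. \<eta> a (x, Cmp Simp (dO a) l k \<theta> g))"
  by (simp_all add: map_space_def)

text \<open>The maps between mapping spaces that occur below, namely simplicial operators,
  precompositions and homotopies, are all of this form. The argument \<open>\<Phi>\<close> may depend on the simplex \<open>g\<close>,
  which is what homotopies require.\<close>

lemma map_space_reparam:
  assumes X: "rs_closed C X" and \<eta>: "\<eta> \<in> El (map_space C dO dA X' W) k" and \<rho>: "\<rho> \<in> Ar Simp l k"
    and \<Phi>: "\<And>a x g. a \<in> Ob C \<Longrightarrow> x \<in> El X a \<Longrightarrow> g \<in> Ar Simp (dO a) l \<Longrightarrow> \<Phi> a x g \<in> El X' a"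
    and nat: "\<And>a b f x g. a \<in> Ob C \<Longrightarrow> b \<in> Ob C \<Longrightarrow> f \<in> Ar C a b \<Longrightarrow> x \<in> El X b \<Longrightarrow> g \<in> Ar Simp (dO b) l
      \<Longrightarrow> \<Phi> a (Rs X a b f x) (Cmp Simp (dO a) (dO b) l g (dA f)) = Rs X' a b f (\<Phi> b x g)"
  shows "(\<lambda>a\<in>Ob C. \<lambda>(x, g)\<in>El X a \<times> Ar Simp (dO a) l. \<eta> a (\<Phi> a x g, Cmp Simp (dO a) l k \<rho> g))
    \<in> El (map_space C dO dA X W) l"
proof -
  note \<eta> = \<eta>[unfolded map_space_simps]
  have "(\<lambda>a\<in>Ob C. \<lambda>p\<in>El (psh_prod X (simplex_over dO dA l)) a.
      case p of (x, g) \<Rightarrow> \<eta> a (\<Phi> a x g, Cmp Simp (dO a) l k \<rho> g))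
    \<in> Nat C (psh_prod X (simplex_over dO dA l)) W"
  proof (rule NatI[OF rs_closed_simplex_prod[OF X]])
    fix a p assume "a \<in> Ob C" "p \<in> El (psh_prod X (simplex_over dO dA l)) a"
    then show "(case p of (x, g) \<Rightarrow> \<eta> a (\<Phi> a x g, Cmp Simp (dO a) l k \<rho> g)) \<in> El W a"
      using \<rho> by (auto intro!: NatD(1)[OF \<eta>] \<Phi> Simp.Cmp_in)
  next
    fix a b f p assume a: "a \<in> Ob C" "b \<in> Ob C" "f \<in> Ar C a b" and "p \<in> El (psh_prod X (simplex_over dO dA l)) b"
    then obtain x g where p: "p = (x, g)" "x \<in> El X b" "g \<in> Ar Simp (dO b) l" by auto
    have "\<eta> a (Rs (psh_prod X' (simplex_over dO dA k)) a b f (\<Phi> b x g, Cmp Simp (dO b) l k \<rho> g))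
        = Rs W a b f (\<eta> b (\<Phi> b x g, Cmp Simp (dO b) l k \<rho> g))"
      using a p \<rho> by (intro NatD(2)[OF \<eta>]) (auto intro!: \<Phi> Simp.Cmp_in)
    then show "(case Rs (psh_prod X (simplex_over dO dA l)) a b f p of (x, g) \<Rightarrow> \<eta> a (\<Phi> a x g, Cmp Simp (dO a) l k \<rho> g))
       = Rs W a b f (case p of (x, g) \<Rightarrow> \<eta> b (\<Phi> b x g, Cmp Simp (dO b) l k \<rho> g))"
      using a p \<rho> by (simp add: nat Simp.Cmp_assoc dA_in)
  qed
  then show ?thesis by (simp add: map_space_simps)
qed

lemma presheaf_map_space:
  assumes X: "rs_closed C X" shows "presheaf Simp (map_space C dO dA X W)"
  unfolding presheaf_def
proof (intro conjI ballI)
  fix a b f assume f: "f \<in> Ar Simp a b"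
  show "Rs (map_space C dO dA X W) a b f \<in> El (map_space C dO dA X W) b \<rightarrow> El (map_space C dO dA X W) a"
  proof
    fix \<eta> assume "\<eta> \<in> El (map_space C dO dA X W) b"
    from map_space_reparam[OF X this f, of "\<lambda>a x g. x"]
    show "Rs (map_space C dO dA X W) a b f \<eta> \<in> El (map_space C dO dA X W) a"
      by (simp add: map_space_simps)
  qed
next
  fix k \<eta> assume \<eta>: "\<eta> \<in> El (map_space C dO dA X W) k"
  have R: "Rs (map_space C dO dA X W) k k (Ide Simp k) \<eta> \<in> El (map_space C dO dA X W) k"
    using map_space_reparam[OF X \<eta> Simp.Ide_in, of "\<lambda>a x g. x"] by (simp add: map_space_simps)
  show "Rs (map_space C dO dA X W) k k (Ide Simp k) \<eta> = \<eta>"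
    by (rule Nat_ext[OF R[unfolded map_space_simps(1)] \<eta>[unfolded map_space_simps(1)]])
      (auto simp: map_space_simps Simp.Cmp_Ide_left)
next
  fix a b c f g \<eta> assume f: "f \<in> Ar Simp a b" and g: "g \<in> Ar Simp b c"
  show "Rs (map_space C dO dA X W) a c (Cmp Simp a b c g f) \<eta>
    = Rs (map_space C dO dA X W) a b f (Rs (map_space C dO dA X W) b c g \<eta>)"
  proof -
    have "Cmp Simp (dO x) a b f h \<in> Ar Simp (dO x) b" if "h \<in> Ar Simp (dO x) a" for x h
      using f that by (auto intro: Simp.Cmp_in)
    then show ?thesis
      using f g by (auto simp: map_space_simps fun_eq_iff restrict_def Simp.Cmp_assoc)
  qed
qed

lemma map_space_pre_simp:
  "\<eta> \<in> El (map_space C dO dA X' W) k \<Longrightarrow> map_space_pre C dO dA X X' W f k \<eta>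
    = (\<lambda>a\<in>Ob C. \<lambda>(x, g)\<in>El X a \<times> Ar Simp (dO a) k. \<eta> a (f a x, g))"
  by (simp add: map_space_pre_def)

end

abbreviation (in over_Simp) Map where "Map X W \<equiv> map_space C dO dA X W"

lemma (in over_Simp) map_space_pre_in:
  assumes X: "rs_closed C X" and f: "f \<in> Nat C X X'" and \<eta>: "\<eta> \<in> El (Map X' W) k"
  shows "map_space_pre C dO dA X X' W f k \<eta> \<in> El (Map X W) k"
proof -
  have "(\<lambda>a\<in>Ob C. \<lambda>(x, g)\<in>El X a \<times> Ar Simp (dO a) k. \<eta> a (f a x, Cmp Simp (dO a) k k (Ide Simp k) g))
    \<in> El (Map X W) k"
    by (rule map_space_reparam[OF X \<eta> Simp.Ide_in]) (use NatD[OF f] in auto)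
  also have "(\<lambda>a\<in>Ob C. \<lambda>(x, g)\<in>El X a \<times> Ar Simp (dO a) k. \<eta> a (f a x, Cmp Simp (dO a) k k (Ide Simp k) g))
     = map_space_pre C dO dA X X' W f k \<eta>"
    unfolding map_space_pre_simp[OF \<eta>] by (auto simp: fun_eq_iff restrict_def Simp.Cmp_Ide_left)
  finally show ?thesis .
qed

lemma (in over_Simp) map_space_pre_Nat:
  assumes X: "rs_closed C X" "rs_closed C X'" and f: "f \<in> Nat C X X'"
  shows "map_space_pre C dO dA X X' W f \<in> Nat Simp (Map X' W) (Map X W)"
proof -
  have "(\<lambda>k\<in>Ob Simp. \<lambda>\<eta>\<in>El (Map X' W) k. map_space_pre C dO dA X X' W f k \<eta>) \<in> Nat Simp (Map X' W) (Map X W)"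
  proof (rule NatI[OF presheaf_rs_closed[OF presheaf_map_space[OF X(2)]]])
    fix k \<eta> assume "\<eta> \<in> El (Map X' W) k"
    then show "map_space_pre C dO dA X X' W f k \<eta> \<in> El (Map X W) k" by (rule map_space_pre_in[OF X(1) f])
  next
    fix l k \<theta> \<eta> assume t: "\<theta> \<in> Ar Simp l k" and \<eta>: "\<eta> \<in> El (Map X' W) k"
    have "Rs (Map X' W) l k \<theta> \<eta> \<in> El (Map X' W) l"
      using presheafD(1)[OF presheaf_map_space[OF X(2)]] t \<eta> by auto
    then show "map_space_pre C dO dA X X' W f l (Rs (Map X' W) l k \<theta> \<eta>)
      = Rs (Map X W) l k \<theta> (map_space_pre C dO dA X X' W f k \<eta>)"
      unfolding map_space_pre_simp[OF \<eta>] using t NatD(1)[OF f]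
      by (auto simp: map_space_pre_simp map_space_simps(2) fun_eq_iff restrict_def intro!: Simp.Cmp_in)
  qed
  then show ?thesis by (simp add: map_space_pre_def restrict_def cong: if_cong)
qed

text \<open>A homotopy \<open>H\<close> on \<open>B\<close> sends a pair of simplices \<open>(\<eta>, h)\<close> to the simplex
  \<open>(x, g) \<mapsto> \<eta> (H (x, h \<circ> g), g)\<close> of the mapping space.\<close>

lemma (in over_Simp) homotopy_retract_map_space:
  fixes A :: "('o, 'm, 'e) psh" and B :: "('o, 'm, 'd) psh" and W :: "('o, 'm, 'w) psh"
  assumes R: "homotopy_retract A B i r"
  shows "over_Simp.homotopy_retract Simp (\<lambda>k. k) (\<lambda>\<theta>. \<theta>) (Map A W) (Map B W)
    (map_space_pre C dO dA B A W r) (map_space_pre C dO dA A B W i)"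
proof -
  interpret S: over_Simp Simp "\<lambda>k. k" "\<lambda>\<theta>. \<theta>" by (rule over_Simp_self)
  note D = homotopy_retractD[OF R]
  obtain H where H: "H \<in> Nat C (psh_prod B (simplex_over dO dA 1)) B"
    "\<And>a x. a \<in> Ob C \<Longrightarrow> x \<in> El B a \<Longrightarrow> H a (x, vtx (dO a) 0) = x"
    "\<And>a x. a \<in> Ob C \<Longrightarrow> x \<in> El B a \<Longrightarrow> H a (x, vtx (dO a) 1) = i a (r a x)"
    by (rule homotopy_retract_homotopy[OF R], rule that) assumption+
  note MA = presheaf_map_space[OF D(1), of W] and MB = presheaf_map_space[OF D(2), of W]
  define K where "K k p = (case p of (\<eta>, h) \<Rightarrow>
    \<lambda>a\<in>Ob C. \<lambda>(x, g)\<in>El B a \<times> Ar Simp (dO a) k. \<eta> a (H a (x, Cmp Simp (dO a) k 1 h g), g))" for k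
    and p :: "('o \<Rightarrow> 'd \<times> (nat \<Rightarrow> nat) \<Rightarrow> 'w) \<times> (nat \<Rightarrow> nat)"
  have K_in: "K k (\<eta>, h) \<in> El (Map B W) k" if \<eta>: "\<eta> \<in> El (Map B W) k" and h: "h \<in> Ar Simp k 1" for k \<eta> h
  proof -
    have "(\<lambda>a\<in>Ob C. \<lambda>(x, g)\<in>El B a \<times> Ar Simp (dO a) k.
        \<eta> a (H a (x, Cmp Simp (dO a) k 1 h g), Cmp Simp (dO a) k k (Ide Simp k) g)) \<in> El (Map B W) k"
    proof (rule map_space_reparam[OF D(2) \<eta> Simp.Ide_in])
      fix a x g assume "a \<in> Ob C" "x \<in> El B a" "g \<in> Ar Simp (dO a) k"
      then show "H a (x, Cmp Simp (dO a) k 1 h g) \<in> El B a"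
        using h by (intro NatD(1)[OF H(1)]) (auto intro: Simp.Cmp_in)
    next
      fix a b f x g assume a: "a \<in> Ob C" "b \<in> Ob C" "f \<in> Ar C a b" "x \<in> El B b" "g \<in> Ar Simp (dO b) k"
      have "H a (Rs (psh_prod B (simplex_over dO dA 1)) a b f (x, Cmp Simp (dO b) k 1 h g))
        = Rs B a b f (H b (x, Cmp Simp (dO b) k 1 h g))"
        using a h by (intro NatD(2)[OF H(1)]) (auto intro: Simp.Cmp_in)
      then show "H a (Rs B a b f x, Cmp Simp (dO a) k 1 h (Cmp Simp (dO a) (dO b) k g (dA f)))
        = Rs B a b f (H b (x, Cmp Simp (dO b) k 1 h g))"
        using a h by (simp add: Simp.Cmp_assoc dA_in)
    qed simp
    also have "(\<lambda>a\<in>Ob C. \<lambda>(x, g)\<in>El B a \<times> Ar Simp (dO a) k.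
        \<eta> a (H a (x, Cmp Simp (dO a) k 1 h g), Cmp Simp (dO a) k k (Ide Simp k) g)) = K k (\<eta>, h)"
      by (auto simp: K_def fun_eq_iff restrict_def Simp.Cmp_Ide_left)
    finally show ?thesis .
  qed
  let ?P = "psh_prod (Map B W) (simplex_over (\<lambda>k. k) (\<lambda>\<theta>. \<theta>) 1)"
  let ?K = "\<lambda>k\<in>Ob Simp. \<lambda>p\<in>El ?P k. K k p"
  show ?thesis
  proof (rule S.homotopy_retractI[where H = ?K])
    show "rs_closed Simp (Map A W)" "rs_closed Simp (Map B W)"
      by (rule presheaf_rs_closed[OF MA], rule presheaf_rs_closed[OF MB])
    show "map_space_pre C dO dA B A W r \<in> Nat Simp (Map A W) (Map B W)"
      by (rule map_space_pre_Nat[OF D(2,1,4)])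
    show "map_space_pre C dO dA A B W i \<in> Nat Simp (Map B W) (Map A W)"
      by (rule map_space_pre_Nat[OF D(1,2,3)])
    show "map_space_pre C dO dA A B W i k (map_space_pre C dO dA B A W r k \<eta>) = \<eta>"
      if \<eta>: "\<eta> \<in> El (Map A W) k" for k \<eta>
    proof -
      note p = map_space_pre_in[OF D(2,4) \<eta>]
      show ?thesis
      proof (rule Nat_ext)
        show "map_space_pre C dO dA A B W i k (map_space_pre C dO dA B A W r k \<eta>)
          \<in> Nat C (psh_prod A (simplex_over dO dA k)) W"
          using map_space_pre_in[OF D(1,3) p] by (simp add: map_space_simps)
        show "\<eta> \<in> Nat C (psh_prod A (simplex_over dO dA k)) W" using \<eta> by (simp add: map_space_simps)
        fix a p assume "a \<in> Ob C" "p \<in> El (psh_prod A (simplex_over dO dA k)) a"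
        then show "map_space_pre C dO dA A B W i k (map_space_pre C dO dA B A W r k \<eta>) a p = \<eta> a p"
          unfolding map_space_pre_simp[OF p] using NatD(1)[OF D(3)] D(5)
          by (auto simp: map_space_pre_simp[OF \<eta>])
      qed
    qed
    show "?K \<in> Nat Simp ?P (Map B W)"
    proof (rule NatI[OF S.rs_closed_simplex_prod[OF presheaf_rs_closed[OF MB]]])
      fix k p assume "p \<in> El ?P k"
      then show "K k p \<in> El (Map B W) k" using K_in by auto
    next
      fix l k \<theta> p assume t: "\<theta> \<in> Ar Simp l k" and "p \<in> El ?P k"
      then obtain \<eta> h where p: "p = (\<eta>, h)" "\<eta> \<in> El (Map B W) k" "h \<in> Ar Simp k 1" by auto
      have "H a (x, Cmp Simp (dO a) k 1 h (Cmp Simp (dO a) l k \<theta> g)) \<in> El B a"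
        if "a \<in> Ob C" "x \<in> El B a" "g \<in> Ar Simp (dO a) l" for a x g
        using that t p(3) by (intro NatD(1)[OF H(1)]) (auto intro!: Simp.Cmp_in)
      then show "K l (Rs ?P l k \<theta> p) = Rs (Map B W) l k \<theta> (K k p)"
        using t p by (auto simp: K_def map_space_simps(2) fun_eq_iff restrict_def Simp.Cmp_assoc intro!: Simp.Cmp_in)
    qed
    fix k \<eta> assume \<eta>: "\<eta> \<in> El (Map B W) k"
    note \<eta>' = \<eta>[unfolded map_space_simps]
    have v: "vtx k j \<in> Ar Simp k 1" if "j \<le> 1" for j by (rule vtx_in[OF that])
    show "?K k (\<eta>, vtx k 0) = \<eta>"
    proof (rule Nat_ext[OF _ \<eta>'])
      show "?K k (\<eta>, vtx k 0) \<in> Nat C (psh_prod B (simplex_over dO dA k)) W"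
        using K_in[OF \<eta> v[of 0]] \<eta> v[of 0] by (simp add: map_space_simps)
      fix a p assume "a \<in> Ob C" "p \<in> El (psh_prod B (simplex_over dO dA k)) a"
      then show "?K k (\<eta>, vtx k 0) a p = \<eta> a p"
        using \<eta> v[of 0] H(2) by (auto simp: K_def Cmp_vtx)
    qed
    note p = map_space_pre_in[OF D(1,3) \<eta>]
    show "?K k (\<eta>, vtx k 1) = map_space_pre C dO dA B A W r k (map_space_pre C dO dA A B W i k \<eta>)"
    proof (rule Nat_ext)
      show "?K k (\<eta>, vtx k 1) \<in> Nat C (psh_prod B (simplex_over dO dA k)) W"
        using K_in[OF \<eta> v[of 1]] \<eta> v[of 1] by (simp add: map_space_simps)
      show "map_space_pre C dO dA B A W r k (map_space_pre C dO dA A B W i k \<eta>)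
          \<in> Nat C (psh_prod B (simplex_over dO dA k)) W"
        using map_space_pre_in[OF D(2,4) p] by (simp add: map_space_simps)
      fix a q assume "a \<in> Ob C" "q \<in> El (psh_prod B (simplex_over dO dA k)) a"
      then show "?K k (\<eta>, vtx k 1) a q
        = map_space_pre C dO dA B A W r k (map_space_pre C dO dA A B W i k \<eta>) a q"
        unfolding map_space_pre_simp[OF p] using \<eta> v[of 1] H(3) NatD(1)[OF D(4)]
        by (auto simp: K_def Cmp_vtx map_space_pre_simp[OF \<eta>])
    qed
  qed
qed

section \<open>Homotopy retracts are weak equivalences\<close>

lemma conn_rel_refl: "x \<in> El X 0 \<Longrightarrow> (x, x) \<in> conn_rel X"
  by (simp add: conn_rel_def)

lemma equiv_conn_rel: "equiv (El X 0) (conn_rel X)"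
proof -
  have "sym (edge_rel X \<union> (edge_rel X)\<inverse>)" by (auto simp: sym_def)
  then have "sym ((edge_rel X \<union> (edge_rel X)\<inverse>)\<^sup>*)" by (rule sym_rtrancl)
  then show ?thesis
    unfolding conn_rel_def
    by (intro equivI) (auto simp: refl_on_def sym_def intro!: transI)
qed

lemma face_in_Simp: "j \<le> k \<Longrightarrow> (\<lambda>i\<in>{..0}. j) \<in> Ar Simp 0 k"
  using vtx_in[of j k 0] by (simp add: vtx_def)

lemma conn_rel_map:
  assumes f: "f \<in> Nat Simp X Y" and xy: "(x, y) \<in> conn_rel X"
  shows "(f 0 x, f 0 y) \<in> conn_rel Y"
proof -
  have "(f 0 u, f 0 v) \<in> edge_rel Y" if "(u, v) \<in> edge_rel X" for u v
  proof -
    from that obtain e where e: "e \<in> El X 1" "u = Rs X 0 1 (\<lambda>i\<in>{..0}. 0) e" "v = Rs X 0 1 (\<lambda>i\<in>{..0}. 1) e"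
      by (auto simp: edge_rel_def)
    have "f 1 e \<in> El Y 1" by (rule NatD(1)[OF f _ e(1)]) simp
    moreover have "f 0 u = Rs Y 0 1 (\<lambda>i\<in>{..0}. 0) (f 1 e)"
      unfolding e(2) by (rule NatD(2)[OF f _ _ face_in_Simp e(1)]) simp_all
    moreover have "f 0 v = Rs Y 0 1 (\<lambda>i\<in>{..0}. 1) (f 1 e)"
      unfolding e(3) by (rule NatD(2)[OF f _ _ face_in_Simp e(1)]) simp_all
    ultimately show ?thesis by (auto simp: edge_rel_def)
  qed
  then have step: "(f 0 u, f 0 v) \<in> edge_rel Y \<union> (edge_rel Y)\<inverse>" if "(u, v) \<in> edge_rel X \<union> (edge_rel X)\<inverse>" for u v
    using that by auto
  have "(x, y) \<in> (edge_rel X \<union> (edge_rel X)\<inverse>)\<^sup>*" using xy by (simp add: conn_rel_def)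
  then have "(f 0 x, f 0 y) \<in> (edge_rel Y \<union> (edge_rel Y)\<inverse>)\<^sup>*"
    by (induction rule: rtrancl_induct) (rule rtrancl.rtrancl_refl, erule rtrancl_into_rtrancl, erule step)
  then show ?thesis using xy NatD(1)[OF f] by (auto simp: conn_rel_def)
qed

lemma pi0_map_class:
  assumes f: "f \<in> Nat Simp X Y" and x: "x \<in> El X 0"
  shows "pi0_map Y f (conn_rel X `` {x}) = conn_rel Y `` {f 0 x}"
proof -
  have "conn_rel Y `` {f 0 y} = conn_rel Y `` {f 0 x}" if "(x, y) \<in> conn_rel X" for y
    using equiv_class_eq[OF equiv_conn_rel conn_rel_map[OF f that]] by simp
  moreover have "conn_rel Y `` (f 0 ` (conn_rel X `` {x}))
      = (\<Union>y\<in>conn_rel X `` {x}. conn_rel Y `` {f 0 y})" by blast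
  moreover have "x \<in> conn_rel X `` {x}" using conn_rel_refl[OF x] by blast
  ultimately show ?thesis unfolding pi0_map_def by (simp only:) blast
qed

lemma pi0_map_bij:
  assumes f: "f \<in> Nat Simp X Y" and g: "g \<in> Nat Simp Y X"
    and gf: "\<And>x. x \<in> El X 0 \<Longrightarrow> (g 0 (f 0 x), x) \<in> conn_rel X"
    and fg: "\<And>y. y \<in> El Y 0 \<Longrightarrow> (f 0 (g 0 y), y) \<in> conn_rel Y"
  shows "bij_betw (pi0_map Y f) (pi0 X) (pi0 Y)"
proof (rule bij_betw_byWitness[where f' = "pi0_map X g"])
  have F: "f 0 x \<in> El Y 0" if "x \<in> El X 0" for x using NatD(1)[OF f] that by simp
  have G: "g 0 y \<in> El X 0" if "y \<in> El Y 0" for y using NatD(1)[OF g] that by simp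
  show "\<forall>A\<in>pi0 X. pi0_map X g (pi0_map Y f A) = A"
  proof
    fix A assume "A \<in> pi0 X"
    then obtain x where x: "x \<in> El X 0" "A = conn_rel X `` {x}" unfolding pi0_def by (rule quotientE)
    have "pi0_map X g (pi0_map Y f A) = conn_rel X `` {g 0 (f 0 x)}"
      unfolding x(2) pi0_map_class[OF f x(1)] by (rule pi0_map_class[OF g F[OF x(1)]])
    then show "pi0_map X g (pi0_map Y f A) = A"
      using equiv_class_eq[OF equiv_conn_rel gf[OF x(1)]] x(2) by simp
  qed
  show "\<forall>A\<in>pi0 Y. pi0_map Y f (pi0_map X g A) = A"
  proof
    fix A assume "A \<in> pi0 Y"
    then obtain y where y: "y \<in> El Y 0" "A = conn_rel Y `` {y}" unfolding pi0_def by (rule quotientE)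
    have "pi0_map Y f (pi0_map X g A) = conn_rel Y `` {f 0 (g 0 y)}"
      unfolding y(2) pi0_map_class[OF g y(1)] by (rule pi0_map_class[OF f G[OF y(1)]])
    then show "pi0_map Y f (pi0_map X g A) = A"
      using equiv_class_eq[OF equiv_conn_rel fg[OF y(1)]] y(2) by simp
  qed
  show "pi0_map Y f ` pi0 X \<subseteq> pi0 Y"
    by (auto simp: pi0_def pi0_map_class[OF f] elim!: quotientE intro!: quotientI F)
  show "pi0_map X g ` pi0 Y \<subseteq> pi0 X"
    by (auto simp: pi0_def pi0_map_class[OF g] elim!: quotientE intro!: quotientI G)
qed

interpretation SS: over_Simp Simp "\<lambda>k. k" "\<lambda>\<theta>. \<theta>" by (rule over_Simp_self)

text \<open>The degenerate edge at a vertex \<open>y\<close> is moved by the homotopy to an edge from \<open>y\<close> to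
  \<open>i (r y)\<close>.\<close>

lemma homotopy_retract_pi0:
  assumes R: "SS.homotopy_retract A B i r" and B: "presheaf Simp B"
  shows "bij_betw (pi0_map B i) (pi0 A) (pi0 B)" "bij_betw (pi0_map A r) (pi0 B) (pi0 A)"
proof -
  note D = SS.homotopy_retractD[OF R]
  obtain H where H: "H \<in> Nat Simp (psh_prod B (simplex_over (\<lambda>k. k) (\<lambda>\<theta>. \<theta>) 1)) B"
    "\<And>a x. a \<in> Ob Simp \<Longrightarrow> x \<in> El B a \<Longrightarrow> H a (x, vtx a 0) = x"
    "\<And>a x. a \<in> Ob Simp \<Longrightarrow> x \<in> El B a \<Longrightarrow> H a (x, vtx a 1) = i a (r a x)"
    by (rule SS.homotopy_retract_homotopy[OF R], rule that) assumption+
  have ir: "(i 0 (r 0 y), y) \<in> conn_rel B" if y: "y \<in> El B 0" for y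
  proof -
    (* the degenerate edge at y, which the homotopy is applied to *)
    define s where "s = Rs B 1 0 (vtx 1 0) y"
    have v: "vtx m j \<in> Ar Simp m k" if "j \<le> k" for m j k by (rule vtx_in[OF that])
    have s: "s \<in> El B 1" unfolding s_def using presheafD(1)[OF B] v y by simp
    define e where "e = H 1 (s, Ide Simp 1)"
    have e: "e \<in> El B 1" unfolding e_def using NatD(1)[OF H(1), of 1] s Simp.Ide_in[of 1] by simp
    have "Rs B 0 1 (vtx 0 j) e = H 0 (y, vtx 0 j)" if j: "j \<le> 1" for j
    proof -
      have "Rs B 0 1 (vtx 0 j) s = Rs B 0 0 (Cmp Simp 0 1 0 (vtx 1 0) (vtx 0 j)) y"
        unfolding s_def using presheafD(3)[OF B, of 0 1 0 "vtx 0 j" "vtx 1 0" y] v j y by simp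
      also have "Cmp Simp 0 1 0 (vtx 1 0) (vtx 0 j) = Ide Simp 0"
        using v[OF j] by (simp add: Cmp_vtx) (simp add: vtx_def Simp_def fun_eq_iff)
      finally have "Rs B 0 1 (vtx 0 j) s = y" using presheafD(2)[OF B] y by simp
      then show ?thesis unfolding e_def
        using NatD(2)[OF H(1), of 0 1 "vtx 0 j" "(s, Ide Simp 1)"] v[OF j] s Simp.Ide_in[of 1]
          Simp.Cmp_Ide_left[of 0 1] by simp
    qed
    from this[of 0] this[of 1] have "(y, i 0 (r 0 y)) \<in> edge_rel B"
      using e H(2,3) y unfolding edge_rel_def vtx_def by force
    moreover have "i 0 (r 0 y) \<in> El B 0" using NatD(1)[OF D(3)] NatD(1)[OF D(4)] y by simp
    ultimately show ?thesis using y unfolding conn_rel_def by auto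
  qed
  have ri: "(r 0 (i 0 x), x) \<in> conn_rel A" if "x \<in> El A 0" for x
    using D(5)[of 0 x] that conn_rel_refl[of x A] by simp
  show "bij_betw (pi0_map B i) (pi0 A) (pi0 B)" by (rule pi0_map_bij[OF D(3,4) ri ir])
  show "bij_betw (pi0_map A r) (pi0 B) (pi0 A)" by (rule pi0_map_bij[OF D(4,3) ir ri])
qed

text \<open>Mapping into a Kan complex \<open>K\<close> turns the retract into another one,
  where precomposition with \<open>r\<close> is the inclusion.\<close>

lemma homotopy_retract_weak_equivalence:
  assumes R: "SS.homotopy_retract A B i r"
  shows "weak_homotopy_equivalence U A B i" "weak_homotopy_equivalence U B A r"
proof -
  note D = SS.homotopy_retractD[OF R]
  have "bij_betw (pi0_map (sset_map A K) (sset_map_pre A B K i)) (pi0 (sset_map B K)) (pi0 (sset_map A K))"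
    "bij_betw (pi0_map (sset_map B K) (sset_map_pre B A K r)) (pi0 (sset_map A K)) (pi0 (sset_map B K))"
    for K :: "'c sset"
    using homotopy_retract_pi0[OF SS.homotopy_retract_map_space[OF R, of K] SS.presheaf_map_space[OF D(2)]]
    by blast+
  then show "weak_homotopy_equivalence U A B i" "weak_homotopy_equivalence U B A r"
    using D(3,4) unfolding weak_homotopy_equivalence_def by blast+
qed

lemma Ob_SimpN [simp]: "ms \<in> Ob (SimpN n) \<longleftrightarrow> length ms = n"
  by (simp add: SimpN_def)

lemma over_Simp_SSp: "over_Simp (SSp n) snd snd"
  by (rule over_Simp_snd[OF category_SimpN])

lemma slice_simps [simp]:
  "El (slice C X a) k = El X (a, k)"
  "Rs (slice C X a) k l \<theta> = Rs X (a, k) (a, l) (Ide C a, \<theta>)"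
  by (simp_all add: slice_def)

lemma slice_Nat:
  assumes C: "category C" and \<eta>: "\<eta> \<in> Nat (cat_prod C Simp) X Y" and a: "a \<in> Ob C"
  shows "(\<lambda>k. \<eta> (a, k)) \<in> Nat Simp (slice C X a) (slice C Y a)"
proof -
  interpret C: category C by fact
  have "\<eta> (a, k) \<in> El X (a, k) \<rightarrow>\<^sub>E El Y (a, k)" for k
    using \<eta> a by (auto simp: Nat_def PiE_iff)
  moreover have "\<eta> (a, k) (Rs X (a, k) (a, l) (Ide C a, \<theta>) x) = Rs Y (a, k) (a, l) (Ide C a, \<theta>) (\<eta> (a, l) x)"
    if "\<theta> \<in> Ar Simp k l" "x \<in> El X (a, l)" for k l \<theta> x
    by (rule NatD(2)[OF \<eta>]) (use a that C.Ide_in in auto)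
  ultimately show ?thesis unfolding Nat_def by (auto simp: PiE_iff Pi_iff)
qed

text \<open>Restricting a homotopy to a fixed multidegree leaves a homotopy of simplicial sets.\<close>

lemma homotopy_retract_slice:
  assumes C: "category C" and a: "a \<in> Ob C"
    and R: "over_Simp.homotopy_retract (cat_prod C Simp) snd snd A B i r"
  shows "SS.homotopy_retract (slice C A a) (slice C B a) (\<lambda>k. i (a, k)) (\<lambda>k. r (a, k))"
proof -
  interpret C: category C by fact
  interpret CS: over_Simp "cat_prod C Simp" snd snd by (rule over_Simp_snd[OF C])
  note D = CS.homotopy_retractD[OF R]
  obtain H where H: "H \<in> Nat (cat_prod C Simp) (psh_prod B (simplex_over snd snd 1)) B"
    "\<And>a x. a \<in> Ob (cat_prod C Simp) \<Longrightarrow> x \<in> El B a \<Longrightarrow> H a (x, vtx (snd a) 0) = x"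
    "\<And>a x. a \<in> Ob (cat_prod C Simp) \<Longrightarrow> x \<in> El B a \<Longrightarrow> H a (x, vtx (snd a) 1) = i a (r a x)"
    by (rule CS.homotopy_retract_homotopy[OF R], rule that) assumption+
  have rs: "rs_closed Simp (slice C X a)" if "rs_closed (cat_prod C Simp) X" for X :: "('a \<times> nat, 'b \<times> (nat \<Rightarrow> nat), 'z) psh"
    unfolding rs_closed_def using a C.Ide_in by (auto intro!: rs_closedD[OF that])
  show ?thesis
  proof (rule SS.homotopy_retractI[where H = "\<lambda>k. H (a, k)"])
    have eq: "psh_prod (slice C B a) (simplex_over (\<lambda>k. k) (\<lambda>\<theta>. \<theta>) 1)
      = slice C (psh_prod B (simplex_over snd snd 1)) a"
      by (simp add: psh_prod_def slice_def simplex_over_def)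
    show "(\<lambda>k. H (a, k)) \<in> Nat Simp (psh_prod (slice C B a) (simplex_over (\<lambda>k. k) (\<lambda>\<theta>. \<theta>) 1)) (slice C B a)"
      unfolding eq by (rule slice_Nat[OF C H(1) a])
  qed (use a D H in \<open>auto intro: slice_Nat[OF C] rs\<close>)
qed

text \<open>For \<open>n = 0\<close> weak equivalences are defined objectwise, and the slices of a homotopy retract
  are homotopy retracts; for \<open>n > 0\<close> they are defined by mapping spaces.\<close>

lemma homotopy_retract_css_we:
  assumes R: "over_Simp.homotopy_retract (SSp n) snd snd A B i r"
    and A: "presheaf_in U (SSp n) A" and B: "presheaf_in U (SSp n) B"
  shows "css_we U n A B i" "css_we U n B A r"
proof -
  interpret P: over_Simp "SSp n" snd snd by (rule over_Simp_SSp)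
  note D = P.homotopy_retractD[OF R]
  have "objectwise_we U n A B i" "objectwise_we U n B A r"
    unfolding objectwise_we_def
    using D(3,4) homotopy_retract_weak_equivalence[OF homotopy_retract_slice[OF category_SimpN _ R]] by blast+
  moreover have
    "weak_homotopy_equivalence U (map_space (SSp n) snd snd B W) (map_space (SSp n) snd snd A W)
        (map_space_pre (SSp n) snd snd A B W i)"
    "weak_homotopy_equivalence U (map_space (SSp n) snd snd A W) (map_space (SSp n) snd snd B W)
        (map_space_pre (SSp n) snd snd B A W r)" for W :: "'a sspace"
    using homotopy_retract_weak_equivalence[OF P.homotopy_retract_map_space[OF R, of W]] by blast+
  ultimately show "css_we U n A B i" "css_we U n B A r"
    using A B D(3,4) unfolding css_we_def by auto
qed

text \<open>In the localisation, the composite \<open>g\<close> followed by \<open>f\<close> is not changed when \<open>g\<close> and its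
  formal inverse are appended. There \<open>f\<close> followed by \<open>g\<close> is the identity, and what remains is \<open>g\<close> followed
  by its formal inverse.\<close>

lemma strict_retract_inverse_in_ho:
  assumes f: "css_we U n A B f" and g: "css_we U n B A g"
    and gf: "nat_comp (SSp n) A g f = nat_id (SSp n) A"
  shows "inverse_in_ho U n A B f g"
proof -
  have P: "presheaf_in U (SSp n) A" "presheaf_in U (SSp n) B" "f \<in> Nat (SSp n) A B" "g \<in> Nat (SSp n) B A"
    using f g by (auto simp: css_we_def)
  have idA: "nat_id (SSp n) A \<in> Nat (SSp n) A A"
  proof -
    have "rs_closed (SSp n) A" using P(1) presheaf_rs_closed unfolding presheaf_in_def by blast
    then show ?thesis unfolding nat_id_def by (rule NatI) auto
  qed
  have 1: "ho_eq U n A A [Fwd A f B, Fwd B g A] []"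
  proof (rule ho_trans)
    show "ho_eq U n A A [Fwd A f B, Fwd B g A] [Fwd A (nat_comp (SSp n) A g f) A]"
      using ho_step[OF zred.intros(1), of U n A A "[]" A f B g A "[]"] P idA by (simp add: gf)
    show "ho_eq U n A A [Fwd A (nat_comp (SSp n) A g f) A] []"
      unfolding gf using ho_step[OF zred.intros(2), of U n A A "[]" A "[]"] P idA by simp
  qed
  (* Insert g and its formal inverse at the end, then cancel f followed by g in the middle. *)
  let ?gf = "[Fwd B g A, Fwd A f B]"
  have 2: "ho_eq U n B B (?gf @ [Fwd B g A, Bwd A g B]) ?gf"
    using ho_step[OF zred.intros(3), of U n B B ?gf B g A "[]"] P g by simp
  have 3: "ho_eq U n B B (?gf @ [Fwd B g A, Bwd A g B]) [Fwd B g A, Fwd A (nat_id (SSp n) A) A, Bwd A g B]"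
    using ho_step[OF zred.intros(1), of U n B B "[Fwd B g A]" A f B g A "[Bwd A g B]"] P g idA by (simp add: gf)
  have 4: "ho_eq U n B B [Fwd B g A, Fwd A (nat_id (SSp n) A) A, Bwd A g B] [Fwd B g A, Bwd A g B]"
    using ho_step[OF zred.intros(2), of U n B B "[Fwd B g A]" A "[Bwd A g B]"] P g idA by simp
  have 5: "ho_eq U n B B [Fwd B g A, Bwd A g B] []"
    using ho_step[OF zred.intros(3), of U n B B "[]" B g A "[]"] P g by simp
  have "ho_eq U n B B ?gf []"
    by (rule ho_trans[OF ho_sym[OF 2] ho_trans[OF 3 ho_trans[OF 4 5]]])
  with 1 show ?thesis by (simp add: inverse_in_ho_def)
qed

section \<open>Constructions that preserve homotopy retracts\<close>

context category
begin

lemma chain_arrow_in: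
  assumes "length cs = Suc k" "set cs \<subseteq> Ob C" "\<forall>i<k. fs ! i \<in> Ar C (cs ! i) (cs ! Suc i)" "i \<le> j" "j \<le> k"
  shows "chain_arrow C cs fs i j \<in> Ar C (cs ! i) (cs ! j)"
proof -
  have ob: "cs ! j \<in> Ob C" if "j \<le> k" for j using assms(1,2) that by (auto simp: subset_iff)
  show ?thesis using assms(4,5)
  proof (induction j)
    case 0
    then show ?case using Ide_in[OF ob[of 0]] by simp
  next
    case (Suc j)
    then show ?case
      using assms(3) ob by (cases "i \<le> j") (auto intro!: Cmp_in Ide_in simp: le_Suc_eq)
  qed
qed

lemma dugger_El:
  "(cs, f, fs, z) \<in> El (dugger_Q C Z) (c, k) \<longleftrightarrow> length cs = Suc k \<and> set cs \<subseteq> Ob C \<and> f \<in> Ar C c (cs ! 0)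
     \<and> length fs = k \<and> (\<forall>i<k. fs ! i \<in> Ar C (cs ! i) (cs ! Suc i)) \<and> z \<in> El Z (cs ! k, k)"
  by (simp add: dugger_Q_def)

lemma dugger_Rs:
  "Rs (dugger_Q C Z) (a, l) (b, k) (h, \<theta>) (cs, f, fs, z) = (map (\<lambda>j. cs ! \<theta> j) [0..<Suc l],
        Cmp C a (cs ! 0) (cs ! \<theta> 0) (chain_arrow C cs fs 0 (\<theta> 0)) (Cmp C a b (cs ! 0) f h),
        map (\<lambda>j. chain_arrow C cs fs (\<theta> j) (\<theta> (Suc j))) [0..<l],
        Rs Z (cs ! \<theta> l, l) (cs ! k, k) (chain_arrow C cs fs (\<theta> l) k, \<theta>) z)"
  by (simp add: dugger_Q_def del: upt_Suc)

lemma dugger_obj: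
  assumes "(cs, f, fs, z) \<in> El (dugger_Q C Z) (b, k)" "\<theta> \<in> Ar Simp l k"
  shows "cs ! k \<in> Ob C" "cs ! \<theta> l \<in> Ob C" "chain_arrow C cs fs (\<theta> l) k \<in> Ar C (cs ! \<theta> l) (cs ! k)"
proof -
  have cs: "length cs = Suc k" "set cs \<subseteq> Ob C" "\<forall>i<k. fs ! i \<in> Ar C (cs ! i) (cs ! Suc i)"
    using assms(1) by (auto simp: dugger_El)
  have t: "\<theta> l \<le> k" using Simp_ArD(1)[OF assms(2)] by simp
  then have "cs ! k \<in> set cs" "cs ! \<theta> l \<in> set cs" using cs(1) by auto
  then show "cs ! k \<in> Ob C" "cs ! \<theta> l \<in> Ob C" using cs(2) by blast+
  show "chain_arrow C cs fs (\<theta> l) k \<in> Ar C (cs ! \<theta> l) (cs ! k)" by (rule chain_arrow_in[OF cs t]) simp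
qed

lemma rs_closed_dugger:
  assumes Z: "rs_closed (cat_prod C Simp) Z" shows "rs_closed (cat_prod C Simp) (dugger_Q C Z)"
  unfolding rs_closed_def
proof (intro ballI)
  fix p q m x assume p: "p \<in> Ob (cat_prod C Simp)" and q: "q \<in> Ob (cat_prod C Simp)"
    and m: "m \<in> Ar (cat_prod C Simp) p q" and x: "x \<in> El (dugger_Q C Z) q"
  obtain a l b k h \<theta> where e: "p = (a, l)" "q = (b, k)" "m = (h, \<theta>)" by (metis surj_pair)
  obtain cs f fs z where x': "x = (cs, f, fs, z)" by (metis surj_pair)
  note x = x[unfolded x' e]
  have a: "a \<in> Ob C" "b \<in> Ob C" "h \<in> Ar C a b" "\<theta> \<in> Ar Simp l k" using p q m by (auto simp: e)
  note t = Simp_ArD[OF a(4)]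
  have cs: "length cs = Suc k" "set cs \<subseteq> Ob C" "f \<in> Ar C b (cs ! 0)" "length fs = k"
    "\<forall>i<k. fs ! i \<in> Ar C (cs ! i) (cs ! Suc i)" "z \<in> El Z (cs ! k, k)" using x by (auto simp: dugger_El)
  have ob: "cs ! j \<in> Ob C" if "j \<le> k" for j using cs(1,2) that by (auto simp: subset_iff)
  have ch: "chain_arrow C cs fs i j \<in> Ar C (cs ! i) (cs ! j)" if "i \<le> j" "j \<le> k" for i j
    by (rule chain_arrow_in[OF cs(1,2,5) that])
  have z: "Rs Z (cs ! \<theta> l, l) (cs ! k, k) (chain_arrow C cs fs (\<theta> l) k, \<theta>) z \<in> El Z (cs ! \<theta> l, l)"
    by (rule rs_closedD[OF Z]) (use a t ob ch cs(6) in auto)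
  have f: "Cmp C a (cs ! 0) (cs ! \<theta> 0) (chain_arrow C cs fs 0 (\<theta> 0)) (Cmp C a b (cs ! 0) f h) \<in> Ar C a (cs ! \<theta> 0)"
    using a t[of 0] ob ch cs(3) by (intro Cmp_in) auto
  have o: "set (map (\<lambda>j. cs ! \<theta> j) [0..<Suc l]) \<subseteq> Ob C" using ob t(1) by auto
  have n: "map (\<lambda>j. cs ! \<theta> j) [0..<Suc l] ! j = cs ! \<theta> j" if "j \<le> l" for j
    using that nth_map_upt[of j "Suc l" 0 "\<lambda>j. cs ! \<theta> j"] by simp
  show "Rs (dugger_Q C Z) p q m x \<in> El (dugger_Q C Z) p"
    unfolding e x' dugger_Rs dugger_El
    using z f o n t ch by (auto simp del: upt_Suc)
qed

definition dugger_map :: "('o \<times> nat \<Rightarrow> 'e \<Rightarrow> 'd) \<Rightarrow> 'o \<times> nat \<Rightarrow> 'o list \<times> 'm \<times> 'm list \<times> 'e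
    \<Rightarrow> 'o list \<times> 'm \<times> 'm list \<times> 'd" where
  "dugger_map = (\<lambda>\<eta> (c :: 'o, k :: nat) (cs, f, fs, z). (cs, f, fs, \<eta> (cs ! k, k) z))"

lemma dugger_map_Nat:
  assumes Z: "rs_closed (cat_prod C Simp) Z" and t: "t \<in> Nat (cat_prod C Simp) Z Z'"
  shows "(\<lambda>a\<in>Ob (cat_prod C Simp). \<lambda>x\<in>El (dugger_Q C Z) a. dugger_map t a x)
    \<in> Nat (cat_prod C Simp) (dugger_Q C Z) (dugger_Q C Z')"
proof (rule NatI[OF rs_closed_dugger[OF Z]])
  fix p x assume p: "p \<in> Ob (cat_prod C Simp)" and x: "x \<in> El (dugger_Q C Z) p"
  obtain c k where e: "p = (c, k)" by (metis surj_pair)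
  obtain cs f fs z where x': "x = (cs, f, fs, z)" by (metis surj_pair)
  have "cs ! k \<in> Ob C" using dugger_obj(1)[OF x[unfolded e x'] Simp.Ide_in] by simp
  then show "dugger_map t p x \<in> El (dugger_Q C Z') p"
    using x NatD(1)[OF t, of "(cs ! k, k)" z] unfolding e x' dugger_map_def by (simp add: dugger_El)
next
  fix p q m x assume p: "p \<in> Ob (cat_prod C Simp)" and q: "q \<in> Ob (cat_prod C Simp)"
    and m: "m \<in> Ar (cat_prod C Simp) p q" and x: "x \<in> El (dugger_Q C Z) q"
  obtain a l b k h \<theta> where e: "p = (a, l)" "q = (b, k)" "m = (h, \<theta>)" by (metis surj_pair)
  obtain cs f fs z where x': "x = (cs, f, fs, z)" by (metis surj_pair)
  note x = x[unfolded x' e]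
  have a: "\<theta> \<in> Ar Simp l k" using m by (auto simp: e)
  note o = dugger_obj[OF x a]
  have "t (cs ! \<theta> l, l) (Rs Z (cs ! \<theta> l, l) (cs ! k, k) (chain_arrow C cs fs (\<theta> l) k, \<theta>) z)
    = Rs Z' (cs ! \<theta> l, l) (cs ! k, k) (chain_arrow C cs fs (\<theta> l) k, \<theta>) (t (cs ! k, k) z)"
    by (rule NatD(2)[OF t]) (use o a x in \<open>auto simp: dugger_El\<close>)
  then show "dugger_map t p (Rs (dugger_Q C Z) p q m x) = Rs (dugger_Q C Z') p q m (dugger_map t q x)"
    unfolding e x' dugger_map_def by (simp add: dugger_Rs nth_map_upt[of l "Suc l" 0, simplified] del: upt_Suc)
qed

text \<open>The replacement of \<open>B \<times> \<Delta>\<^sup>1\<close> is the product of the replacement of \<open>B\<close> with \<open>\<Delta>\<^sup>1\<close>, because the standard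
  simplex is constant in the direction of \<open>C\<close>.\<close>

lemma homotopy_retract_dugger:
  assumes R: "over_Simp.homotopy_retract (cat_prod C Simp) snd snd A B i r"
  shows "over_Simp.homotopy_retract (cat_prod C Simp) snd snd (dugger_Q C A) (dugger_Q C B)
    (\<lambda>a\<in>Ob (cat_prod C Simp). \<lambda>x\<in>El (dugger_Q C A) a. dugger_map i a x)
    (\<lambda>a\<in>Ob (cat_prod C Simp). \<lambda>x\<in>El (dugger_Q C B) a. dugger_map r a x)"
proof -
  interpret P: over_Simp "cat_prod C Simp" snd snd by (rule over_Simp_snd[OF category_axioms])
  note D = P.homotopy_retractD[OF R]
  obtain H where H: "H \<in> Nat (cat_prod C Simp) (psh_prod B (simplex_over snd snd 1)) B"
    "\<And>a x. a \<in> Ob (cat_prod C Simp) \<Longrightarrow> x \<in> El B a \<Longrightarrow> H a (x, vtx (snd a) 0) = x"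
    "\<And>a x. a \<in> Ob (cat_prod C Simp) \<Longrightarrow> x \<in> El B a \<Longrightarrow> H a (x, vtx (snd a) 1) = i a (r a x)"
    by (rule P.homotopy_retract_homotopy[OF R], rule that) assumption+
  have ob: "cs ! k \<in> Ob C" "z \<in> El Z (cs ! k, k)" if "(cs, f, fs, z) \<in> El (dugger_Q C Z) (c, k)"
    for cs f fs z c k and Z :: "('o \<times> nat, 'm \<times> (nat \<Rightarrow> nat), 'z) psh"
    using dugger_obj(1)[OF that Simp.Ide_in] that by (auto simp: dugger_El)
  let ?P = "psh_prod (dugger_Q C B) (simplex_over snd snd 1)"
  define K where "K a p = (case p of (x, g) \<Rightarrow> dugger_map (\<lambda>a z. H a (z, g)) a x)" for a p
  note n1 = dugger_map_Nat[OF D(1,3)] and n2 = dugger_map_Nat[OF D(2,4)]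
  show ?thesis
  proof (rule P.homotopy_retractI[where H = "\<lambda>a\<in>Ob (cat_prod C Simp). \<lambda>p\<in>El ?P a. K a p", OF rs_closed_dugger[OF D(1)] rs_closed_dugger[OF D(2)] n1 n2])
    fix a x assume a: "a \<in> Ob (cat_prod C Simp)" and x: "x \<in> El (dugger_Q C A) a"
    obtain c k where e: "a = (c, k)" by (metis surj_pair)
    obtain cs f fs z where x': "x = (cs, f, fs, z)" by (metis surj_pair)
    have "r (cs ! k, k) (i (cs ! k, k) z) = z" using D(5) ob[OF x[unfolded e x']] by simp
    moreover have "dugger_map i a x \<in> El (dugger_Q C B) a" using NatD(1)[OF n1 a x] a x by simp
    ultimately show "(\<lambda>a\<in>Ob (cat_prod C Simp). \<lambda>x\<in>El (dugger_Q C B) a. dugger_map r a x) a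
        ((\<lambda>a\<in>Ob (cat_prod C Simp). \<lambda>x\<in>El (dugger_Q C A) a. dugger_map i a x) a x) = x"
      using a x by (simp add: restrict_def) (simp add: e x' dugger_map_def)
  next
    show "(\<lambda>a\<in>Ob (cat_prod C Simp). \<lambda>p\<in>El ?P a. K a p) \<in> Nat (cat_prod C Simp) ?P (dugger_Q C B)"
    proof (rule NatI[OF P.rs_closed_simplex_prod[OF rs_closed_dugger[OF D(2)]]])
      fix a p assume a: "a \<in> Ob (cat_prod C Simp)" and p: "p \<in> El ?P a"
      obtain c k where e: "a = (c, k)" by (metis surj_pair)
      obtain cs f fs z g where p': "p = ((cs, f, fs, z), g)" by (metis surj_pair)
      from p have x: "(cs, f, fs, z) \<in> El (dugger_Q C B) (c, k)" and g: "g \<in> Ar Simp k 1" by (auto simp: p' e)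
      have "H (cs ! k, k) (z, g) \<in> El B (cs ! k, k)"
        by (rule NatD(1)[OF H(1)]) (use ob[OF x] g in auto)
      then show "K a p \<in> El (dugger_Q C B) a"
        using x unfolding e p' K_def dugger_map_def by (simp add: dugger_El)
    next
      fix a b m p assume a: "a \<in> Ob (cat_prod C Simp)" and b: "b \<in> Ob (cat_prod C Simp)"
        and m: "m \<in> Ar (cat_prod C Simp) a b" and p: "p \<in> El ?P b"
      obtain c l d k h \<theta> where e: "a = (c, l)" "b = (d, k)" "m = (h, \<theta>)" by (metis surj_pair)
      obtain cs f fs z g where p': "p = ((cs, f, fs, z), g)" by (metis surj_pair)
      from p have x: "(cs, f, fs, z) \<in> El (dugger_Q C B) (d, k)" and g: "g \<in> Ar Simp k 1" by (auto simp: p' e)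
      have t: "\<theta> \<in> Ar Simp l k" using m by (auto simp: e)
      note o = dugger_obj[OF x t]
      have "H (cs ! \<theta> l, l) (Rs (psh_prod B (simplex_over snd snd 1)) (cs ! \<theta> l, l) (cs ! k, k) (chain_arrow C cs fs (\<theta> l) k, \<theta>) (z, g))
        = Rs B (cs ! \<theta> l, l) (cs ! k, k) (chain_arrow C cs fs (\<theta> l) k, \<theta>) (H (cs ! k, k) (z, g))"
        by (rule NatD(2)[OF H(1)]) (use o t ob[OF x] g in auto)
      then show "K a (Rs ?P a b m p) = Rs (dugger_Q C B) a b m (K b p)"
        unfolding e p' K_def dugger_map_def
        by (simp add: dugger_Rs nth_map_upt[of l "Suc l" 0, simplified] del: upt_Suc)
    qed
  next
    fix a x assume a: "a \<in> Ob (cat_prod C Simp)" and x: "x \<in> El (dugger_Q C B) a"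
    obtain c k where e: "a = (c, k)" by (metis surj_pair)
    obtain cs f fs z where x': "x = (cs, f, fs, z)" by (metis surj_pair)
    note o = ob[OF x[unfolded e x']]
    have v: "vtx k j \<in> Ar Simp k 1" if "j \<le> 1" for j by (rule vtx_in[OF that])
    show "(\<lambda>a\<in>Ob (cat_prod C Simp). \<lambda>p\<in>El ?P a. K a p) a (x, vtx (snd a) 0) = x"
      using a x v[of 0] H(2)[of "(cs ! k, k)" z] o by (simp add: e) (simp add: x' K_def dugger_map_def)
    have "dugger_map r a x \<in> El (dugger_Q C A) a" using NatD(1)[OF n2 a x] a x by simp
    then show "(\<lambda>a\<in>Ob (cat_prod C Simp). \<lambda>p\<in>El ?P a. K a p) a (x, vtx (snd a) 1)
      = (\<lambda>a\<in>Ob (cat_prod C Simp). \<lambda>x\<in>El (dugger_Q C A) a. dugger_map i a x) a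
        ((\<lambda>a\<in>Ob (cat_prod C Simp). \<lambda>x\<in>El (dugger_Q C B) a. dugger_map r a x) a x)"
      using a x v[of 1] H(3)[of "(cs ! k, k)" z] o by (simp add: e) (simp add: x' K_def dugger_map_def)
  qed
qed

end

declare Ob_SimpN [simp del]

lemma SSp_cat: "category (SSp n)"
  by (rule category_cat_prod[OF category_SimpN category_Simp])

lemma css_functorD:
  assumes "css_functor U n F"
  shows "\<And>c. c \<in> Ob Cart \<Longrightarrow> presheaf (SSp n) (FOb F c)"
    "\<And>c p. c \<in> Ob Cart \<Longrightarrow> p \<in> Ob (SSp n) \<Longrightarrow> El (FOb F c) p \<in> U"
    "\<And>c d f. c \<in> Ob Cart \<Longrightarrow> d \<in> Ob Cart \<Longrightarrow> f \<in> Ar Cart c d \<Longrightarrow> FAr F c d f \<in> Nat (SSp n) (FOb F d) (FOb F c)"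
  using assms unfolding css_functor_def presheaf_in_def by blast+

text \<open>The nested function spaces, unfolded: an element is a family that is natural in simplicial
  operators and in maps of test spaces.\<close>

lemma end_El_iff:
  "\<alpha> \<in> El (end_cotensor n Z F) (ms, k) \<longleftrightarrow> \<alpha> \<in> extensional (Ob Cart)
    \<and> (\<forall>c\<in>Ob Cart. \<forall>j. \<alpha> c j \<in> extensional (El Z (c, j) \<times> Ar Simp j k)
         \<and> (\<forall>x\<in>El Z (c, j). \<forall>g\<in>Ar Simp j k. \<alpha> c j (x, g) \<in> El (FOb F c) (ms, j)))
    \<and> (\<forall>c\<in>Ob Cart. \<forall>j j'. \<forall>\<theta>\<in>Ar Simp j j'. \<forall>x\<in>El Z (c, j'). \<forall>g\<in>Ar Simp j' k.
         \<alpha> c j (Rs Z (c, j) (c, j') (Ide Cart c, \<theta>) x, Cmp Simp j j' k g \<theta>)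
           = Rs (FOb F c) (ms, j) (ms, j') (Ide (SimpN n) ms, \<theta>) (\<alpha> c j' (x, g)))
    \<and> (\<forall>c\<in>Ob Cart. \<forall>d\<in>Ob Cart. \<forall>f\<in>Ar Cart c d. \<forall>j. \<forall>x\<in>El Z (d, j). \<forall>g\<in>Ar Simp j k.
         \<alpha> c j (Rs Z (c, j) (d, j) (f, Ide Simp j) x, g) = FAr F c d f (ms, j) (\<alpha> d j (x, g)))"
  unfolding end_cotensor_def cotensor_def SS.map_space_simps Nat_def
  by (auto simp: PiE_iff Pi_iff SS.map_space_simps Nat_def)

lemma end_elim:
  assumes "\<alpha> \<in> El (end_cotensor n Z F) (ms, k)"
  shows "\<And>c j x g. c \<in> Ob Cart \<Longrightarrow> x \<in> El Z (c, j) \<Longrightarrow> g \<in> Ar Simp j k \<Longrightarrow> \<alpha> c j (x, g) \<in> El (FOb F c) (ms, j)"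
    "\<And>c j j' \<theta> x g. c \<in> Ob Cart \<Longrightarrow> \<theta> \<in> Ar Simp j j' \<Longrightarrow> x \<in> El Z (c, j') \<Longrightarrow> g \<in> Ar Simp j' k \<Longrightarrow>
         \<alpha> c j (Rs Z (c, j) (c, j') (Ide Cart c, \<theta>) x, Cmp Simp j j' k g \<theta>)
           = Rs (FOb F c) (ms, j) (ms, j') (Ide (SimpN n) ms, \<theta>) (\<alpha> c j' (x, g))"
    "\<And>c d f j x g. c \<in> Ob Cart \<Longrightarrow> d \<in> Ob Cart \<Longrightarrow> f \<in> Ar Cart c d \<Longrightarrow> x \<in> El Z (d, j) \<Longrightarrow> g \<in> Ar Simp j k \<Longrightarrow>
         \<alpha> c j (Rs Z (c, j) (d, j) (f, Ide Simp j) x, g) = FAr F c d f (ms, j) (\<alpha> d j (x, g))"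
    "\<alpha> \<in> extensional (Ob Cart)"
    "\<And>c j. c \<in> Ob Cart \<Longrightarrow> \<alpha> c j \<in> extensional (El Z (c, j) \<times> Ar Simp j k)"
  using assms unfolding end_El_iff by blast+

lemma end_ext:
  assumes a: "\<alpha> \<in> El (end_cotensor n Z F) (ms, k)" and b: "\<beta> \<in> El (end_cotensor n Z F) (ms, k)"
    and eq: "\<And>c j x g. c \<in> Ob Cart \<Longrightarrow> x \<in> El Z (c, j) \<Longrightarrow> g \<in> Ar Simp j k \<Longrightarrow> \<alpha> c j (x, g) = \<beta> c j (x, g)"
  shows "\<alpha> = \<beta>"
proof (rule extensionalityI[of _ "Ob Cart"])
  show "\<alpha> \<in> extensional (Ob Cart)" "\<beta> \<in> extensional (Ob Cart)"
    by (rule end_elim(4)[OF a], rule end_elim(4)[OF b])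
  fix c assume c: "c \<in> Ob Cart"
  show "\<alpha> c = \<beta> c"
  proof
    fix j
    show "\<alpha> c j = \<beta> c j"
    proof (rule extensionalityI)
      show "\<alpha> c j \<in> extensional (El Z (c, j) \<times> Ar Simp j k)" "\<beta> c j \<in> extensional (El Z (c, j) \<times> Ar Simp j k)"
        by (rule end_elim(5)[OF a c], rule end_elim(5)[OF b c])
    qed (use eq c in auto)
  qed
qed

text \<open>The analogue of \<open>map_space_reparam\<close>, combined with an operator of the target.\<close>

lemma end_reparam:
  assumes F: "css_functor U n F" and Z: "rs_closed CartS Z"
    and \<alpha>: "\<alpha> \<in> El (end_cotensor n Z' F) (ms, k)"
    and \<rho>s: "ls \<in> Ob (SimpN n)" "ms \<in> Ob (SimpN n)" "\<rho>s \<in> Ar (SimpN n) ls ms" and \<rho>: "\<rho> \<in> Ar Simp l k"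
    and \<Phi>: "\<And>c j x g. c \<in> Ob Cart \<Longrightarrow> x \<in> El Z (c, j) \<Longrightarrow> g \<in> Ar Simp j l \<Longrightarrow> \<Phi> c j x g \<in> El Z' (c, j)"
    and nat: "\<And>c d j j' f \<theta> x g. c \<in> Ob Cart \<Longrightarrow> d \<in> Ob Cart \<Longrightarrow> f \<in> Ar Cart c d \<Longrightarrow> \<theta> \<in> Ar Simp j j'
      \<Longrightarrow> x \<in> El Z (d, j') \<Longrightarrow> g \<in> Ar Simp j' l
      \<Longrightarrow> \<Phi> c j (Rs Z (c, j) (d, j') (f, \<theta>) x) (Cmp Simp j j' l g \<theta>) = Rs Z' (c, j) (d, j') (f, \<theta>) (\<Phi> d j' x g)"
  shows "(\<lambda>c\<in>Ob Cart. \<lambda>j. \<lambda>(x, g)\<in>El Z (c, j) \<times> Ar Simp j l.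
      Rs (FOb F c) (ls, j) (ms, j) (\<rho>s, Ide Simp j) (\<alpha> c j (\<Phi> c j x g, Cmp Simp j l k \<rho> g)))
    \<in> El (end_cotensor n Z F) (ls, l)" (is "?\<beta> \<in> _")
proof -
  interpret N: category "SimpN n" by (rule category_SimpN)
  note A = end_elim[OF \<alpha>] and P = css_functorD[OF F]
  have Rs_in: "Rs Z (c, j) (d, j') (f, \<theta>) x \<in> El Z (c, j)"
    if "c \<in> Ob Cart" "d \<in> Ob Cart" "f \<in> Ar Cart c d" "\<theta> \<in> Ar Simp j j'" "x \<in> El Z (d, j')" for c d f j j' \<theta> x
    by (rule rs_closedD[OF Z]) (use that in auto)
  have \<alpha>_in: "\<alpha> c j (\<Phi> c j x g, Cmp Simp j l k \<rho> g) \<in> El (FOb F c) (ms, j)"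
    if "c \<in> Ob Cart" "x \<in> El Z (c, j)" "g \<in> Ar Simp j l" for c j x g
    by (intro A(1) \<Phi> Simp.Cmp_in that) (use \<rho> in auto)
  have \<beta>_simp: "?\<beta> c j (x, g) = Rs (FOb F c) (ls, j) (ms, j) (\<rho>s, Ide Simp j) (\<alpha> c j (\<Phi> c j x g, Cmp Simp j l k \<rho> g))"
    if "c \<in> Ob Cart" "x \<in> El Z (c, j)" "g \<in> Ar Simp j l" for c j x g using that by simp
  have ob: "(ls, j) \<in> Ob (SSp n)" "(ms, j) \<in> Ob (SSp n)" for j using \<rho>s by auto
  show ?thesis unfolding end_El_iff
  proof (intro conjI ballI allI)
    show "?\<beta> \<in> extensional (Ob Cart)" by simp
    fix c assume c: "c \<in> Ob Cart"
    show "?\<beta> c j \<in> extensional (El Z (c, j) \<times> Ar Simp j l)" for j using c by simp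
    show "?\<beta> c j (x, g) \<in> El (FOb F c) (ls, j)" if x: "x \<in> El Z (c, j)" and g: "g \<in> Ar Simp j l" for j x g
      unfolding \<beta>_simp[OF c x g]
      by (rule presheafD(1)[OF P(1)[OF c] ob]) (use \<rho>s \<alpha>_in[OF c x g] in \<open>auto intro: Simp.Ide_in\<close>)
    show "?\<beta> c j (Rs Z (c, j) (c, j') (Ide Cart c, \<theta>) x, Cmp Simp j j' l g \<theta>)
           = Rs (FOb F c) (ls, j) (ls, j') (Ide (SimpN n) ls, \<theta>) (?\<beta> c j' (x, g))"
      if t: "\<theta> \<in> Ar Simp j j'" and x: "x \<in> El Z (c, j')" and g: "g \<in> Ar Simp j' l" for j j' \<theta> x g
    proof -
      let ?y = "\<alpha> c j' (\<Phi> c j' x g, Cmp Simp j' l k \<rho> g)"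
      have x': "Rs Z (c, j) (c, j') (Ide Cart c, \<theta>) x \<in> El Z (c, j)"
        by (rule Rs_in[OF c c Cart.Ide_in[OF c] t x])
      have g': "Cmp Simp j j' l g \<theta> \<in> Ar Simp j l" using t g by (auto intro: Simp.Cmp_in)
      have y: "?y \<in> El (FOb F c) (ms, j')" by (rule \<alpha>_in[OF c x g])
      have "?\<beta> c j (Rs Z (c, j) (c, j') (Ide Cart c, \<theta>) x, Cmp Simp j j' l g \<theta>)
        = Rs (FOb F c) (ls, j) (ms, j) (\<rho>s, Ide Simp j)
          (\<alpha> c j (Rs Z' (c, j) (c, j') (Ide Cart c, \<theta>) (\<Phi> c j' x g), Cmp Simp j j' k (Cmp Simp j' l k \<rho> g) \<theta>))"
        unfolding \<beta>_simp[OF c x' g'] using nat[OF c c Cart.Ide_in[OF c] t x g] t g \<rho> by (simp add: Simp.Cmp_assoc)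
      also have "\<dots> = Rs (FOb F c) (ls, j) (ms, j) (\<rho>s, Ide Simp j)
          (Rs (FOb F c) (ms, j) (ms, j') (Ide (SimpN n) ms, \<theta>) ?y)"
        using A(2)[OF c t \<Phi>[OF c x g]] g \<rho> by (simp add: Simp.Cmp_in)
      also have "\<dots> = Rs (FOb F c) (ls, j) (ms, j') (Cmp (SSp n) (ls, j) (ms, j) (ms, j') (Ide (SimpN n) ms, \<theta>) (\<rho>s, Ide Simp j)) ?y"
        by (rule presheafD(3)[OF P(1)[OF c] ob(1) ob(2) ob(2), symmetric])
          (use \<rho>s t y in \<open>auto intro: Simp.Ide_in N.Ide_in\<close>)
      also have "Cmp (SSp n) (ls, j) (ms, j) (ms, j') (Ide (SimpN n) ms, \<theta>) (\<rho>s, Ide Simp j)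
        = Cmp (SSp n) (ls, j) (ls, j') (ms, j') (\<rho>s, Ide Simp j') (Ide (SimpN n) ls, \<theta>)"
        using \<rho>s t by (simp add: N.Cmp_Ide_left N.Cmp_Ide_right Simp.Cmp_Ide_left Simp.Cmp_Ide_right )
      also have "Rs (FOb F c) (ls, j) (ms, j') \<dots> ?y = Rs (FOb F c) (ls, j) (ls, j') (Ide (SimpN n) ls, \<theta>)
         (Rs (FOb F c) (ls, j') (ms, j') (\<rho>s, Ide Simp j') ?y)"
        by (rule presheafD(3)[OF P(1)[OF c] ob(1) ob(1) ob(2)])
          (use \<rho>s t y in \<open>auto intro: Simp.Ide_in N.Ide_in\<close>)
      finally show ?thesis unfolding \<beta>_simp[OF c x g] .
    qed
    fix d assume d: "d \<in> Ob Cart"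
    show "?\<beta> c j (Rs Z (c, j) (d, j) (f, Ide Simp j) x, g) = FAr F c d f (ls, j) (?\<beta> d j (x, g))"
      if f: "f \<in> Ar Cart c d" and x: "x \<in> El Z (d, j)" and g: "g \<in> Ar Simp j l" for f j x g
    proof -
      let ?y = "\<alpha> d j (\<Phi> d j x g, Cmp Simp j l k \<rho> g)"
      have y: "?y \<in> El (FOb F d) (ms, j)" by (rule \<alpha>_in[OF d x g])
      have Ij: "Ide Simp j \<in> Ar Simp j j" by (rule Simp.Ide_in) simp
      have x': "Rs Z (c, j) (d, j) (f, Ide Simp j) x \<in> El Z (c, j)" by (rule Rs_in[OF c d f Ij x])
      have gi: "Cmp Simp j j l g (Ide Simp j) = g" by (rule Simp.Cmp_Ide_right) (use g in auto)
      have "?\<beta> c j (Rs Z (c, j) (d, j) (f, Ide Simp j) x, g)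
        = Rs (FOb F c) (ls, j) (ms, j) (\<rho>s, Ide Simp j)
          (\<alpha> c j (Rs Z' (c, j) (d, j) (f, Ide Simp j) (\<Phi> d j x g), Cmp Simp j l k \<rho> g))"
        unfolding \<beta>_simp[OF c x' g] using nat[OF c d f Ij x g] by (simp add: gi)
      also have "\<dots> = Rs (FOb F c) (ls, j) (ms, j) (\<rho>s, Ide Simp j) (FAr F c d f (ms, j) ?y)"
        using A(3)[OF c d f \<Phi>[OF d x g]] g \<rho> by (simp add: Simp.Cmp_in)
      also have "\<dots> = FAr F c d f (ls, j) (Rs (FOb F d) (ls, j) (ms, j) (\<rho>s, Ide Simp j) ?y)"
        by (rule NatD(2)[OF P(3)[OF c d f] ob, symmetric]) (use \<rho>s y Ij in auto)
      finally show ?thesis unfolding \<beta>_simp[OF d x g] .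
    qed
  qed
qed

lemma end_Rs:
  "Rs (end_cotensor n Z F) (ls, l) (ms, k) (\<rho>s, \<rho>) \<alpha> = (\<lambda>c\<in>Ob Cart. \<lambda>j. \<lambda>(x, g)\<in>El Z (c, j) \<times> Ar Simp j l.
     Rs (FOb F c) (ls, j) (ms, j) (\<rho>s, Ide Simp j) (\<alpha> c j (x, Cmp Simp j l k \<rho> g)))"
  by (simp add: end_cotensor_def cotensor_def restrict_UNIV)

lemma presheaf_end:
  assumes F: "css_functor U n F" and Z: "rs_closed CartS Z"
  shows "presheaf (SSp n) (end_cotensor n Z F)"
proof -
  interpret N: category "SimpN n" by (rule category_SimpN)
  let ?E = "end_cotensor n Z F"
  note P = css_functorD[OF F]
  have cl: "Rs ?E (ls, l) (ms, k) (\<rho>s, \<rho>) \<alpha> \<in> El ?E (ls, l)"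
    if "ls \<in> Ob (SimpN n)" "ms \<in> Ob (SimpN n)" "\<rho>s \<in> Ar (SimpN n) ls ms" "\<rho> \<in> Ar Simp l k" "\<alpha> \<in> El ?E (ms, k)"
    for ls l ms k \<rho>s \<rho> \<alpha>
    unfolding end_Rs by (rule end_reparam[OF F Z that(5,1-4), of "\<lambda>c j x g. x"]) auto
  show ?thesis unfolding presheaf_def
  proof (intro conjI ballI)
    fix p q m assume "p \<in> Ob (SSp n)" "q \<in> Ob (SSp n)" "m \<in> Ar (SSp n) p q"
    then show "Rs ?E p q m \<in> El ?E q \<rightarrow> El ?E p" by (cases p; cases q; cases m) (auto intro!: cl)
  next
    fix p \<alpha> assume p: "p \<in> Ob (SSp n)" and \<alpha>: "\<alpha> \<in> El ?E p"
    obtain ms k where e: "p = (ms, k)" by (cases p)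
    have ms: "ms \<in> Ob (SimpN n)" using p by (simp add: e)
    note \<alpha> = \<alpha>[unfolded e]
    have "Rs ?E (ms, k) (ms, k) (Ide (SimpN n) ms, Ide Simp k) \<alpha> = \<alpha>"
    proof (rule end_ext[OF cl[OF ms ms N.Ide_in[OF ms] Simp.Ide_in \<alpha>] \<alpha>])
      fix c j x g assume c: "c \<in> Ob Cart" and x: "x \<in> El Z (c, j)" and g: "g \<in> Ar Simp j k"
      show "Rs ?E (ms, k) (ms, k) (Ide (SimpN n) ms, Ide Simp k) \<alpha> c j (x, g) = \<alpha> c j (x, g)"
        using presheafD(2)[OF P(1)[OF c], of "(ms, j)" "\<alpha> c j (x, g)"] end_elim(1)[OF \<alpha> c x g] ms c x g
        by (simp add: end_Rs Simp.Cmp_Ide_left)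
    qed simp
    then show "Rs ?E p p (Ide (SSp n) p) \<alpha> = \<alpha>" by (simp add: e)
  next
    fix p q r m m' \<alpha> assume p: "p \<in> Ob (SSp n)" "q \<in> Ob (SSp n)" "r \<in> Ob (SSp n)"
      and m: "m \<in> Ar (SSp n) p q" "m' \<in> Ar (SSp n) q r" and \<alpha>: "\<alpha> \<in> El ?E r"
    obtain ks j ls l ms k \<rho>s \<rho> \<sigma>s \<sigma> where e: "p = (ks, j)" "q = (ls, l)" "r = (ms, k)" "m = (\<rho>s, \<rho>)" "m' = (\<sigma>s, \<sigma>)"
      by (metis surj_pair)
    have ob: "ks \<in> Ob (SimpN n)" "ls \<in> Ob (SimpN n)" "ms \<in> Ob (SimpN n)" using p by (auto simp: e)
    have ar: "\<rho>s \<in> Ar (SimpN n) ks ls" "\<rho> \<in> Ar Simp j l" "\<sigma>s \<in> Ar (SimpN n) ls ms" "\<sigma> \<in> Ar Simp l k"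
      using m by (auto simp: e)
    note \<alpha> = \<alpha>[unfolded e]
    have c1: "Cmp (SimpN n) ks ls ms \<sigma>s \<rho>s \<in> Ar (SimpN n) ks ms" by (rule N.Cmp_in[OF ob ar(1,3)])
    have c2: "Cmp Simp j l k \<sigma> \<rho> \<in> Ar Simp j k" using ar by (intro Simp.Cmp_in) auto
    note b = cl[OF ob(2,3) ar(3,4) \<alpha>]
    have "Rs ?E (ks, j) (ms, k) (Cmp (SimpN n) ks ls ms \<sigma>s \<rho>s, Cmp Simp j l k \<sigma> \<rho>) \<alpha>
      = Rs ?E (ks, j) (ls, l) (\<rho>s, \<rho>) (Rs ?E (ls, l) (ms, k) (\<sigma>s, \<sigma>) \<alpha>)"
    proof (rule end_ext[OF cl[OF ob(1,3) c1 c2 \<alpha>] cl[OF ob(1,2) ar(1,2) b]])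
      fix c i x g assume c: "c \<in> Ob Cart" and x: "x \<in> El Z (c, i)" and g: "g \<in> Ar Simp i j"
      have Ii: "Ide Simp i \<in> Ar Simp i i" by (rule Simp.Ide_in) simp
      have g1: "Cmp Simp i j l \<rho> g \<in> Ar Simp i l" using ar g by (intro Simp.Cmp_in) auto
      have g2: "Cmp Simp i l k \<sigma> (Cmp Simp i j l \<rho> g) \<in> Ar Simp i k" by (rule Simp.Cmp_in[OF _ _ _ g1 ar(4)]) auto
      let ?y = "\<alpha> c i (x, Cmp Simp i l k \<sigma> (Cmp Simp i j l \<rho> g))"
      have y: "?y \<in> El (FOb F c) (ms, i)" by (rule end_elim(1)[OF \<alpha> c x g2])
      have "Rs (FOb F c) (ks, i) (ms, i) (Cmp (SSp n) (ks, i) (ls, i) (ms, i) (\<sigma>s, Ide Simp i) (\<rho>s, Ide Simp i)) ?y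
        = Rs (FOb F c) (ks, i) (ls, i) (\<rho>s, Ide Simp i) (Rs (FOb F c) (ls, i) (ms, i) (\<sigma>s, Ide Simp i) ?y)"
        by (rule presheafD(3)[OF P(1)[OF c]]) (use ob ar Ii y in auto)
      then show "Rs ?E (ks, j) (ms, k) (Cmp (SimpN n) ks ls ms \<sigma>s \<rho>s, Cmp Simp j l k \<sigma> \<rho>) \<alpha> c i (x, g)
        = Rs ?E (ks, j) (ls, l) (\<rho>s, \<rho>) (Rs ?E (ls, l) (ms, k) (\<sigma>s, \<sigma>) \<alpha>) c i (x, g)"
        using c x g g1 Ii ar by (simp add: end_Rs Simp.Cmp_assoc Simp.Cmp_Ide_left)
    qed
    then show "Rs ?E p r (Cmp (SSp n) p q r m' m) \<alpha> = Rs ?E p q m (Rs ?E q r m' \<alpha>)" by (simp add: e)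
  qed
qed

text \<open>Precomposition of an element of the end with \<open>\<Phi>\<close>, which may depend on the simplex \<open>g\<close>.\<close>

definition end_reindex :: "nat \<Rightarrow> 'V ffun \<Rightarrow> (pt set \<times> nat, (pt \<Rightarrow> pt) \<times> (nat \<Rightarrow> nat), 'e) psh
    \<Rightarrow> (pt set \<Rightarrow> nat \<Rightarrow> 'e \<Rightarrow> (nat \<Rightarrow> nat) \<Rightarrow> 'd) \<Rightarrow> nat \<Rightarrow> (pt set \<Rightarrow> nat \<Rightarrow> 'd \<times> (nat \<Rightarrow> nat) \<Rightarrow> 'V)
    \<Rightarrow> pt set \<Rightarrow> nat \<Rightarrow> 'e \<times> (nat \<Rightarrow> nat) \<Rightarrow> 'V" where
  "end_reindex n F Z \<Phi> l \<alpha> = (\<lambda>c\<in>Ob Cart. \<lambda>j. \<lambda>(x, g)\<in>El Z (c, j) \<times> Ar Simp j l. \<alpha> c j (\<Phi> c j x g, g))"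

lemma end_reindex_in:
  assumes F: "css_functor U n F" and Z: "rs_closed CartS Z"
    and \<alpha>: "\<alpha> \<in> El (end_cotensor n Z' F) (ms, l)" and ms: "ms \<in> Ob (SimpN n)"
    and \<Phi>: "\<And>c j x g. c \<in> Ob Cart \<Longrightarrow> x \<in> El Z (c, j) \<Longrightarrow> g \<in> Ar Simp j l \<Longrightarrow> \<Phi> c j x g \<in> El Z' (c, j)"
    and nat: "\<And>c d j j' f \<theta> x g. c \<in> Ob Cart \<Longrightarrow> d \<in> Ob Cart \<Longrightarrow> f \<in> Ar Cart c d \<Longrightarrow> \<theta> \<in> Ar Simp j j'
      \<Longrightarrow> x \<in> El Z (d, j') \<Longrightarrow> g \<in> Ar Simp j' l
      \<Longrightarrow> \<Phi> c j (Rs Z (c, j) (d, j') (f, \<theta>) x) (Cmp Simp j j' l g \<theta>) = Rs Z' (c, j) (d, j') (f, \<theta>) (\<Phi> d j' x g)"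
  shows "end_reindex n F Z \<Phi> l \<alpha> \<in> El (end_cotensor n Z F) (ms, l)"
proof -
  interpret N: category "SimpN n" by (rule category_SimpN)
  note P = css_functorD[OF F]
  have "end_reindex n F Z \<Phi> l \<alpha> = (\<lambda>c\<in>Ob Cart. \<lambda>j. \<lambda>(x, g)\<in>El Z (c, j) \<times> Ar Simp j l.
      Rs (FOb F c) (ms, j) (ms, j) (Ide (SimpN n) ms, Ide Simp j) (\<alpha> c j (\<Phi> c j x g, Cmp Simp j l l (Ide Simp l) g)))"
  proof -
    have "Rs (FOb F c) (ms, j) (ms, j) (Ide (SimpN n) ms, Ide Simp j)
        (\<alpha> c j (\<Phi> c j x g, Cmp Simp j l l (Ide Simp l) g)) = \<alpha> c j (\<Phi> c j x g, g)"
      if c: "c \<in> Ob Cart" and x: "x \<in> El Z (c, j)" and g: "g \<in> Ar Simp j l" for c j x g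
      using presheafD(2)[OF P(1)[OF c], of "(ms, j)"] end_elim(1)[OF \<alpha> c \<Phi>[OF c x g] g] ms g
      by (simp add: Simp.Cmp_Ide_left)
    then show ?thesis unfolding end_reindex_def by (auto simp: fun_eq_iff restrict_def)
  qed
  also have "\<dots> \<in> El (end_cotensor n Z F) (ms, l)"
    by (rule end_reparam[OF F Z \<alpha> ms ms N.Ide_in[OF ms] _ \<Phi> nat]) (auto intro: Simp.Ide_in)
  finally show ?thesis .
qed

lemma end_reindex_apply:
  "c \<in> Ob Cart \<Longrightarrow> x \<in> El Z (c, j) \<Longrightarrow> g \<in> Ar Simp j l \<Longrightarrow> end_reindex n F Z \<Phi> l \<alpha> c j (x, g) = \<alpha> c j (\<Phi> c j x g, g)"
  by (simp add: end_reindex_def)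

definition end_pre where
  "end_pre n F Z Z' t = (\<lambda>p\<in>Ob (SSp n). \<lambda>\<alpha>\<in>El (end_cotensor n Z' F) p.
     end_reindex n F Z (\<lambda>c j x g. t (c, j) x) (snd p) \<alpha>)"

lemma end_pre_in:
  assumes F: "css_functor U n F" and Z: "rs_closed CartS Z" and t: "t \<in> Nat CartS Z Z'"
    and ms: "ms \<in> Ob (SimpN n)" and \<alpha>: "\<alpha> \<in> El (end_cotensor n Z' F) (ms, k)"
  shows "end_reindex n F Z (\<lambda>c j x g. t (c, j) x) k \<alpha> \<in> El (end_cotensor n Z F) (ms, k)"
  by (rule end_reindex_in[OF F Z \<alpha> ms]) (use NatD[OF t] in auto)

lemma end_pre_Nat:
  assumes F: "css_functor U n F" and Z: "rs_closed CartS Z" "rs_closed CartS Z'" and t: "t \<in> Nat CartS Z Z'"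
  shows "end_pre n F Z Z' t \<in> Nat (SSp n) (end_cotensor n Z' F) (end_cotensor n Z F)"
  unfolding end_pre_def
proof (rule NatI[OF presheaf_rs_closed[OF presheaf_end[OF F Z(2)]]])
  fix p \<alpha> assume "p \<in> Ob (SSp n)" "\<alpha> \<in> El (end_cotensor n Z' F) p"
  then show "end_reindex n F Z (\<lambda>c j x g. t (c, j) x) (snd p) \<alpha> \<in> El (end_cotensor n Z F) p"
    by (cases p) (auto intro!: end_pre_in[OF F Z(1) t])
next
  fix p q m \<alpha> assume p: "p \<in> Ob (SSp n)" "q \<in> Ob (SSp n)" "m \<in> Ar (SSp n) p q"
    and \<alpha>: "\<alpha> \<in> El (end_cotensor n Z' F) q"
  obtain ls l ms k \<rho>s \<rho> where e: "p = (ls, l)" "q = (ms, k)" "m = (\<rho>s, \<rho>)" by (metis surj_pair)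
  have "t (c, j) x \<in> El Z' (c, j)" if "c \<in> Ob Cart" "x \<in> El Z (c, j)" for c j x
    using NatD(1)[OF t, of "(c, j)" x] that by simp
  moreover have "Cmp Simp j l k \<rho> g \<in> Ar Simp j k" if "g \<in> Ar Simp j l" for j g
    using p that by (auto simp: e intro: Simp.Cmp_in)
  ultimately show "end_reindex n F Z (\<lambda>c j x g. t (c, j) x) (snd p) (Rs (end_cotensor n Z' F) p q m \<alpha>)
    = Rs (end_cotensor n Z F) p q m (end_reindex n F Z (\<lambda>c j x g. t (c, j) x) (snd q) \<alpha>)"
    by (auto simp: e end_Rs end_reindex_def fun_eq_iff restrict_def)
qed

text \<open>The homotopy is given by the same formula as for mapping spaces.\<close>

lemma homotopy_retract_end:
  assumes F: "css_functor U n F" and R: "over_Simp.homotopy_retract CartS snd snd A B i r"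
  shows "over_Simp.homotopy_retract (SSp n) snd snd (end_cotensor n A F) (end_cotensor n B F)
    (end_pre n F B A r) (end_pre n F A B i)"
proof -
  interpret P: over_Simp CartS snd snd by (rule over_Simp_snd[OF category_Cart])
  interpret Q: over_Simp "SSp n" snd snd by (rule over_Simp_SSp)
  note D = P.homotopy_retractD[OF R]
  obtain H where H: "H \<in> Nat CartS (psh_prod B (simplex_over snd snd 1)) B"
    "\<And>a x. a \<in> Ob CartS \<Longrightarrow> x \<in> El B a \<Longrightarrow> H a (x, vtx (snd a) 0) = x"
    "\<And>a x. a \<in> Ob CartS \<Longrightarrow> x \<in> El B a \<Longrightarrow> H a (x, vtx (snd a) 1) = i a (r a x)"
    by (rule P.homotopy_retract_homotopy[OF R], rule that) assumption+
  let ?EA = "end_cotensor n A F" and ?EB = "end_cotensor n B F"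
  let ?P = "psh_prod ?EB (simplex_over snd snd 1)"
  define \<Phi> where "\<Phi> k h = (\<lambda>c j x g. H (c, j) (x, Cmp Simp j k 1 h g))" for k h
  have \<Phi>_in: "\<Phi> k h c j x g \<in> El B (c, j)"
    if "c \<in> Ob Cart" "x \<in> El B (c, j)" "g \<in> Ar Simp j k" "h \<in> Ar Simp k 1" for k h c j x g
    unfolding \<Phi>_def by (rule NatD(1)[OF H(1)]) (use that in \<open>auto intro: Simp.Cmp_in\<close>)
  have \<Phi>_nat: "\<Phi> k h c j (Rs B (c, j) (d, j') (f, \<theta>) x) (Cmp Simp j j' k g \<theta>) = Rs B (c, j) (d, j') (f, \<theta>) (\<Phi> k h d j' x g)"
    if "c \<in> Ob Cart" "d \<in> Ob Cart" "f \<in> Ar Cart c d" "\<theta> \<in> Ar Simp j j'" "x \<in> El B (d, j')" "g \<in> Ar Simp j' k"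
      "h \<in> Ar Simp k 1" for k h c d j j' f \<theta> x g
  proof -
    have "H (c, j) (Rs (psh_prod B (simplex_over snd snd 1)) (c, j) (d, j') (f, \<theta>) (x, Cmp Simp j' k 1 h g))
      = Rs B (c, j) (d, j') (f, \<theta>) (H (d, j') (x, Cmp Simp j' k 1 h g))"
      by (rule NatD(2)[OF H(1)]) (use that in \<open>auto intro: Simp.Cmp_in\<close>)
    then show ?thesis using that by (simp add: \<Phi>_def Simp.Cmp_assoc)
  qed
  have K_in: "end_reindex n F B (\<Phi> k h) k \<alpha> \<in> El ?EB (ms, k)"
    if "ms \<in> Ob (SimpN n)" "\<alpha> \<in> El ?EB (ms, k)" "h \<in> Ar Simp k 1" for ms k \<alpha> h
    by (rule end_reindex_in[OF F D(2) that(2,1)]) (use \<Phi>_in \<Phi>_nat that in auto)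
  define K where "K p \<alpha>h = (case \<alpha>h of (\<alpha>, h) \<Rightarrow> end_reindex n F B (\<Phi> (snd p) h) (snd p) \<alpha>)"
    for p :: "nat list \<times> nat" and \<alpha>h
  have i_in: "i (c, j) x \<in> El B (c, j)" if "c \<in> Ob Cart" "x \<in> El A (c, j)" for c j x
    using NatD(1)[OF D(3), of "(c, j)" x] that by simp
  have r_in: "r (c, j) x \<in> El A (c, j)" if "c \<in> Ob Cart" "x \<in> El B (c, j)" for c j x
    using NatD(1)[OF D(4), of "(c, j)" x] that by simp
  note nr = end_pre_Nat[OF F D(2,1,4)] and ni = end_pre_Nat[OF F D(1,2,3)]
  show ?thesis
  proof (rule Q.homotopy_retractI[where H = "\<lambda>p\<in>Ob (SSp n). \<lambda>\<alpha>h\<in>El ?P p. K p \<alpha>h",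
      OF presheaf_rs_closed[OF presheaf_end[OF F D(1)]] presheaf_rs_closed[OF presheaf_end[OF F D(2)]] nr ni])
    fix p \<alpha> assume p: "p \<in> Ob (SSp n)" and \<alpha>: "\<alpha> \<in> El ?EA p"
    obtain ms k where e: "p = (ms, k)" by (cases p)
    have ms: "ms \<in> Ob (SimpN n)" using p by (simp add: e)
    note \<alpha>' = \<alpha>[unfolded e]
    note s1 = end_pre_in[OF F D(2,4) ms \<alpha>']
    show "end_pre n F A B i p (end_pre n F B A r p \<alpha>) = \<alpha>"
    proof (rule end_ext[where ms = ms and k = k, OF _ \<alpha>'])
      show "end_pre n F A B i p (end_pre n F B A r p \<alpha>) \<in> El ?EA (ms, k)"
        using NatD(1)[OF ni p NatD(1)[OF nr p \<alpha>]] by (simp add: e)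
      fix c j x g assume "c \<in> Ob Cart" "x \<in> El A (c, j)" "g \<in> Ar Simp j k"
      then show "end_pre n F A B i p (end_pre n F B A r p \<alpha>) c j (x, g) = \<alpha> c j (x, g)"
        using ms \<alpha>' s1 i_in D(5)[of "(c, j)" x] by (simp add: e end_pre_def end_reindex_apply)
    qed
  next
    show "(\<lambda>p\<in>Ob (SSp n). \<lambda>\<alpha>h\<in>El ?P p. K p \<alpha>h) \<in> Nat (SSp n) ?P ?EB"
    proof (rule NatI[OF Q.rs_closed_simplex_prod[OF presheaf_rs_closed[OF presheaf_end[OF F D(2)]]]])
      fix p q assume "p \<in> Ob (SSp n)" "q \<in> El ?P p"
      then show "K p q \<in> El ?EB p" by (cases p; cases q) (auto simp: K_def intro!: K_in)
    next
      fix p q m \<alpha>h assume p: "p \<in> Ob (SSp n)" "q \<in> Ob (SSp n)" "m \<in> Ar (SSp n) p q" and ah: "\<alpha>h \<in> El ?P q"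
      obtain ls l ms k \<rho>s \<rho> \<alpha> h where e: "p = (ls, l)" "q = (ms, k)" "m = (\<rho>s, \<rho>)" "\<alpha>h = (\<alpha>, h)" by (metis surj_pair)
      have ar: "\<rho> \<in> Ar Simp l k" "h \<in> Ar Simp k 1" using p ah by (auto simp: e)
      have hl: "Cmp Simp l k 1 h \<rho> \<in> Ar Simp l 1" using ar by (intro Simp.Cmp_in) auto
      have "\<Phi> l (Cmp Simp l k 1 h \<rho>) c j x g = \<Phi> k h c j x (Cmp Simp j l k \<rho> g)" if "g \<in> Ar Simp j l" for c j x g
        using ar that by (simp add: \<Phi>_def Simp.Cmp_assoc)
      moreover have "Cmp Simp j l k \<rho> g \<in> Ar Simp j k" if "g \<in> Ar Simp j l" for j g
        using ar that by (auto intro: Simp.Cmp_in)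
      moreover have "\<Phi> k h c j x (Cmp Simp j l k \<rho> g) \<in> El B (c, j)"
        if "c \<in> Ob Cart" "x \<in> El B (c, j)" "g \<in> Ar Simp j l" for c j x g
        using that ar by (intro \<Phi>_in) (auto intro: Simp.Cmp_in)
      ultimately show "K p (Rs ?P p q m \<alpha>h) = Rs ?EB p q m (K q \<alpha>h)"
        by (auto simp: e K_def end_Rs end_reindex_def fun_eq_iff restrict_def)
    qed
  next
    fix p \<alpha> assume p: "p \<in> Ob (SSp n)" and \<alpha>: "\<alpha> \<in> El ?EB p"
    obtain ms k where e: "p = (ms, k)" by (cases p)
    have ms: "ms \<in> Ob (SimpN n)" using p by (simp add: e)
    note \<alpha>' = \<alpha>[unfolded e]
    have v: "vtx k j \<in> Ar Simp k 1" if "j \<le> 1" for j by (rule vtx_in[OF that])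
    have \<Phi>v: "\<Phi> k (vtx k 0) c j x g = x" "\<Phi> k (vtx k 1) c j x g = i (c, j) (r (c, j) x)"
      if "c \<in> Ob Cart" "x \<in> El B (c, j)" "g \<in> Ar Simp j k" for c j x g
      using that H(2,3)[of "(c, j)" x] by (auto simp: \<Phi>_def Cmp_vtx)
    show "(\<lambda>p\<in>Ob (SSp n). \<lambda>\<alpha>h\<in>El ?P p. K p \<alpha>h) p (\<alpha>, vtx (snd p) 0) = \<alpha>"
    proof (rule end_ext[where ms = ms and k = k, OF _ \<alpha>'])
      show "(\<lambda>p\<in>Ob (SSp n). \<lambda>\<alpha>h\<in>El ?P p. K p \<alpha>h) p (\<alpha>, vtx (snd p) 0) \<in> El ?EB (ms, k)"
        using K_in[OF ms \<alpha>' v[of 0]] ms \<alpha>' v[of 0] by (simp add: e K_def)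
      fix c j x g assume "c \<in> Ob Cart" "x \<in> El B (c, j)" "g \<in> Ar Simp j k"
      then show "(\<lambda>p\<in>Ob (SSp n). \<lambda>\<alpha>h\<in>El ?P p. K p \<alpha>h) p (\<alpha>, vtx (snd p) 0) c j (x, g) = \<alpha> c j (x, g)"
        using ms \<alpha>' v[of 0] \<Phi>v(1) by (simp add: e K_def end_reindex_apply)
    qed
    note s1 = end_pre_in[OF F D(1,3) ms \<alpha>']
    show "(\<lambda>p\<in>Ob (SSp n). \<lambda>\<alpha>h\<in>El ?P p. K p \<alpha>h) p (\<alpha>, vtx (snd p) 1) = end_pre n F B A r p (end_pre n F A B i p \<alpha>)"
    proof (rule end_ext[where ms = ms and k = k])
      show "(\<lambda>p\<in>Ob (SSp n). \<lambda>\<alpha>h\<in>El ?P p. K p \<alpha>h) p (\<alpha>, vtx (snd p) 1) \<in> El ?EB (ms, k)"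
        using K_in[OF ms \<alpha>' v[of 1]] ms \<alpha>' v[of 1] by (simp add: e K_def)
      show "end_pre n F B A r p (end_pre n F A B i p \<alpha>) \<in> El ?EB (ms, k)"
        using NatD(1)[OF nr p NatD(1)[OF ni p \<alpha>]] by (simp add: e)
      fix c j x g assume "c \<in> Ob Cart" "x \<in> El B (c, j)" "g \<in> Ar Simp j k"
      then show "(\<lambda>p\<in>Ob (SSp n). \<lambda>\<alpha>h\<in>El ?P p. K p \<alpha>h) p (\<alpha>, vtx (snd p) 1) c j (x, g)
        = end_pre n F B A r p (end_pre n F A B i p \<alpha>) c j (x, g)"
        using ms \<alpha>' v[of 1] \<Phi>v(2) s1 r_in by (simp add: e K_def end_pre_def end_reindex_apply)
    qed
  qed
qed

lemma (in set_universe) encoding: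
  fixes X :: "('o, 'm, 'e) psh"
  assumes "\<And>a. a \<in> Ob C \<Longrightarrow> small U (El X a)"
  shows "\<And>a. a \<in> Ob C \<Longrightarrow> inj_on (encoding U C X a) (El X a)"
    "\<And>a. a \<in> Ob C \<Longrightarrow> encoding U C X a ` El X a \<in> U"
proof -
  have "\<forall>a\<in>Ob C. \<exists>e. inj_on e (El X a) \<and> e ` El X a \<in> U"
    using assms unfolding small_def bij_betw_def by blast
  from bchoice[OF this] have "\<exists>e. \<forall>a\<in>Ob C. inj_on (e a) (El X a) \<and> e a ` El X a \<in> U" .
  then have "\<forall>a\<in>Ob C. inj_on (encoding U C X a) (El X a) \<and> encoding U C X a ` El X a \<in> U"
    unfolding encoding_def by (rule someI_ex)
  then show "\<And>a. a \<in> Ob C \<Longrightarrow> inj_on (encoding U C X a) (El X a)"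
    "\<And>a. a \<in> Ob C \<Longrightarrow> encoding U C X a ` El X a \<in> U" by blast+
qed

lemma copy_El: "El (copy_in U C X) a = encoding U C X a ` El X a"
  by (simp add: copy_in_def Let_def)

lemma (in set_universe) copy_Rs:
  assumes "\<And>a. a \<in> Ob C \<Longrightarrow> small U (El X a)" "b \<in> Ob C" "x \<in> El X b"
  shows "Rs (copy_in U C X) a b f (encoding U C X b x) = encoding U C X a (Rs X a b f x)"
  using encoding(1)[of C X, OF assms(1,2)] assms(3) by (simp add: copy_in_def Let_def)

lemma (in set_universe) presheaf_in_copy:
  assumes C: "category C" and X: "presheaf C X" and s: "\<And>a. a \<in> Ob C \<Longrightarrow> small U (El X a)"
  shows "presheaf_in U C (copy_in U C X)"
proof -
  interpret C: category C by fact
  note R = copy_Rs[of C X, OF s] and P = presheafD[OF X]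
  show ?thesis unfolding presheaf_in_def presheaf_def
    using encoding(2)[of C X, OF s] by (auto simp: copy_El R P C.Cmp_in)
qed

text \<open>Copies in a universe are isomorphic to the original, so everything is transported along the
  bijections \<open>eA\<close> and \<open>eB\<close>.\<close>

lemma (in set_universe) homotopy_retract_copy:
  assumes C: "over_Simp C dO dA" and R: "over_Simp.homotopy_retract C dO dA A B i r"
    and sA: "\<And>a. a \<in> Ob C \<Longrightarrow> small U (El A a)" and sB: "\<And>a. a \<in> Ob C \<Longrightarrow> small U (El B a)"
  shows "\<exists>i' r'. over_Simp.homotopy_retract C dO dA (copy_in U C A) (copy_in U C B) i' r'"
proof -
  interpret C: over_Simp C dO dA by fact
  note D = C.homotopy_retractD[OF R]
  obtain H where H: "H \<in> Nat C (psh_prod B (simplex_over dO dA 1)) B"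
    "\<And>a x. a \<in> Ob C \<Longrightarrow> x \<in> El B a \<Longrightarrow> H a (x, vtx (dO a) 0) = x"
    "\<And>a x. a \<in> Ob C \<Longrightarrow> x \<in> El B a \<Longrightarrow> H a (x, vtx (dO a) 1) = i a (r a x)"
    by (rule C.homotopy_retract_homotopy[OF R], rule that) assumption+
  let ?A = "copy_in U C A" and ?B = "copy_in U C B"
  define eA where "eA = encoding U C A"
  define eB where "eB = encoding U C B"
  define dA' where "dA' a = inv_into (El A a) (eA a)" for a
  define dB' where "dB' a = inv_into (El B a) (eB a)" for a
  have dA: "dA' a (eA a x) = x" if "a \<in> Ob C" "x \<in> El A a" for a x
    using that encoding(1)[of C A, OF sA] by (simp add: dA'_def eA_def)
  have dB: "dB' a (eB a x) = x" if "a \<in> Ob C" "x \<in> El B a" for a x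
    using that encoding(1)[of C B, OF sB] by (simp add: dB'_def eB_def)
  have EA: "El ?A a = eA a ` El A a" and EB: "El ?B a = eB a ` El B a" for a by (simp_all add: copy_El eA_def eB_def)
  have RA: "Rs ?A a b f (eA b x) = eA a (Rs A a b f x)" if "b \<in> Ob C" "x \<in> El A b" for a b f x
    unfolding eA_def by (rule copy_Rs[OF sA that])
  have RB: "Rs ?B a b f (eB b x) = eB a (Rs B a b f x)" if "b \<in> Ob C" "x \<in> El B b" for a b f x
    unfolding eB_def by (rule copy_Rs[OF sB that])
  note rA = rs_closedD[OF D(1)] and rB = rs_closedD[OF D(2)]
  have cA: "rs_closed C ?A" unfolding rs_closed_def EA by (auto simp: RA rA)
  have cB: "rs_closed C ?B" unfolding rs_closed_def EB by (auto simp: RB rB)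
  note i = NatD[OF D(3)] and r = NatD[OF D(4)]
  let ?P = "psh_prod ?B (simplex_over dO dA 1)"
  let ?i = "\<lambda>a\<in>Ob C. \<lambda>v\<in>El ?A a. eB a (i a (dA' a v))"
  let ?r = "\<lambda>a\<in>Ob C. \<lambda>v\<in>El ?B a. eA a (r a (dB' a v))"
  let ?H = "\<lambda>a\<in>Ob C. \<lambda>p\<in>El ?P a. eB a (H a (dB' a (fst p), snd p))"
  have Hin: "H a (x, g) \<in> El B a" if "a \<in> Ob C" "x \<in> El B a" "g \<in> Ar Simp (dO a) 1" for a x g
    using NatD(1)[OF H(1), of a "(x, g)"] that by simp
  have Hnat: "H a (Rs B a b f x, Cmp Simp (dO a) (dO b) 1 g (dA f)) = Rs B a b f (H b (x, g))"
    if "a \<in> Ob C" "b \<in> Ob C" "f \<in> Ar C a b" "x \<in> El B b" "g \<in> Ar Simp (dO b) 1" for a b f x g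
    using NatD(2)[OF H(1), of a b f "(x, g)"] that by simp
  have "C.homotopy_retract ?A ?B ?i ?r"
  proof (rule C.homotopy_retractI[where H = ?H, OF cA cB])
    show "?i \<in> Nat C ?A ?B"
    proof (rule NatI[OF cA])
      show "eB a (i a (dA' a v)) \<in> El ?B a" if "a \<in> Ob C" "v \<in> El ?A a" for a v
        using that i(1) by (auto simp: EA EB dA)
      show "eB a (i a (dA' a (Rs ?A a b f v))) = Rs ?B a b f (eB b (i b (dA' b v)))"
        if "a \<in> Ob C" "b \<in> Ob C" "f \<in> Ar C a b" "v \<in> El ?A b" for a b f v
        using that i by (auto simp: EA dA RA RB rA)
    qed
    show "?r \<in> Nat C ?B ?A"
    proof (rule NatI[OF cB])
      show "eA a (r a (dB' a v)) \<in> El ?A a" if "a \<in> Ob C" "v \<in> El ?B a" for a v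
        using that r(1) by (auto simp: EA EB dB)
      show "eA a (r a (dB' a (Rs ?B a b f v))) = Rs ?A a b f (eA b (r b (dB' b v)))"
        if "a \<in> Ob C" "b \<in> Ob C" "f \<in> Ar C a b" "v \<in> El ?B b" for a b f v
        using that r by (auto simp: EB dB RA RB rB)
    qed
    show "?r a (?i a v) = v" if "a \<in> Ob C" "v \<in> El ?A a" for a v
    proof -
      from that(2) obtain x where v: "v = eA a x" "x \<in> El A a" by (auto simp: EA)
      have ix: "i a x \<in> El B a" by (rule i(1)[OF that(1) v(2)])
      then have "eB a (i a x) \<in> El ?B a" by (simp add: EB)
      moreover have "?i a v = eB a (i a x)" using that v by (simp add: dA)
      ultimately show ?thesis using that(1) ix v D(5)[OF that(1) v(2)] by (simp add: dB)
    qed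
    show "?H \<in> Nat C ?P ?B"
    proof (rule NatI[OF C.rs_closed_simplex_prod[OF cB]])
      show "eB a (H a (dB' a (fst p), snd p)) \<in> El ?B a" if "a \<in> Ob C" "p \<in> El ?P a" for a p
        using that Hin by (auto simp: EB dB)
      show "eB a (H a (dB' a (fst (Rs ?P a b f p)), snd (Rs ?P a b f p)))
        = Rs ?B a b f (eB b (H b (dB' b (fst p), snd p)))"
        if "a \<in> Ob C" "b \<in> Ob C" "f \<in> Ar C a b" "p \<in> El ?P b" for a b f p
        using that Hin Hnat by (auto simp: EB dB RB rB)
    qed
    fix a v assume a: "a \<in> Ob C" and "v \<in> El ?B a"
    then obtain x where v: "v = eB a x" "x \<in> El B a" by (auto simp: EB)
    have w: "vtx (dO a) j \<in> Ar Simp (dO a) 1" if "j \<le> 1" for j by (rule vtx_in[OF that])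
    show "?H a (v, vtx (dO a) 0) = v" using a v w[of 0] H(2) by (simp add: EB dB)
    show "?H a (v, vtx (dO a) 1) = ?i a (?r a v)"
      using a v w[of 1] H(3) r(1) by (simp add: EA EB dA dB)
  qed
  then show ?thesis by blast
qed

section \<open>The bar construction retracts onto a single object\<close>

lemma bar_El:
  "(Ys, v, \<phi>s) \<in> El (bar \<O> P) (c, k) \<longleftrightarrow> length Ys = Suc k \<and> set Ys \<subseteq> \<O> \<and> v \<in> El (POb P (Ys ! 0)) c
     \<and> length \<phi>s = k \<and> (\<forall>i<k. \<phi>s ! i \<in> El (Dpsh (Ys ! Suc i) (Ys ! i)) c)"
  by (simp add: bar_def)

lemma bar_Rs:
  "Rs (bar \<O> P) (a, l) (b, k) (f, \<theta>) (Ys, v, \<phi>s) =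
     (map (\<lambda>j. Ys ! \<theta> j) [0..<Suc l],
      Rs (POb P (Ys ! \<theta> 0)) a b f (P_act P (Ys ! 0) (Ys ! \<theta> 0) b (bar_arrow Ys \<phi>s b 0 (\<theta> 0)) v),
      map (\<lambda>j. compose a (bar_arrow Ys \<phi>s b (\<theta> j) (\<theta> (Suc j))) f) [0..<l])"
  by (simp add: bar_def Dpsh_Rs del: upt_Suc)

text \<open>A connected enriched groupoid of manifolds, with a chosen diffeomorphism from \<open>Y\<close> to each object.\<close>

locale diffeo_connected =
  fixes U :: "'V set set" and \<O> :: "'p omfd set" and P :: "('p, 'V) efun"
    and Y :: "'p omfd" and h :: "'p omfd \<Rightarrow> 'p \<Rightarrow> 'p"
  assumes Y_in: "Y \<in> \<O>"
    and oriented: "M \<in> \<O> \<Longrightarrow> oriented_manifold M"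
    and enriched: "enriched_functor U \<O> P"
    and h_diffeo: "M \<in> \<O> \<Longrightarrow> op_diffeo Y M (h M)"
    and h_Y: "h Y = (\<lambda>p. p)"
begin

lemma POb_presheaf: "M \<in> \<O> \<Longrightarrow> presheaf Cart (POb P M)"
  using enriched by (simp add: enriched_functor_def presheaf_in_def)

lemma PAr_Nat: "M \<in> \<O> \<Longrightarrow> N \<in> \<O> \<Longrightarrow> PAr P M N \<in> Nat Cart (Dpsh N M) (ihom Cart (POb P M) (POb P N))"
  using enriched by (simp add: enriched_functor_def)

lemma PAr_in:
  assumes "M \<in> \<O>" "N \<in> \<O>" "c \<in> Ob Cart" "\<phi> \<in> El (Dpsh N M) c"
  shows "PAr P M N c \<phi> \<in> Nat Cart (psh_prod (yoneda Cart c) (POb P M)) (POb P N)"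
  using NatD(1)[OF PAr_Nat[OF assms(1,2)] assms(3,4)] by (simp add: ihom_def)

lemma yoneda_simps [simp]:
  "El (yoneda C c) a = Ar C a c" "Rs (yoneda C c) a b f g = Cmp C a b c g f"
  by (simp_all add: yoneda_def)

lemma act_in:
  assumes "M \<in> \<O>" "N \<in> \<O>" "c \<in> Ob Cart" "\<phi> \<in> El (Dpsh N M) c" "v \<in> El (POb P M) c"
  shows "P_act P M N c \<phi> v \<in> El (POb P N) c"
  unfolding P_act_def by (rule NatD(1)[OF PAr_in[OF assms(1-4)] assms(3)]) (simp add: assms Cart.Ide_in)

lemma act_id:
  assumes "M \<in> \<O>" "c \<in> Ob Cart" "v \<in> El (POb P M) c"
  shows "P_act P M M c (D_id M c) v = v"
  using enriched assms by (simp add: enriched_functor_def P_act_def ihom_id_def Cart.Ide_in)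

lemma act_comp:
  assumes "M \<in> \<O>" "N \<in> \<O>" "K \<in> \<O>" "c \<in> Ob Cart" "\<phi> \<in> El (Dpsh N M) c" "\<psi> \<in> El (Dpsh K N) c"
    "v \<in> El (POb P M) c"
  shows "P_act P N K c \<psi> (P_act P M N c \<phi> v) = P_act P M K c (D_comp K c \<phi> \<psi>) v"
proof -
  have "PAr P M K c (D_comp K c \<phi> \<psi>) = ihom_comp Cart (POb P M) c (PAr P N K c \<psi>) (PAr P M N c \<phi>)"
    using enriched assms unfolding enriched_functor_def by blast
  then show ?thesis using assms by (simp add: P_act_def ihom_comp_def Cart.Ide_in)
qed

text \<open>Naturality of the action in the test space combines naturality of \<open>PAr\<close> with naturality of the
  elements of the internal hom.\<close>

lemma act_restrict:
  assumes "M \<in> \<O>" "N \<in> \<O>" "a \<in> Ob Cart" "b \<in> Ob Cart" "f \<in> Ar Cart a b" "\<phi> \<in> El (Dpsh N M) b"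
    "v \<in> El (POb P M) b"
  shows "Rs (POb P N) a b f (P_act P M N b \<phi> v) = P_act P M N a (compose a \<phi> f) (Rs (POb P M) a b f v)"
proof -
  have fv: "Rs (POb P M) a b f v \<in> El (POb P M) a"
    by (rule presheafD(1)[OF POb_presheaf[OF assms(1)] assms(3-5,7)])
  have "PAr P M N a (compose a \<phi> f) = Rs (ihom Cart (POb P M) (POb P N)) a b f (PAr P M N b \<phi>)"
    using NatD(2)[OF PAr_Nat[OF assms(1,2)] assms(3-6)] by (simp add: Dpsh_Rs)
  then have "P_act P M N a (compose a \<phi> f) (Rs (POb P M) a b f v)
    = PAr P M N b \<phi> a (Cmp Cart a a b f (Ide Cart a), Rs (POb P M) a b f v)"
    using assms fv by (simp add: P_act_def ihom_def Cart.Ide_in)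
  also have "Cmp Cart a a b f (Ide Cart a) = Cmp Cart a b b (Ide Cart b) f"
    using assms by (simp add: Cart.Cmp_Ide_left Cart.Cmp_Ide_right)
  also have "PAr P M N b \<phi> a (Cmp Cart a b b (Ide Cart b) f, Rs (POb P M) a b f v)
    = Rs (POb P N) a b f (PAr P M N b \<phi> b (Ide Cart b, v))"
    using NatD(2)[OF PAr_in[OF assms(1,2,4,6)] assms(3-5), of "(Ide Cart b, v)"] assms by (simp add: Cart.Ide_in)
  finally show ?thesis by (simp add: P_act_def)
qed

lemma D_id_in: "M \<in> \<O> \<Longrightarrow> c \<in> Ob Cart \<Longrightarrow> D_id M c \<in> El (Dpsh M M) c"
  unfolding D_id_const by (intro D_const_in oriented op_diffeo_id)

lemma D_comp_in:
  "M \<in> \<O> \<Longrightarrow> N \<in> \<O> \<Longrightarrow> K \<in> \<O> \<Longrightarrow> c \<in> Ob Cart \<Longrightarrow> \<phi> \<in> El (Dpsh N M) c \<Longrightarrow> \<psi> \<in> El (Dpsh K N) c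
    \<Longrightarrow> D_comp K c \<phi> \<psi> \<in> El (Dpsh K M) c"
  by (intro D_comp_closed[of M N K] oriented)

lemma bar_arrow_in:
  assumes c: "c \<in> Ob Cart" and Ys: "\<And>j. j \<le> k \<Longrightarrow> Ys ! j \<in> \<O>"
    and \<phi>s: "\<And>i. i < k \<Longrightarrow> \<phi>s ! i \<in> El (Dpsh (Ys ! Suc i) (Ys ! i)) c"
  shows "i \<le> j \<Longrightarrow> j \<le> k \<Longrightarrow> bar_arrow Ys \<phi>s c i j \<in> El (Dpsh (Ys ! j) (Ys ! i)) c"
proof (induction j)
  case 0
  then show ?case using D_id_in[OF Ys[of 0] c] by simp
next
  case (Suc j)
  show ?case
  proof (cases "i \<le> j")
    case True
    then show ?thesis using Suc \<phi>s[of j] D_comp_in[of "Ys ! i" "Ys ! j" "Ys ! Suc j" c] Ys c by simp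
  next
    case False
    then show ?thesis using Suc D_id_in[OF Ys[of "Suc j"] c] by (simp add: le_Suc_eq)
  qed
qed

lemma nth_map_Suc: "j \<le> l \<Longrightarrow> map F [0..<Suc l] ! j = F j"
  using nth_map_upt[of j "Suc l" 0 F] by simp

lemma bar_facts:
  assumes "(Ys, v, \<phi>s) \<in> El (bar \<O>' P) (c, k)" "\<O>' \<subseteq> \<O>"
  shows "\<And>j. j \<le> k \<Longrightarrow> Ys ! j \<in> \<O>'" "\<And>j. j \<le> k \<Longrightarrow> Ys ! j \<in> \<O>" "v \<in> El (POb P (Ys ! 0)) c"
    "\<And>i. i < k \<Longrightarrow> \<phi>s ! i \<in> El (Dpsh (Ys ! Suc i) (Ys ! i)) c" "length Ys = Suc k" "length \<phi>s = k"
proof -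
  have "set Ys \<subseteq> \<O>'" "length Ys = Suc k" using assms(1) by (auto simp: bar_El)
  then show "\<And>j. j \<le> k \<Longrightarrow> Ys ! j \<in> \<O>'" using nth_mem[of _ Ys] by auto
  then show "\<And>j. j \<le> k \<Longrightarrow> Ys ! j \<in> \<O>" using assms(2) by blast
qed (use assms(1) in \<open>auto simp: bar_El\<close>)

lemma rs_closed_bar:
  assumes O': "\<O>' \<subseteq> \<O>" shows "rs_closed CartS (bar \<O>' P)"
  unfolding rs_closed_def
proof (intro ballI)
  fix p q m x assume p: "p \<in> Ob CartS" "q \<in> Ob CartS" "m \<in> Ar CartS p q" and x: "x \<in> El (bar \<O>' P) q"
  obtain a l b k f \<theta> where e: "p = (a, l)" "q = (b, k)" "m = (f, \<theta>)" by (metis surj_pair)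
  obtain Ys v \<phi>s where x': "x = (Ys, v, \<phi>s)" by (metis surj_pair)
  have a: "a \<in> Ob Cart" "b \<in> Ob Cart" "f \<in> Ar Cart a b" "\<theta> \<in> Ar Simp l k" using p by (auto simp: e)
  note B = bar_facts[OF x[unfolded x' e] O'] and t = Simp_ArD[OF a(4)]
  have ba: "bar_arrow Ys \<phi>s b i j \<in> El (Dpsh (Ys ! j) (Ys ! i)) b" if "i \<le> j" "j \<le> k" for i j
    by (rule bar_arrow_in[OF a(2) B(2,4) that])
  have "Rs (POb P (Ys ! \<theta> 0)) a b f (P_act P (Ys ! 0) (Ys ! \<theta> 0) b (bar_arrow Ys \<phi>s b 0 (\<theta> 0)) v)
    \<in> El (POb P (Ys ! \<theta> 0)) a"
    using t[of 0] by (intro presheafD(1)[OF POb_presheaf] act_in ba B a) auto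
  moreover have "compose a (bar_arrow Ys \<phi>s b (\<theta> j) (\<theta> (Suc j))) f \<in> El (Dpsh (Ys ! \<theta> (Suc j)) (Ys ! \<theta> j)) a"
    if "j < l" for j
  proof -
    have "\<theta> j \<le> \<theta> (Suc j)" "\<theta> (Suc j) \<le> k" using t that by auto
    then show ?thesis
      using Dpsh_restrict[of "Ys ! \<theta> (Suc j)" "Ys ! \<theta> j" a b f] a oriented B(2) ba by (simp add: Dpsh_Rs)
  qed
  moreover have "set (map (\<lambda>j. Ys ! \<theta> j) [0..<Suc l]) \<subseteq> \<O>'" using B(1) t(1) by auto
  ultimately show "Rs (bar \<O>' P) p q m x \<in> El (bar \<O>' P) p"
    unfolding e x' bar_Rs bar_El by (simp add: nth_map_Suc del: upt_Suc)
qed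

text \<open>The last argument of \<open>tgt\<close>, \<open>fwd\<close> and \<open>bwd\<close> is a vertex of the \<open>1\<close>-simplex. At \<open>0\<close> the object stays where it
  is, at any other vertex it is moved to \<open>Y\<close>; \<open>fwd\<close> and \<open>bwd\<close> are the mutually inverse constant families
  between the moved object and the original one.\<close>

definition tgt :: "'p omfd \<Rightarrow> nat \<Rightarrow> 'p omfd" where
  "tgt M t = (if t = 0 then M else Y)"

definition fwd :: "pt set \<Rightarrow> 'p omfd \<Rightarrow> nat \<Rightarrow> pt \<Rightarrow> 'p \<Rightarrow> 'p" where
  "fwd c M t = (if t = 0 then D_id M c else D_const Y c (h M))"

definition bwd :: "pt set \<Rightarrow> 'p omfd \<Rightarrow> nat \<Rightarrow> pt \<Rightarrow> 'p \<Rightarrow> 'p" where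
  "bwd c M t = (if t = 0 then D_id M c else D_const M c (inv_into (points Y) (h M)))"

lemma tgt_in: "M \<in> \<O> \<Longrightarrow> tgt M t \<in> \<O>"
  using Y_in by (simp add: tgt_def)

lemma fwd_in: "M \<in> \<O> \<Longrightarrow> c \<in> Ob Cart \<Longrightarrow> fwd c M t \<in> El (Dpsh (tgt M t) M) c"
  by (auto simp: fwd_def tgt_def intro!: D_id_in D_const_in oriented Y_in h_diffeo)

lemma bwd_in: "M \<in> \<O> \<Longrightarrow> c \<in> Ob Cart \<Longrightarrow> bwd c M t \<in> El (Dpsh M (tgt M t)) c"
  by (auto simp: bwd_def tgt_def intro!: D_id_in D_const_in op_diffeo_inv oriented Y_in h_diffeo)

lemma bwd_fwd:
  assumes M: "M \<in> \<O>" and c: "c \<in> Ob Cart"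
  shows "D_comp (tgt M t) c (bwd c M t) (fwd c M t) = D_id (tgt M t) c"
proof (cases "t = 0")
  case True
  then show ?thesis using D_comp_id(1)[OF D_id_in[OF M c]] by (simp add: fwd_def bwd_def tgt_def)
next
  case False
  note d = op_diffeoD[OF h_diffeo[OF M]]
  have "D_comp Y c (D_const M c (inv_into (points Y) (h M))) (D_const Y c (h M))
    = D_const Y c (\<lambda>p. inv_into (points Y) (h M) (h M p))"
    by (rule D_comp_const) (rule smooth_map_points[OF d(3)])
  also have "\<dots> = D_id Y c" unfolding D_id_const
    by (rule D_const_cong) (rule bij_betw_inv_into_left[OF d(2)])
  finally show ?thesis using False by (simp add: fwd_def bwd_def tgt_def)
qed

lemma fwd_bwd:
  assumes M: "M \<in> \<O>" and c: "c \<in> Ob Cart"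
  shows "D_comp M c (fwd c M t) (bwd c M t) = D_id M c"
proof (cases "t = 0")
  case True
  then show ?thesis using D_comp_id(1)[OF D_id_in[OF M c]] by (simp add: fwd_def bwd_def)
next
  case False
  note d = op_diffeoD[OF h_diffeo[OF M]]
  have "D_comp M c (D_const Y c (h M)) (D_const M c (inv_into (points Y) (h M)))
    = D_const M c (\<lambda>p. h M (inv_into (points Y) (h M) p))"
    by (rule D_comp_const) (rule smooth_map_points[OF d(4)])
  also have "\<dots> = D_id M c" unfolding D_id_const
    by (rule D_const_cong) (rule bij_betw_inv_into_right[OF d(2)])
  finally show ?thesis using False by (simp add: fwd_def bwd_def)
qed

lemma fwd_bwd_restrict:
  assumes "f \<in> Ar Cart a b"
  shows "compose a (fwd b M t) f = fwd a M t" "compose a (bwd b M t) f = bwd a M t"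
  by (simp_all add: fwd_def bwd_def D_id_const D_const_restrict[OF assms])

lemma fwd_bwd_cancel:
  assumes "M \<in> \<O>" "K \<in> \<O>" "c \<in> Ob Cart" "\<phi> \<in> El (Dpsh K M) c"
  shows "D_comp K c (fwd c M t) (D_comp K c (bwd c M t) \<phi>) = \<phi>"
  using D_comp_assoc[OF assms(4), of "fwd c M t" "bwd c M t"] fwd_bwd[OF assms(1,3)] D_comp_id(2)[OF assms(4)]
  by simp

definition conjugate :: "pt set \<Rightarrow> 'p omfd \<Rightarrow> nat \<Rightarrow> 'p omfd \<Rightarrow> nat \<Rightarrow> (pt \<Rightarrow> 'p \<Rightarrow> 'p) \<Rightarrow> pt \<Rightarrow> 'p \<Rightarrow> 'p" where
  "conjugate c M s N t \<phi> = D_comp (tgt N t) c (bwd c M s) (D_comp (tgt N t) c \<phi> (fwd c N t))"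

lemma conjugate_in:
  "M \<in> \<O> \<Longrightarrow> N \<in> \<O> \<Longrightarrow> c \<in> Ob Cart \<Longrightarrow> \<phi> \<in> El (Dpsh N M) c
    \<Longrightarrow> conjugate c M s N t \<phi> \<in> El (Dpsh (tgt N t) (tgt M s)) c"
  unfolding conjugate_def
  by (rule D_comp_in[of _ M], simp_all add: tgt_in bwd_in) (rule D_comp_in[of _ N], simp_all add: tgt_in fwd_in)

lemma fwd_conjugate:
  assumes "M \<in> \<O>" "N \<in> \<O>" "c \<in> Ob Cart" "\<phi> \<in> El (Dpsh N M) c"
  shows "D_comp (tgt N t) c (fwd c M s) (conjugate c M s N t \<phi>) = D_comp (tgt N t) c \<phi> (fwd c N t)"
  unfolding conjugate_def
  by (rule fwd_bwd_cancel[OF assms(1) tgt_in[OF assms(2)] assms(3)])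
    (rule D_comp_in[of _ N], simp_all add: assms tgt_in fwd_in)

lemma conjugate_id:
  assumes M: "M \<in> \<O>" and c: "c \<in> Ob Cart"
  shows "conjugate c M t M t (D_id M c) = D_id (tgt M t) c"
  unfolding conjugate_def using D_comp_id(2)[OF fwd_in[OF M c]] bwd_fwd[OF M c] by simp

text \<open>The two inner factors \<open>fwd\<close> and \<open>bwd\<close> at \<open>N\<close> cancel.\<close>

lemma conjugate_comp:
  assumes M: "M \<in> \<O>" and N: "N \<in> \<O>" and K: "K \<in> \<O>" and c: "c \<in> Ob Cart"
    and \<phi>: "\<phi> \<in> El (Dpsh N M) c" and \<psi>: "\<psi> \<in> El (Dpsh K N) c"
  shows "D_comp (tgt K u) c (conjugate c M s N t \<phi>) (conjugate c N t K u \<psi>) = conjugate c M s K u (D_comp K c \<phi> \<psi>)"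
proof -
  have cj: "conjugate c N t K u \<psi> \<in> El (Dpsh (tgt K u) (tgt N t)) c" by (rule conjugate_in[OF N K c \<psi>])
  note fK = fwd_in[OF K c, of u]
  have "D_comp (tgt K u) c (conjugate c M s N t \<phi>) (conjugate c N t K u \<psi>)
    = D_comp (tgt K u) c (bwd c M s) (D_comp (tgt K u) c \<phi> (D_comp (tgt K u) c (fwd c N t) (conjugate c N t K u \<psi>)))"
    unfolding conjugate_def[of c M s N t \<phi>] by (simp add: D_comp_assoc[OF cj])
  also have "\<dots> = conjugate c M s K u (D_comp K c \<phi> \<psi>)"
    unfolding fwd_conjugate[OF N K c \<psi>] conjugate_def[of c M s K u] by (simp add: D_comp_assoc[OF fK])
  finally show ?thesis .
qed

lemma conjugate_restrict:
  "f \<in> Ar Cart a b \<Longrightarrow> compose a (conjugate b M s N t \<phi>) f = conjugate a M s N t (compose a \<phi> f)"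
  by (simp add: conjugate_def D_comp_restrict fwd_bwd_restrict)

text \<open>The \<open>j\<close>-th object of a simplex is moved according to the vertex \<open>g j\<close>, and all arrows are conjugated
  accordingly.\<close>

definition bar_homotopy :: "pt set \<times> nat \<Rightarrow> ('p, 'V) bar_el \<times> (nat \<Rightarrow> nat) \<Rightarrow> ('p, 'V) bar_el" where
  "bar_homotopy = (\<lambda>(c, k) ((Ys, v, \<phi>s), g).
     (map (\<lambda>j. tgt (Ys ! j) (g j)) [0..<Suc k],
      P_act P (Ys ! 0) (tgt (Ys ! 0) (g 0)) c (fwd c (Ys ! 0) (g 0)) v,
      map (\<lambda>j. conjugate c (Ys ! j) (g j) (Ys ! Suc j) (g (Suc j)) (\<phi>s ! j)) [0..<k]))"

lemma bar_homotopy_in: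
  assumes x: "x \<in> El (bar \<O> P) p" and p: "p \<in> Ob CartS"
  shows "bar_homotopy p (x, g) \<in> El (bar \<O> P) p"
proof -
  obtain c k where e: "p = (c, k)" by (metis surj_pair)
  obtain Ys v \<phi>s where x': "x = (Ys, v, \<phi>s)" by (metis surj_pair)
  have c: "c \<in> Ob Cart" using p by (simp add: e)
  note B = bar_facts[OF x[unfolded e x'] subset_refl]
  have "P_act P (Ys ! 0) (tgt (Ys ! 0) (g 0)) c (fwd c (Ys ! 0) (g 0)) v \<in> El (POb P (tgt (Ys ! 0) (g 0))) c"
    by (intro act_in tgt_in fwd_in B c) auto
  moreover have "conjugate c (Ys ! j) (g j) (Ys ! Suc j) (g (Suc j)) (\<phi>s ! j)
      \<in> El (Dpsh (tgt (Ys ! Suc j) (g (Suc j))) (tgt (Ys ! j) (g j))) c" if "j < k" for j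
    using that by (intro conjugate_in B c) auto
  moreover have "set (map (\<lambda>j. tgt (Ys ! j) (g j)) [0..<Suc k]) \<subseteq> \<O>" using B(2) tgt_in by auto
  ultimately show ?thesis
    unfolding e x' bar_homotopy_def by (simp add: bar_El nth_map_Suc del: upt_Suc)
qed

lemma bar_arrow_conjugate:
  assumes c: "c \<in> Ob Cart" and Ys: "\<And>j. j \<le> k \<Longrightarrow> Ys ! j \<in> \<O>"
    and \<phi>s: "\<And>i. i < k \<Longrightarrow> \<phi>s ! i \<in> El (Dpsh (Ys ! Suc i) (Ys ! i)) c"
    and Ys': "\<And>j. j \<le> k \<Longrightarrow> Ys' ! j = tgt (Ys ! j) (g j)"
    and \<phi>s': "\<And>j. j < k \<Longrightarrow> \<phi>s' ! j = conjugate c (Ys ! j) (g j) (Ys ! Suc j) (g (Suc j)) (\<phi>s ! j)"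
  shows "i \<le> j \<Longrightarrow> j \<le> k \<Longrightarrow> bar_arrow Ys' \<phi>s' c i j = conjugate c (Ys ! i) (g i) (Ys ! j) (g j) (bar_arrow Ys \<phi>s c i j)"
proof (induction j)
  case 0
  then show ?case using conjugate_id[OF Ys[of 0] c] Ys'[of 0] by simp
next
  case (Suc j)
  show ?case
  proof (cases "i \<le> j")
    case True
    have "bar_arrow Ys \<phi>s c i j \<in> El (Dpsh (Ys ! j) (Ys ! i)) c"
      using Suc.prems True by (intro bar_arrow_in[OF c Ys \<phi>s]) auto
    then show ?thesis
      using Suc True Ys'[of "Suc j"] \<phi>s'[of j] \<phi>s[of j]
        conjugate_comp[of "Ys ! i" "Ys ! j" "Ys ! Suc j" c "bar_arrow Ys \<phi>s c i j" "\<phi>s ! j"] Ys c by simp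
  next
    case False
    then have "i = Suc j" using Suc.prems by simp
    then show ?thesis using conjugate_id[OF Ys[of "Suc j"] c] Ys'[of "Suc j"] Suc.prems by simp
  qed
qed

text \<open>For the arrows, this says that conjugation commutes with composition and restriction. For the
  element of \<open>P\<close>, both sides are the action of the same composite, by \<open>fwd_conjugate\<close>. Since the restriction
  maps of the bar construction do not depend on the set of objects, \<open>\<O>'\<close> is arbitrary.\<close>

lemma bar_homotopy_natural:
  assumes p: "p \<in> Ob CartS" "q \<in> Ob CartS" "m \<in> Ar CartS p q" and x: "x \<in> El (bar \<O> P) q"
    and g: "g \<in> Ar Simp (snd q) 1"
  shows "bar_homotopy p (Rs (bar \<O> P) p q m x, Cmp Simp (snd p) (snd q) 1 g (snd m))
    = Rs (bar \<O>' P) p q m (bar_homotopy q (x, g))"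
proof -
  obtain a l b k f \<theta> where e: "p = (a, l)" "q = (b, k)" "m = (f, \<theta>)" by (metis surj_pair)
  obtain Ys v \<phi>s where x': "x = (Ys, v, \<phi>s)" by (metis surj_pair)
  have a: "a \<in> Ob Cart" "b \<in> Ob Cart" "f \<in> Ar Cart a b" "\<theta> \<in> Ar Simp l k" using p by (auto simp: e)
  note B = bar_facts[OF x[unfolded x' e] subset_refl] and t = Simp_ArD[OF a(4)]
  define g' where "g' = Cmp Simp l k 1 g \<theta>"
  have g': "g' j = g (\<theta> j)" if "j \<le> l" for j using that by (simp add: g'_def Simp_def compose_def)
  define Ys' where "Ys' = map (\<lambda>j. tgt (Ys ! j) (g j)) [0..<Suc k]"
  define \<phi>s' where "\<phi>s' = map (\<lambda>j. conjugate b (Ys ! j) (g j) (Ys ! Suc j) (g (Suc j)) (\<phi>s ! j)) [0..<k]"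
  define v' where "v' = P_act P (Ys ! 0) (tgt (Ys ! 0) (g 0)) b (fwd b (Ys ! 0) (g 0)) v"
  have Ys'n: "Ys' ! j = tgt (Ys ! j) (g j)" if "j \<le> k" for j using that by (simp add: Ys'_def nth_map_Suc del: upt_Suc)
  have \<phi>s'n: "\<phi>s' ! j = conjugate b (Ys ! j) (g j) (Ys ! Suc j) (g (Suc j)) (\<phi>s ! j)" if "j < k" for j
    using that by (simp add: \<phi>s'_def)
  have ba: "bar_arrow Ys \<phi>s b i j \<in> El (Dpsh (Ys ! j) (Ys ! i)) b" if "i \<le> j" "j \<le> k" for i j
    by (rule bar_arrow_in[OF a(2) B(2,4) that])
  have ba': "bar_arrow Ys' \<phi>s' b i j = conjugate b (Ys ! i) (g i) (Ys ! j) (g j) (bar_arrow Ys \<phi>s b i j)"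
    if "i \<le> j" "j \<le> k" for i j
    by (rule bar_arrow_conjugate[OF a(2) B(2,4) Ys'n \<phi>s'n that])
  have t0: "\<theta> 0 \<le> k" using t by simp
  (* The element of P: both sides are the restriction of the action of one composite in D(?T, Ys ! 0). *)
  let ?T = "tgt (Ys ! \<theta> 0) (g (\<theta> 0))" and ?\<beta> = "bar_arrow Ys \<phi>s b 0 (\<theta> 0)"
  let ?wz = "fwd b (Ys ! 0) (g 0)" and ?w = "fwd b (Ys ! \<theta> 0) (g (\<theta> 0))"
  have O: "Ys ! 0 \<in> \<O>" "Ys ! \<theta> 0 \<in> \<O>" "?T \<in> \<O>" "tgt (Ys ! 0) (g 0) \<in> \<O>" using B(2) t0 tgt_in by auto
  have \<beta>: "?\<beta> \<in> El (Dpsh (Ys ! \<theta> 0) (Ys ! 0)) b" by (rule ba) (use t0 in auto)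
  have w: "?w \<in> El (Dpsh ?T (Ys ! \<theta> 0)) b" by (rule fwd_in[OF O(2) a(2)])
  have w0: "?wz \<in> El (Dpsh (tgt (Ys ! 0) (g 0)) (Ys ! 0)) b" by (rule fwd_in[OF O(1) a(2)])
  have \<beta>': "bar_arrow Ys' \<phi>s' b 0 (\<theta> 0) = conjugate b (Ys ! 0) (g 0) (Ys ! \<theta> 0) (g (\<theta> 0)) ?\<beta>"
    by (rule ba') (use t0 in auto)
  have v1: "P_act P (Ys ! 0) (Ys ! \<theta> 0) b ?\<beta> v \<in> El (POb P (Ys ! \<theta> 0)) b"
    by (rule act_in[OF O(1,2) a(2) \<beta> B(3)])
  have "P_act P (Ys ! \<theta> 0) ?T a (fwd a (Ys ! \<theta> 0) (g (\<theta> 0)))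
      (Rs (POb P (Ys ! \<theta> 0)) a b f (P_act P (Ys ! 0) (Ys ! \<theta> 0) b ?\<beta> v))
    = Rs (POb P ?T) a b f (P_act P (Ys ! \<theta> 0) ?T b ?w (P_act P (Ys ! 0) (Ys ! \<theta> 0) b ?\<beta> v))"
    using act_restrict[OF O(2,3) a(1-3) w v1] by (simp add: fwd_bwd_restrict[OF a(3)])
  also have "P_act P (Ys ! \<theta> 0) ?T b ?w (P_act P (Ys ! 0) (Ys ! \<theta> 0) b ?\<beta> v)
    = P_act P (Ys ! 0) ?T b (D_comp ?T b ?\<beta> ?w) v"
    by (rule act_comp[OF O(1,2,3) a(2) \<beta> w B(3)])
  also have "D_comp ?T b ?\<beta> ?w = D_comp ?T b ?wz (bar_arrow Ys' \<phi>s' b 0 (\<theta> 0))"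
    unfolding \<beta>' by (rule fwd_conjugate[OF O(1,2) a(2) \<beta>, symmetric])
  also have "P_act P (Ys ! 0) ?T b (D_comp ?T b ?wz (bar_arrow Ys' \<phi>s' b 0 (\<theta> 0))) v
    = P_act P (tgt (Ys ! 0) (g 0)) ?T b (bar_arrow Ys' \<phi>s' b 0 (\<theta> 0)) v'"
    unfolding v'_def by (rule act_comp[OF O(1,4,3) a(2) w0 _ B(3), symmetric])
      (unfold \<beta>', rule conjugate_in[OF O(1,2) a(2) \<beta>])
  finally have V: "P_act P (Ys ! \<theta> 0) ?T a (fwd a (Ys ! \<theta> 0) (g (\<theta> 0)))
      (Rs (POb P (Ys ! \<theta> 0)) a b f (P_act P (Ys ! 0) (Ys ! \<theta> 0) b ?\<beta> v))
    = Rs (POb P (Ys' ! \<theta> 0)) a b f (P_act P (Ys' ! 0) (Ys' ! \<theta> 0) b (bar_arrow Ys' \<phi>s' b 0 (\<theta> 0)) v')"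
    by (simp add: Ys'n t0)
  have \<Phi>: "conjugate a (Ys ! \<theta> j) (g' j) (Ys ! \<theta> (Suc j)) (g' (Suc j)) (compose a (bar_arrow Ys \<phi>s b (\<theta> j) (\<theta> (Suc j))) f)
    = compose a (bar_arrow Ys' \<phi>s' b (\<theta> j) (\<theta> (Suc j))) f" if "j < l" for j
  proof -
    have "\<theta> j \<le> \<theta> (Suc j)" "\<theta> (Suc j) \<le> k" using t that by auto
    then show ?thesis using that by (simp add: ba' conjugate_restrict[OF a(3)] g')
  qed
  have "bar_homotopy p (Rs (bar \<O> P) p q m x, Cmp Simp (snd p) (snd q) 1 g (snd m))
    = (map (\<lambda>j. tgt (Ys ! \<theta> j) (g' j)) [0..<Suc l],
       P_act P (Ys ! \<theta> 0) (tgt (Ys ! \<theta> 0) (g' 0)) a (fwd a (Ys ! \<theta> 0) (g' 0))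
         (Rs (POb P (Ys ! \<theta> 0)) a b f (P_act P (Ys ! 0) (Ys ! \<theta> 0) b ?\<beta> v)),
       map (\<lambda>j. conjugate a (Ys ! \<theta> j) (g' j) (Ys ! \<theta> (Suc j)) (g' (Suc j))
         (compose a (bar_arrow Ys \<phi>s b (\<theta> j) (\<theta> (Suc j))) f)) [0..<l])"
    unfolding e x' bar_Rs bar_homotopy_def g'_def
    by (simp add: nth_map_Suc del: upt_Suc)
  also have "\<dots> = (map (\<lambda>j. Ys' ! \<theta> j) [0..<Suc l],
      Rs (POb P (Ys' ! \<theta> 0)) a b f (P_act P (Ys' ! 0) (Ys' ! \<theta> 0) b (bar_arrow Ys' \<phi>s' b 0 (\<theta> 0)) v'),
      map (\<lambda>j. compose a (bar_arrow Ys' \<phi>s' b (\<theta> j) (\<theta> (Suc j))) f) [0..<l])"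
    using V \<Phi> t(1) by (simp add: g' Ys'n del: upt_Suc)
  also have "\<dots> = Rs (bar \<O>' P) p q m (bar_homotopy q (x, g))"
    unfolding e x' bar_homotopy_def by (simp add: bar_Rs Ys'_def \<phi>s'_def v'_def del: upt_Suc)
  finally show ?thesis .
qed

text \<open>At the end \<open>0\<close> of the homotopy nothing moves. Neither does anything move on simplices all of whose
  objects are \<open>Y\<close>, because \<open>h Y\<close> is the identity; so the retraction is strict.\<close>

lemma bar_homotopy_trivial:
  assumes x: "(Ys, v, \<phi>s) \<in> El (bar \<O> P) (c, k)" and c: "c \<in> Ob Cart"
    and g: "\<And>j. j \<le> k \<Longrightarrow> g j = 0 \<or> Ys ! j = Y"
  shows "bar_homotopy (c, k) ((Ys, v, \<phi>s), g) = (Ys, v, \<phi>s)"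
proof -
  note B = bar_facts[OF x subset_refl]
  have "D_const Y c (inv_into (points Y) (\<lambda>p. p)) = D_id Y c"
    unfolding D_id_const by (rule D_const_cong) (simp add: inv_into_f_eq)
  then have T: "tgt (Ys ! j) (g j) = Ys ! j" "fwd c (Ys ! j) (g j) = D_id (Ys ! j) c"
    "bwd c (Ys ! j) (g j) = D_id (Ys ! j) c" if "j \<le> k" for j
  proof -
    have "g j = 0 \<or> (g j \<noteq> 0 \<and> Ys ! j = Y)" using g[OF that] by blast
    then show "tgt (Ys ! j) (g j) = Ys ! j" "fwd c (Ys ! j) (g j) = D_id (Ys ! j) c"
      "bwd c (Ys ! j) (g j) = D_id (Ys ! j) c"
      using \<open>D_const Y c (inv_into (points Y) (\<lambda>p. p)) = D_id Y c\<close>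
      by (elim disjE conjE, simp_all add: tgt_def fwd_def bwd_def h_Y D_id_const)+
  qed
  have "map (\<lambda>j. tgt (Ys ! j) (g j)) [0..<Suc k] = Ys"
    by (rule nth_equalityI) (use B(5) in \<open>auto simp: nth_map_Suc T simp del: upt_Suc\<close>)
  moreover have "P_act P (Ys ! 0) (tgt (Ys ! 0) (g 0)) c (fwd c (Ys ! 0) (g 0)) v = v"
    using act_id[OF B(2)[of 0] c B(3)] by (simp add: T)
  moreover have "map (\<lambda>j. conjugate c (Ys ! j) (g j) (Ys ! Suc j) (g (Suc j)) (\<phi>s ! j)) [0..<k] = \<phi>s"
    by (rule nth_equalityI) (use B(6) D_comp_id[OF B(4)] in \<open>auto simp: conjugate_def T\<close>)
  ultimately show ?thesis by (simp add: bar_homotopy_def del: upt_Suc)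
qed

lemma homotopy_retract_bar:
  "over_Simp.homotopy_retract CartS snd snd (bar {Y} P) (bar \<O> P)
     (\<lambda>p\<in>Ob CartS. \<lambda>x\<in>El (bar {Y} P) p. x)
     (\<lambda>p\<in>Ob CartS. \<lambda>x\<in>El (bar \<O> P) p. bar_homotopy p (x, vtx (snd p) 1))"
proof -
  interpret Q: over_Simp CartS snd snd by (rule over_Simp_snd[OF category_Cart])
  have YO: "{Y} \<subseteq> \<O>" using Y_in by simp
  note cY = rs_closed_bar[OF YO] and cO = rs_closed_bar[OF subset_refl]
  have sub: "x \<in> El (bar \<O> P) p" if "x \<in> El (bar {Y} P) p" for x p
    using that YO by (cases p; cases x) (auto simp: bar_El)
  have RsY: "Rs (bar {Y} P) = Rs (bar \<O> P)" by (simp add: bar_def)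
  have v: "vtx k j \<in> Ar Simp k 1" if "j \<le> 1" for j k by (rule vtx_in[OF that])
  have rY: "bar_homotopy p (x, vtx (snd p) 1) \<in> El (bar {Y} P) p" if p: "p \<in> Ob CartS" and x: "x \<in> El (bar \<O> P) p" for p x
  proof -
    obtain c k where e: "p = (c, k)" by (metis surj_pair)
    obtain Ys v \<phi>s where x': "x = (Ys, v, \<phi>s)" by (metis surj_pair)
    have "set (map (\<lambda>j. tgt (Ys ! j) (vtx k 1 j)) [0..<Suc k]) \<subseteq> {Y}" by (auto simp: tgt_def vtx_def)
    then show ?thesis
      using bar_homotopy_in[OF x p, of "vtx (snd p) 1"] unfolding e x' bar_homotopy_def
      by (simp add: bar_El del: upt_Suc)
  qed
  let ?P = "psh_prod (bar \<O> P) (simplex_over snd snd 1)"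
  show ?thesis
  proof (rule Q.homotopy_retractI[where H = "\<lambda>p\<in>Ob CartS. \<lambda>y\<in>El ?P p. bar_homotopy p y", OF cY cO])
    show "(\<lambda>p\<in>Ob CartS. \<lambda>x\<in>El (bar {Y} P) p. x) \<in> Nat CartS (bar {Y} P) (bar \<O> P)"
      by (rule NatI[OF cY]) (auto simp: sub RsY)
    show "(\<lambda>p\<in>Ob CartS. \<lambda>x\<in>El (bar \<O> P) p. bar_homotopy p (x, vtx (snd p) 1)) \<in> Nat CartS (bar \<O> P) (bar {Y} P)"
    proof (rule NatI[OF cO rY])
      fix p q m x assume p: "p \<in> Ob CartS" "q \<in> Ob CartS" "m \<in> Ar CartS p q" and x: "x \<in> El (bar \<O> P) q"
      have "snd m \<in> Ar Simp (snd p) (snd q)" using p by (cases p; cases q; cases m) auto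
      then show "bar_homotopy p (Rs (bar \<O> P) p q m x, vtx (snd p) 1)
        = Rs (bar {Y} P) p q m (bar_homotopy q (x, vtx (snd q) 1))"
        using bar_homotopy_natural[OF p x v[of 1]] by (simp add: Cmp_vtx)
    qed
    fix p and x :: "('p, 'V) bar_el" assume p: "p \<in> Ob CartS"
    obtain c k where e: "p = (c, k)" by (metis surj_pair)
    obtain Ys u \<phi>s where x': "x = (Ys, u, \<phi>s)" by (metis surj_pair)
    have c: "c \<in> Ob Cart" using p by (simp add: e)
    show "(\<lambda>p\<in>Ob CartS. \<lambda>x\<in>El (bar \<O> P) p. bar_homotopy p (x, vtx (snd p) 1)) p
        ((\<lambda>p\<in>Ob CartS. \<lambda>x\<in>El (bar {Y} P) p. x) p x) = x" if x: "x \<in> El (bar {Y} P) p"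
    proof -
      note xY = x[unfolded e x']
      have "bar_homotopy (c, k) ((Ys, u, \<phi>s), vtx k 1) = (Ys, u, \<phi>s)"
        using bar_facts(1)[OF xY YO] by (intro bar_homotopy_trivial[OF sub[OF xY] c]) auto
      then show ?thesis using c x sub[OF x] by (simp add: e x')
    qed
    assume x: "x \<in> El (bar \<O> P) p"
    have "bar_homotopy (c, k) ((Ys, u, \<phi>s), vtx k 0) = (Ys, u, \<phi>s)"
      by (rule bar_homotopy_trivial[OF x[unfolded e x'] c]) (simp add: vtx_def)
    then show "(\<lambda>p\<in>Ob CartS. \<lambda>y\<in>El ?P p. bar_homotopy p y) p (x, vtx (snd p) 0) = x"
      using p x v[of 0] by (simp add: e x')
    show "(\<lambda>p\<in>Ob CartS. \<lambda>y\<in>El ?P p. bar_homotopy p y) p (x, vtx (snd p) 1)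
      = (\<lambda>p\<in>Ob CartS. \<lambda>x\<in>El (bar {Y} P) p. x) p
        ((\<lambda>p\<in>Ob CartS. \<lambda>x\<in>El (bar \<O> P) p. bar_homotopy p (x, vtx (snd p) 1)) p x)"
      using p x v[of 1] rY[OF p x] by simp
  next
    show "(\<lambda>p\<in>Ob CartS. \<lambda>y\<in>El ?P p. bar_homotopy p y) \<in> Nat CartS ?P (bar \<O> P)"
    proof (rule NatI[OF Q.rs_closed_simplex_prod[OF cO]])
      fix p y assume "p \<in> Ob CartS" "y \<in> El ?P p"
      then show "bar_homotopy p y \<in> El (bar \<O> P) p" using bar_homotopy_in by (cases y) auto
    next
      fix p q m y assume p: "p \<in> Ob CartS" "q \<in> Ob CartS" "m \<in> Ar CartS p q" and "y \<in> El ?P q"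
      then obtain x g where y: "y = (x, g)" "x \<in> El (bar \<O> P) q" "g \<in> Ar Simp (snd q) 1" by auto
      show "bar_homotopy p (Rs ?P p q m y) = Rs (bar \<O> P) p q m (bar_homotopy q y)"
        using bar_homotopy_natural[OF p y(2,3)] by (simp add: y)
    qed
  qed
qed

end

lemma (in set_universe) small_bar:
  fixes P :: "('p, 'V) efun"
  assumes p: "small U (UNIV :: 'p set)" and P: "\<And>M. M \<in> \<O> \<Longrightarrow> El (POb P M) c \<in> U"
  shows "small U (El (bar \<O> P) (c, k))"
proof (rule small_subset)
  show "small U ((UNIV :: 'p omfd list set) \<times> (\<Union>M\<in>\<O>. El (POb P M) c) \<times> (UNIV :: (pt \<Rightarrow> 'p \<Rightarrow> 'p) list set))"
    by (intro small_Times small_list small_omfd small_UN small_member small_fun small_pt p P)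
  show "El (bar \<O> P) (c, k) \<subseteq> UNIV \<times> (\<Union>M\<in>\<O>. El (POb P M) c) \<times> UNIV"
  proof
    fix x assume x: "x \<in> El (bar \<O> P) (c, k)"
    obtain Ys v \<phi>s where x': "x = (Ys, v, \<phi>s)" by (metis surj_pair)
    have "Ys ! 0 \<in> \<O>" using x nth_mem[of 0 Ys] unfolding x' bar_El by auto
    then show "x \<in> UNIV \<times> (\<Union>M\<in>\<O>. El (POb P M) c) \<times> UNIV" using x unfolding x' bar_El by auto
  qed
qed

lemma (in set_universe) small_dugger:
  fixes Z :: "(pt set \<times> nat, (pt \<Rightarrow> pt) \<times> (nat \<Rightarrow> nat), 'e) psh"
  assumes "\<And>c. c \<in> Ob Cart \<Longrightarrow> small U (El Z (c, k))"
  shows "small U (El (dugger_Q Cart Z) (c, k))"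
proof (rule small_subset)
  show "small U ((UNIV :: pt set list set) \<times> (UNIV :: (pt \<Rightarrow> pt) set) \<times> (UNIV :: (pt \<Rightarrow> pt) list set)
      \<times> (\<Union>c\<in>Ob Cart. El Z (c, k)))"
    by (intro small_Times small_list small_set small_UN small_fun small_pt assms)
  show "El (dugger_Q Cart Z) (c, k) \<subseteq> UNIV \<times> UNIV \<times> UNIV \<times> (\<Union>c\<in>Ob Cart. El Z (c, k))"
  proof
    fix x assume x: "x \<in> El (dugger_Q Cart Z) (c, k)"
    obtain cs f fs z where x': "x = (cs, f, fs, z)" by (metis surj_pair)
    have "cs ! k \<in> Ob Cart" using x nth_mem[of k cs] unfolding x' Cart.dugger_El by auto
    then show "x \<in> UNIV \<times> UNIV \<times> UNIV \<times> (\<Union>c\<in>Ob Cart. El Z (c, k))" using x unfolding x' Cart.dugger_El by auto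
  qed
qed

lemma (in set_universe) small_end:
  assumes F: "css_functor U n F" and Z: "\<And>c k. c \<in> Ob Cart \<Longrightarrow> small U (El Z (c, k))" and p: "p \<in> Ob (SSp n)"
  shows "small U (El (end_cotensor n Z F) p)"
proof -
  obtain ms k where e: "p = (ms, k)" by (cases p)
  show ?thesis
  proof (rule small_subset)
    have "small U (El (FOb F c) (ms, j))" if "c \<in> Ob Cart" for c j
      by (rule small_member[OF css_functorD(2)[OF F that]]) (use p in \<open>simp add: e\<close>)
    then show "small U (\<Pi>\<^sub>E c\<in>Ob Cart. \<Pi>\<^sub>E j\<in>UNIV. (El Z (c, j) \<times> Ar Simp j k) \<rightarrow>\<^sub>E El (FOb F c) (ms, j))"
      by (intro small_PiE small_Times small_fun small_set small_pt small_nat Z)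
    show "El (end_cotensor n Z F) p \<subseteq> (\<Pi>\<^sub>E c\<in>Ob Cart. \<Pi>\<^sub>E j\<in>UNIV. (El Z (c, j) \<times> Ar Simp j k) \<rightarrow>\<^sub>E El (FOb F c) (ms, j))"
    proof
      fix \<alpha> assume "\<alpha> \<in> El (end_cotensor n Z F) p"
      note E = end_elim[OF this[unfolded e]]
      show "\<alpha> \<in> (\<Pi>\<^sub>E c\<in>Ob Cart. \<Pi>\<^sub>E j\<in>UNIV. (El Z (c, j) \<times> Ar Simp j k) \<rightarrow>\<^sub>E El (FOb F c) (ms, j))"
        using E(1,4,5) by (auto simp: PiE_iff)
    qed
  qed
qed

theorem theorem4p34:
  fixes elts :: "'V \<Rightarrow> 'V set" and S L XL :: 'V
    and Y :: "'p omfd" and P :: "('p, 'V) efun" and n :: nat and F :: "'V ffun"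
  assumes "zfc_model elts"
    and "grothendieck_universe elts S"
    and "grothendieck_universe elts L"
    and "grothendieck_universe elts XL"
    and "S \<in> elts L" and "L \<in> elts XL"
    and "small (sets_in elts S) (UNIV :: 'p set)"
    and "closed_oriented_manifold Y"
    and "enriched_functor (sets_in elts S) (component Y) P"
    and "css_functor (sets_in elts L) n F"
    and "projectively_fibrant (sets_in elts L) n F"
  shows "\<exists>f g.
      css_we (sets_in elts L) n
        (F_red_D (sets_in elts L) n F P Y) (F_red_coh (sets_in elts L) n F P Y) f
    \<and> css_we (sets_in elts L) n
        (F_red_coh (sets_in elts L) n F P Y) (F_red_D (sets_in elts L) n F P Y) g
    \<and> inverse_in_ho (sets_in elts L) n
        (F_red_D (sets_in elts L) n F P Y) (F_red_coh (sets_in elts L) n F P Y) f g"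
proof -
  define U where "U = sets_in elts L"
  interpret U: set_universe U unfolding U_def by (rule set_universe_sets_in[OF assms(1,3)])
  have SU: "sets_in elts S \<subseteq> U" unfolding U_def by (rule sets_in_mono[OF assms(3,5)])
  (* The values of P are sets in S, hence in L, so that all sizes can be measured in L. *)
  have F: "css_functor U n F" using assms(10) by (simp add: U_def)
  have p: "small U (UNIV :: 'p set)" by (rule small_mono[OF SU assms(7)])
  have Yo: "oriented_manifold Y" using assms(8) by (simp add: closed_oriented_manifold_def)
  have YO: "Y \<in> component Y" using Yo op_diffeo_id[OF Yo] by (auto simp: component_def)
  have "\<exists>h. op_diffeo Y M h" if "M \<in> component Y" for M
    using that op_diffeo_inv[OF _ Yo] by (auto simp: component_def)
  then have "\<exists>h. \<forall>M\<in>component Y. op_diffeo Y M (h M)" by (intro bchoice ballI)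
  then obtain h0 where h0: "\<forall>M\<in>component Y. op_diffeo Y M (h0 M)" by blast
  (* Overriding the choice at Y makes the retraction strict. *)
  define h where "h = h0(Y := \<lambda>p. p)"
  interpret D: diffeo_connected "sets_in elts S" "component Y" P Y h
    by unfold_locales (use YO h0 assms(9) op_diffeo_id[OF Yo] in \<open>auto simp: h_def component_def\<close>)
  interpret B: over_Simp "SSp n" snd snd by (rule over_Simp_SSp)
  let ?Z = "\<lambda>\<O>. dugger_Q Cart (bar \<O> P)"
  have PU: "El (POb P M) c \<in> U" if "M \<in> component Y" "c \<in> Ob Cart" for M c
    using assms(9) that SU unfolding enriched_functor_def presheaf_in_def by blast
  have sm: "small U (El (end_cotensor n (?Z \<O>) F) q)" if "\<O> \<subseteq> component Y" "q \<in> Ob (SSp n)" for \<O> q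
    by (intro U.small_end[OF F _ that(2)] U.small_dugger U.small_bar p PU) (use that in auto)
  have ps: "presheaf (SSp n) (end_cotensor n (?Z \<O>) F)" if "\<O> \<subseteq> component Y" for \<O>
    by (rule presheaf_end[OF F Cart.rs_closed_dugger[OF D.rs_closed_bar[OF that]]])
  have Ysub: "{Y} \<subseteq> component Y" using YO by simp
  let ?A = "copy_in U (SSp n) (end_cotensor n (?Z {Y}) F)"
  let ?B = "copy_in U (SSp n) (end_cotensor n (?Z (component Y)) F)"
  have "\<exists>f g. B.homotopy_retract ?A ?B f g"
    by (rule U.homotopy_retract_copy[OF over_Simp_SSp
          homotopy_retract_end[OF F Cart.homotopy_retract_dugger[OF D.homotopy_retract_bar]]])
      (use sm[OF Ysub] sm[OF subset_refl] in auto)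
  then obtain f g where R: "B.homotopy_retract ?A ?B f g" by blast
  have A: "presheaf_in U (SSp n) ?A" and B: "presheaf_in U (SSp n) ?B"
    using U.presheaf_in_copy[OF SSp_cat ps[OF Ysub] sm[OF Ysub]]
      U.presheaf_in_copy[OF SSp_cat ps[OF subset_refl] sm[OF subset_refl]] by auto
  note we = homotopy_retract_css_we[OF R A B]
  have "nat_comp (SSp n) ?A g f = nat_id (SSp n) ?A"
    using B.homotopy_retractD(5)[OF R] by (auto simp: nat_comp_def nat_id_def fun_eq_iff restrict_def)
  from strict_retract_inverse_in_ho[OF we this]
  show ?thesis using we unfolding F_red_D_def F_red_coh_def F_red_def U_def by blast
qed

end
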